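(* The solution of the fully implicit Crank-Nicolson discontinuous Galerkin scheme is unique for sufficiently small $\tau$. That is, there exists $\tau_*>0$, independent of $h$, such that for every mesh $\mathcal{K}_h$ of the family and every integer $N\ge1$ with $\tau=T/N\le\tau_*$, any two sequences $(u_h^n)_{n=0}^N$ in $V_h^k$ which satisfy $u_h^0=R_hu^0$ and, for every $n=1,\dots,N$, $$(D_\tau u_{h}^{n},v_{h})+(\nu + \mathrm{i}\alpha)\,a_h(\hat{u}_h^n, v_h)+(\kappa + \mathrm{i}\beta)\,(| \hat{u}^n_h |^2 \hat{u}_h^n,v_h)-\gamma\, (\hat{u}_h^n,v_h)=0\qquad \text{for all } v_h\in V_h^k $$ coincide.
   Context: Problem: $\Omega\subset\mathbb{R}^2$ is a bounded convex polygonal domain, $T>0$, and $\nu>0$, $\kappa>0$, $\alpha,\beta,\gamma$ are given real constants. $u^0$ is a sufficiently smooth complex-valued function on $\bar\Omega$ with zero boundary trace, and $u$ denotes the exact solution of the Ginzburg-Landau equation $u_t-(\nu+\mathrm{i}\alpha)\Delta u+(\kappa+\mathrm{i}\beta)|u|^2u-\gamma u=0$ in $\Omega\times(0,T]$ with $u=0$ on $\partial\Omega\times(0,T]$ and $u(\cdot,0)=u^0$. The exact solution is assumed to exist and be sufficiently smooth, e.g. $u\in C^3([0,T];H^{k+1}(\Omega)\cap H_0^1(\Omega))$. Inner product: $(u,v)=\int_\Omega u v^*\,\mathrm{d}\boldsymbol{x}$, where $v^*$ is the complex conjugate; $\|u\|=\sqrt{(u,u)}$ is the $L^2(\Omega)$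 norm. Mesh and space: $\{\mathcal{K}_h\}$ is a sequence of conforming quasi-uniform triangulations of $\Omega$ with mesh size $h$ (largest element diameter); $\mathcal{E}_h$ is the set of all edges, with interior edges $\mathcal{E}_h^i$ and boundary edges $\mathcal{E}_h^b$; $h_E$ is the length of $E$. Each edge $E$ has a fixed unit normal $\boldsymbol{n}_E$ (outward to $\Omega$ if $E\subset\partial\Omega$). For $E\in\mathcal{E}_h^i$ shared by $K_1,K_2$, where $\boldsymbol{n}_E$ points out of $K_1$, $\{v\}=\frac12(v|_{K_1}+v|_{K_2})$ and $[v]=v|_{K_1}-v|_{K_2}$; for $E\in\mathcal{E}_h^b$, $\{v\}=[v]=v|_K$. For a fixed integer $k\ge1$, $V_h^k=\{v_h\in L^2(\Omega;\mathbb{C}): v_h|_K\in\mathbb{P}_k(K)\ \forall K\in\mathcal{K}_h\}$, with $\mathbb{P}_k(K)$ the complex polynomials of total degree at most $k$. DG norm: $\|v_h\|_{\mathrm{DG}}=\big(\sum_{K}\int_K|\nabla v_h|^2\,\mathrm{d}\boldsymbol{x}+\sum_{E\in\mathcal{E}_h}\frac1{h_E}\int_E|[v_h]|^2\,\mathrm{d}s\big)^{1/2}$. Bilinear form (with $\nabla_h$ the piecewise gradient): $$a_h(v_h,w_h)=\int_\Omega\nabla_hv_h\cdot\nabla_hw_h^*\,\mathrm{d}\boldsymbol{x}-\sum_{E\in\mathcal{E}_h}\int_E\{\nabla_hv_h\}\cdot\boldsymbol{n}_E[w_h^*]\,\mathrm{d}s-\sum_{E\in\mathcal{E}_h}\int_E[v_h]\{\nabla_hw_h^*\}\cdot\boldsymbol{n}_E\,\mathrm{d}s+\sum_{E\in\mathcal{E}_h}\frac{\lambda}{h_E}\int_E[v_h][w_h^*]\,\mathrm{d}s,$$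 where the penalty parameter $\lambda$ is fixed sufficiently large (independently of $h$), so that there are constants $C_1,C_2>0$ independent of $h$ with $C_1\|v_h\|_{\mathrm{DG}}^2\le a_h(v_h,v_h)\le C_2\|v_h\|_{\mathrm{DG}}^2$ for all $v_h\in V_h^k$. Ritz projection: for $w\in H^{k+1}(\Omega)$, $R_hw\in V_h^k$ is defined by $a_h(R_hw,v_h)=-(\Delta w,v_h)$ for all $v_h\in V_h^k$. Time grid: $t_n=n\tau$, $D_\tau\phi^n=(\phi^n-\phi^{n-1})/\tau$, $\hat\phi^n=(\phi^n+\phi^{n-1})/2$. *)

theory Defs
  imports "HOL-Analysis.Analysis"
begin

type_synonym R2 = "real^2"

section \<open>Lebesgue and Sobolev spaces on a planar domain\<close>

text \<open>Elements of the function spaces are represented by functions on the whole plane, of which only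
  the values almost everywhere on the domain matter.\<close>

definition L2 :: "R2 set \<Rightarrow> (R2 \<Rightarrow> complex) set" where
  "L2 \<Omega> = {f. f \<in> borel_measurable (lebesgue_on \<Omega>) \<and>
              integrable (lebesgue_on \<Omega>) (\<lambda>x. (cmod (f x))\<^sup>2)}"

definition L2_inner :: "R2 set \<Rightarrow> (R2 \<Rightarrow> complex) \<Rightarrow> (R2 \<Rightarrow> complex) \<Rightarrow> complex" where
  "L2_inner \<Omega> u v = (LINT x|lebesgue_on \<Omega>. u x * cnj (v x))"

definition L2_norm :: "R2 set \<Rightarrow> (R2 \<Rightarrow> complex) \<Rightarrow> real" where
  "L2_norm \<Omega> u = sqrt (Re (L2_inner \<Omega> u u))"

definition partial_deriv :: "2 \<Rightarrow> (R2 \<Rightarrow> complex) \<Rightarrow> R2 \<Rightarrow> complex" where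
  "partial_deriv i f x = frechet_derivative f (at x) (axis i 1)"

primrec Cn :: "nat \<Rightarrow> (R2 \<Rightarrow> complex) \<Rightarrow> bool" where
  "Cn 0 f \<longleftrightarrow> continuous_on UNIV f"
| "Cn (Suc n) f \<longleftrightarrow> (\<forall>x. f differentiable (at x)) \<and> (\<forall>i. Cn n (partial_deriv i f))"

definition test_function :: "R2 set \<Rightarrow> (R2 \<Rightarrow> complex) \<Rightarrow> bool" where
  "test_function \<Omega> \<phi> \<longleftrightarrow>
     (\<forall>n. Cn n \<phi>) \<and> (\<exists>C. compact C \<and> C \<subseteq> \<Omega> \<and> (\<forall>x. x \<notin> C \<longrightarrow> \<phi> x = 0))"

definition has_weak_deriv ::
  "R2 set \<Rightarrow> nat \<Rightarrow> nat \<Rightarrow> (R2 \<Rightarrow> complex) \<Rightarrow> (R2 \<Rightarrow> complex) \<Rightarrow> bool" where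
  "has_weak_deriv \<Omega> a b f g \<longleftrightarrow> f \<in> L2 \<Omega> \<and> g \<in> L2 \<Omega> \<and>
     (\<forall>\<phi>. test_function \<Omega> \<phi> \<longrightarrow>
        (LINT x|lebesgue_on \<Omega>. f x * ((partial_deriv 1 ^^ a) ((partial_deriv 2 ^^ b) \<phi>)) x)
        = (-1) ^ (a + b) * (LINT x|lebesgue_on \<Omega>. g x * \<phi> x))"

text \<open>The choice below is unique up to a null set whenever a weak derivative exists.\<close>

definition weak_deriv :: "R2 set \<Rightarrow> nat \<Rightarrow> nat \<Rightarrow> (R2 \<Rightarrow> complex) \<Rightarrow> R2 \<Rightarrow> complex" where
  "weak_deriv \<Omega> a b f = (SOME g. has_weak_deriv \<Omega> a b f g)"

definition weak_laplacian :: "R2 set \<Rightarrow> (R2 \<Rightarrow> complex) \<Rightarrow> R2 \<Rightarrow> complex" where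
  "weak_laplacian \<Omega> f x = weak_deriv \<Omega> 2 0 f x + weak_deriv \<Omega> 0 2 f x"

definition Hm :: "nat \<Rightarrow> R2 set \<Rightarrow> (R2 \<Rightarrow> complex) set" where
  "Hm m \<Omega> = {f \<in> L2 \<Omega>. \<forall>a b. a + b \<le> m \<longrightarrow> (\<exists>g. has_weak_deriv \<Omega> a b f g)}"

definition Hm_norm :: "nat \<Rightarrow> R2 set \<Rightarrow> (R2 \<Rightarrow> complex) \<Rightarrow> real" where
  "Hm_norm m \<Omega> f = sqrt (\<Sum>a\<le>m. \<Sum>b\<le>m - a. (L2_norm \<Omega> (weak_deriv \<Omega> a b f))\<^sup>2)"

text \<open>Functions with zero boundary trace: the closure of the test functions in \<open>H\<^sup>1\<close>.\<close>

definition H10 :: "R2 set \<Rightarrow> (R2 \<Rightarrow> complex) set" where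
  "H10 \<Omega> = {f \<in> Hm 1 \<Omega>. \<exists>\<phi>. (\<forall>n. test_function \<Omega> (\<phi> n)) \<and>
      (\<lambda>n::nat. Hm_norm 1 \<Omega> (\<lambda>x. f x - \<phi> n x)) \<longlonglongrightarrow> 0}"

text \<open>Differentiability in time of a curve with values in \<open>H\<^sup>m\<close>; at the end points of the time
  interval the derivative is one-sided.\<close>

definition has_time_deriv ::
  "nat \<Rightarrow> R2 set \<Rightarrow> real \<Rightarrow> (real \<Rightarrow> R2 \<Rightarrow> complex) \<Rightarrow> (real \<Rightarrow> R2 \<Rightarrow> complex) \<Rightarrow> bool" where
  "has_time_deriv m \<Omega> T u u' \<longleftrightarrow> (\<forall>t\<in>{0..T}. u t \<in> Hm m \<Omega> \<and> u' t \<in> Hm m \<Omega> \<and>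
     ((\<lambda>s. Hm_norm m \<Omega> (\<lambda>x. (u s x - u t x) / of_real (s - t) - u' t x)) \<longlongrightarrow> 0)
       (at t within {0..T}))"

text \<open>The space \<open>C\<^sup>r([0,T]; H\<^sup>m \<inter> H\<^sub>0\<^sup>1)\<close>.\<close>

primrec C_time ::
  "nat \<Rightarrow> nat \<Rightarrow> R2 set \<Rightarrow> real \<Rightarrow> (real \<Rightarrow> R2 \<Rightarrow> complex) \<Rightarrow> bool" where
  "C_time 0 m \<Omega> T u \<longleftrightarrow> (\<forall>t\<in>{0..T}. u t \<in> Hm m \<Omega> \<inter> H10 \<Omega> \<and>
     ((\<lambda>s. Hm_norm m \<Omega> (\<lambda>x. u s x - u t x)) \<longlongrightarrow> 0) (at t within {0..T}))"
| "C_time (Suc r) m \<Omega> T u \<longleftrightarrow> (\<forall>t\<in>{0..T}. u t \<in> Hm m \<Omega> \<inter> H10 \<Omega>) \<and>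
     (\<exists>u'. has_time_deriv m \<Omega> T u u' \<and> C_time r m \<Omega> T u')"


section \<open>The Ginzburg--Landau problem\<close>

definition convex_polygonal_domain :: "R2 set \<Rightarrow> bool" where
  "convex_polygonal_domain \<Omega> \<longleftrightarrow>
     open \<Omega> \<and> \<Omega> \<noteq> {} \<and> bounded \<Omega> \<and> convex \<Omega> \<and> polytope (closure \<Omega>)"

text \<open>The homogeneous boundary condition is part of \<open>C_time\<close>, through \<open>H10\<close>.\<close>

definition GL_solution ::
  "nat \<Rightarrow> R2 set \<Rightarrow> real \<Rightarrow> real \<Rightarrow> real \<Rightarrow> real \<Rightarrow> real \<Rightarrow> real \<Rightarrow>
   (R2 \<Rightarrow> complex) \<Rightarrow> (real \<Rightarrow> R2 \<Rightarrow> complex) \<Rightarrow> bool" where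
  "GL_solution m \<Omega> T \<nu> \<alpha> \<kappa> \<beta> \<gamma> u0 u \<longleftrightarrow>
     C_time 3 m \<Omega> T u \<and>
     (AE x in lebesgue_on \<Omega>. u 0 x = u0 x) \<and>
     (\<exists>ut. has_time_deriv m \<Omega> T u ut \<and>
        (\<forall>t\<in>{0<..T}. AE x in lebesgue_on \<Omega>.
           ut t x - Complex \<nu> \<alpha> * weak_laplacian \<Omega> (u t) x
           + Complex \<kappa> \<beta> * of_real ((cmod (u t x))\<^sup>2) * u t x - of_real \<gamma> * u t x = 0))"


section \<open>Meshes\<close>

text \<open>A mesh is its set of closed triangles. The library notion \<open>triangulation\<close> says that any two of
  them meet in a common face (possibly empty), which is conformity.\<close>

definition conforming_mesh :: "R2 set \<Rightarrow> R2 set set \<Rightarrow> bool" where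
  "conforming_mesh \<Omega> M \<longleftrightarrow>
     triangulation M \<and> (\<forall>K\<in>M. 2 simplex K) \<and> \<Union>M = closure \<Omega>"

definition mesh_size :: "R2 set set \<Rightarrow> real" where
  "mesh_size M = Max (diameter ` M)"

definition quasi_uniform :: "(nat \<Rightarrow> R2 set set) \<Rightarrow> bool" where
  "quasi_uniform mesh \<longleftrightarrow>
     (\<exists>\<rho>>0. \<forall>j. \<forall>K\<in>mesh j. \<exists>x. ball x (\<rho> * mesh_size (mesh j)) \<subseteq> K)"

definition edges :: "R2 set set \<Rightarrow> R2 set set" where
  "edges M = {E. \<exists>K\<in>M. E edge_of K}"

definition boundary_edge :: "R2 set \<Rightarrow> R2 set \<Rightarrow> bool" where
  "boundary_edge \<Omega> E \<longleftrightarrow> E \<subseteq> frontier \<Omega>"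

text \<open>Outwardness on boundary edges is expressed through convexity of \<open>\<Omega>\<close>.\<close>

definition edge_normals :: "R2 set \<Rightarrow> R2 set set \<Rightarrow> (R2 set \<Rightarrow> R2) \<Rightarrow> bool" where
  "edge_normals \<Omega> M n \<longleftrightarrow> (\<forall>E\<in>edges M.
     norm (n E) = 1 \<and> (\<forall>x\<in>E. \<forall>y\<in>E. n E \<bullet> (y - x) = 0) \<and>
     (boundary_edge \<Omega> E \<longrightarrow> (\<forall>x\<in>E. \<forall>y\<in>\<Omega>. n E \<bullet> (y - x) \<le> 0)))"

text \<open>The two elements adjacent to an edge; the normal points out of the first one. On a boundary
  edge only the first one exists.\<close>

definition elem1 :: "R2 set set \<Rightarrow> (R2 set \<Rightarrow> R2) \<Rightarrow> R2 set \<Rightarrow> R2 set" where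
  "elem1 M n E = (THE K. K \<in> M \<and> E edge_of K \<and> (\<forall>x\<in>E. \<forall>y\<in>K. n E \<bullet> (y - x) \<le> 0))"

definition elem2 :: "R2 set set \<Rightarrow> (R2 set \<Rightarrow> R2) \<Rightarrow> R2 set \<Rightarrow> R2 set" where
  "elem2 M n E = (THE K. K \<in> M \<and> E edge_of K \<and> (\<forall>x\<in>E. \<forall>y\<in>K. n E \<bullet> (y - x) \<ge> 0))"

text \<open>Integral over a segment with respect to arc length.\<close>

definition edge_integral :: "R2 set \<Rightarrow> (R2 \<Rightarrow> 'b::{banach,second_countable_topology}) \<Rightarrow> 'b" where
  "edge_integral E f = (let (p, q) = (SOME (p, q). E = closed_segment p q)
     in dist p q *\<^sub>R (LINT t|lebesgue_on {0..1}. f (linepath p q t)))"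

text \<open>Averages and jumps of a piecewise defined function \<open>F\<close>, where \<open>F K\<close> is (the extension to the
  plane of) its restriction to the element \<open>K\<close>.\<close>

definition edge_avg ::
  "R2 set \<Rightarrow> R2 set set \<Rightarrow> (R2 set \<Rightarrow> R2) \<Rightarrow> R2 set \<Rightarrow> (R2 set \<Rightarrow> R2 \<Rightarrow> 'b::real_vector) \<Rightarrow> R2 \<Rightarrow> 'b" where
  "edge_avg \<Omega> M n E F x =
     (if boundary_edge \<Omega> E then F (elem1 M n E) x
      else (1/2) *\<^sub>R (F (elem1 M n E) x + F (elem2 M n E) x))"

definition edge_jump ::
  "R2 set \<Rightarrow> R2 set set \<Rightarrow> (R2 set \<Rightarrow> R2) \<Rightarrow> R2 set \<Rightarrow> (R2 set \<Rightarrow> R2 \<Rightarrow> 'b::real_vector) \<Rightarrow> R2 \<Rightarrow> 'b" where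
  "edge_jump \<Omega> M n E F x =
     (if boundary_edge \<Omega> E then F (elem1 M n E) x
      else F (elem1 M n E) x - F (elem2 M n E) x)"


section \<open>The discontinuous Galerkin space and forms\<close>

definition Pk :: "nat \<Rightarrow> (R2 \<Rightarrow> complex) set" where
  "Pk k = {p. \<exists>c :: nat \<Rightarrow> nat \<Rightarrow> complex.
      p = (\<lambda>x. \<Sum>a\<le>k. \<Sum>b\<le>k - a. c a b * of_real ((x$1) ^ a * (x$2) ^ b))}"

definition Vh :: "nat \<Rightarrow> R2 set \<Rightarrow> R2 set set \<Rightarrow> (R2 \<Rightarrow> complex) set" where
  "Vh k \<Omega> M = {v \<in> L2 \<Omega>. \<forall>K\<in>M. \<exists>p\<in>Pk k. AE x in lebesgue_on K. v x = p x}"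

text \<open>The restriction of a member of \<open>Vh\<close> to an element, as a polynomial; it supplies the traces on
  the edges and the elementwise gradient.\<close>

definition restr :: "(R2 \<Rightarrow> complex) \<Rightarrow> R2 set \<Rightarrow> R2 \<Rightarrow> complex" where
  "restr v K = (THE p. p \<in> (\<Union>k. Pk k) \<and> (AE x in lebesgue_on K. v x = p x))"

definition grad :: "(R2 \<Rightarrow> complex) \<Rightarrow> R2 \<Rightarrow> complex^2" where
  "grad p x = (\<chi> i. partial_deriv i p x)"

definition normal_comp :: "complex^2 \<Rightarrow> R2 \<Rightarrow> complex" where
  "normal_comp g n = (\<Sum>i\<in>UNIV. g$i * of_real (n$i))"

definition DG_norm ::
  "R2 set \<Rightarrow> R2 set set \<Rightarrow> (R2 set \<Rightarrow> R2) \<Rightarrow> (R2 \<Rightarrow> complex) \<Rightarrow> real" where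
  "DG_norm \<Omega> M n v = sqrt (
     (\<Sum>K\<in>M. LINT x|lebesgue_on K. (norm (grad (restr v K) x))\<^sup>2)
   + (\<Sum>E\<in>edges M. 1 / diameter E *
        edge_integral E (\<lambda>x. (cmod (edge_jump \<Omega> M n E (restr v) x))\<^sup>2)))"

text \<open>Conjugation commutes with restrictions, gradients, averages and jumps, so it is applied to the
  final values.\<close>

definition ah ::
  "R2 set \<Rightarrow> R2 set set \<Rightarrow> (R2 set \<Rightarrow> R2) \<Rightarrow> real \<Rightarrow> (R2 \<Rightarrow> complex) \<Rightarrow> (R2 \<Rightarrow> complex) \<Rightarrow> complex" where
  "ah \<Omega> M n lam v w =
     (\<Sum>K\<in>M. LINT x|lebesgue_on K.
        (\<Sum>i\<in>UNIV. grad (restr v K) x $ i * cnj (grad (restr w K) x $ i)))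
   - (\<Sum>E\<in>edges M. edge_integral E (\<lambda>x.
        normal_comp (edge_avg \<Omega> M n E (\<lambda>K. grad (restr v K)) x) (n E)
        * cnj (edge_jump \<Omega> M n E (restr w) x)))
   - (\<Sum>E\<in>edges M. edge_integral E (\<lambda>x.
        edge_jump \<Omega> M n E (restr v) x
        * cnj (normal_comp (edge_avg \<Omega> M n E (\<lambda>K. grad (restr w K)) x) (n E))))
   + (\<Sum>E\<in>edges M. of_real (lam / diameter E) * edge_integral E (\<lambda>x.
        edge_jump \<Omega> M n E (restr v) x * cnj (edge_jump \<Omega> M n E (restr w) x)))"

text \<open>\<open>ah\<close> is Hermitian, so \<open>ah v v\<close> is real and the estimates are stated for its real part.\<close>

definition penalty_admissible ::
  "nat \<Rightarrow> R2 set \<Rightarrow> (nat \<Rightarrow> R2 set set) \<Rightarrow> (nat \<Rightarrow> R2 set \<Rightarrow> R2) \<Rightarrow> real \<Rightarrow> bool" where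
  "penalty_admissible k \<Omega> mesh n lam \<longleftrightarrow>
     (\<exists>C1>0. \<exists>C2>0. \<forall>j. \<forall>v\<in>Vh k \<Omega> (mesh j).
        C1 * (DG_norm \<Omega> (mesh j) (n j) v)\<^sup>2 \<le> Re (ah \<Omega> (mesh j) (n j) lam v v) \<and>
        Re (ah \<Omega> (mesh j) (n j) lam v v) \<le> C2 * (DG_norm \<Omega> (mesh j) (n j) v)\<^sup>2)"

definition is_ritz_projection ::
  "nat \<Rightarrow> R2 set \<Rightarrow> R2 set set \<Rightarrow> (R2 set \<Rightarrow> R2) \<Rightarrow> real \<Rightarrow>
   (R2 \<Rightarrow> complex) \<Rightarrow> (R2 \<Rightarrow> complex) \<Rightarrow> bool" where
  "is_ritz_projection k \<Omega> M n lam w r \<longleftrightarrow> r \<in> Vh k \<Omega> M \<and>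
     (\<forall>v\<in>Vh k \<Omega> M. ah \<Omega> M n lam r v = - L2_inner \<Omega> (weak_laplacian \<Omega> w) v)"


section \<open>The Crank--Nicolson scheme\<close>

definition D_tau :: "real \<Rightarrow> (nat \<Rightarrow> R2 \<Rightarrow> complex) \<Rightarrow> nat \<Rightarrow> R2 \<Rightarrow> complex" where
  "D_tau \<tau> \<phi> n x = (\<phi> n x - \<phi> (n - 1) x) / of_real \<tau>"

definition midpt :: "(nat \<Rightarrow> R2 \<Rightarrow> complex) \<Rightarrow> nat \<Rightarrow> R2 \<Rightarrow> complex" where
  "midpt \<phi> n x = (\<phi> n x + \<phi> (n - 1) x) / 2"

definition CN_DG_solution ::
  "nat \<Rightarrow> R2 set \<Rightarrow> R2 set set \<Rightarrow> (R2 set \<Rightarrow> R2) \<Rightarrow> real \<Rightarrow>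
   real \<Rightarrow> real \<Rightarrow> real \<Rightarrow> real \<Rightarrow> real \<Rightarrow> (R2 \<Rightarrow> complex) \<Rightarrow> nat \<Rightarrow> real \<Rightarrow>
   (nat \<Rightarrow> R2 \<Rightarrow> complex) \<Rightarrow> bool" where
  "CN_DG_solution k \<Omega> M nrm lam \<nu> \<alpha> \<kappa> \<beta> \<gamma> u0 N \<tau> U \<longleftrightarrow>
     (\<forall>n\<le>N. U n \<in> Vh k \<Omega> M) \<and>
     is_ritz_projection k \<Omega> M nrm lam u0 (U 0) \<and>
     (\<forall>n\<in>{1..N}. \<forall>v\<in>Vh k \<Omega> M.
        L2_inner \<Omega> (D_tau \<tau> U n) v
        + Complex \<nu> \<alpha> * ah \<Omega> M nrm lam (midpt U n) v
        + Complex \<kappa> \<beta> *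
            L2_inner \<Omega> (\<lambda>x. of_real ((cmod (midpt U n x))\<^sup>2) * midpt U n x) v
        - of_real \<gamma> * L2_inner \<Omega> (midpt U n) v = 0)"

end

theory Submission
  imports Defs
begin

text \<open>Write \<open>g\<close> for the value at \<open>t\<^sub>n\<^sub>-\<^sub>1\<close>, \<open>w\<close> for the midpoint value and \<open>A v\<close> for \<open>a\<^sub>h(v, v)\<close>. No error estimate is
  needed; it suffices to bound \<open>A\<close> along the scheme uniformly in the mesh.

  The only analytic input is the inequality \<open>\<integral>|v|\<^sup>2\<^sup>m \<le> C A(v) \<integral>|v|\<^sup>2\<^sup>m\<^sup>-\<^sup>2\<close> for \<open>m = 1, 2, 3\<close>, with \<open>C\<close> independent of the
  mesh. It is the planar Gagliardo--Nirenberg--Sobolev argument applied to the piecewise polynomial \<open>v\<^sup>m\<close>: on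
  almost every line parallel to an axis, \<open>v\<^sup>m\<close> is bounded by the integral of its derivative plus the jumps
  across the edges that the line crosses, and a trace inequality for polynomials turns the jump terms into
  the DG norm.

  Testing one step with \<open>w\<close> bounds the \<open>L\<^sup>2\<close> norms and \<open>\<tau> \<Sum> A(w)\<close>. If \<open>A(g)\<close> is bounded, testing with \<open>w - g\<close> bounds
  \<open>A(w)\<close> and the \<open>L\<^sup>4\<close> norm of \<open>w\<close> without a factor \<open>1/\<tau>\<close>. Testing with \<open>(\<nu> + \<i>\<alpha>)(w - g)\<close> gives
  \<open>A(u\<^sup>n) - A(g) \<le> K \<tau> A(w)(1 + A(w))\<close>, so a discrete Gronwall argument keeps \<open>A\<close> bounded for small \<open>\<tau>\<close>. With the
  \<open>L\<^sup>4\<close> bounds on two midpoints \<open>w\<close>, \<open>z\<close> that start from the same value, the cubic term tested with \<open>w - z\<close> is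
  absorbed by \<open>\<nu> A(w - z)\<close> and by \<open>(2/\<tau>) \<parallel>w - z\<parallel>\<^sup>2\<close>.\<close>


section \<open>Polynomials and an inverse inequality\<close>

text \<open>The cubic term need not be monotone when |\<beta>| is large compared with \<kappa>, so
  the uniqueness argument for one step asks that \<tau> times the fourth power of the L^4 norm of
  the midpoints be small. The energy identity alone gives A(w) = O(1/\<tau>), hence only that this
  product is bounded; therefore A itself has to be controlled. The growth inequality for A is
  quadratic, yet one of its two factors A(w) is summable by the energy identity, with a bound that
  comes from the data alone. That factor can serve as the coefficient of a Gronwall argument, and
  the final bound on A is known before the induction starts. Of the three cases of the analytic
  inequality, m = 1 is a Poincare inequality, m = 2 is the L^4 estimate of Ladyzhenskaya type behind
  the bound for cubic differences, and m = 3 controls the L^2 norm of the cubic term.\<close>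

lemma poly_at_0_from_nodes:
  "\<exists>c :: nat \<Rightarrow> complex. \<forall>q. degree q < n \<longrightarrow> poly q 0 = (\<Sum>i=1..n. c i * poly q (of_nat i))"
proof (induction n)
  case 0
  show ?case by simp
next
  case (Suc n)
  then obtain c :: "nat \<Rightarrow> complex"
    where c: "\<And>q. degree q < n \<Longrightarrow> poly q 0 = (\<Sum>i=1..n. c i * poly q (of_nat i))" by blast
  let ?N = "of_nat (Suc n) :: complex"
  \<comment> \<open>Division of \<open>q\<close> by \<open>x - N\<close> gives
    \<open>q(x) = q(N) + (x - N) s(x)\<close> with \<open>s\<close> of lower degree; the induction
    hypothesis for \<open>s\<close> at \<open>0\<close> is rewritten through
    \<open>s(i) = (q(i) - q(N)) / (i - N)\<close>.\<close>
  define c' where "c' i = ?N * c i / (?N - of_nat i)" for i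
  define c'' where "c'' i = (if i = Suc n then 1 - (\<Sum>i=1..n. c' i) else c' i)" for i
  have "poly q 0 = (\<Sum>i=1..Suc n. c'' i * poly q (of_nat i))" if dq: "degree q < Suc n" for q
  proof -
    define s where "s = synthetic_div q ?N"
    have q: "poly q x = poly q ?N + (x - ?N) * poly s x" for x
    proof -
      have e: "q + smult ?N s = pCons (poly q ?N) s"
        unfolding s_def by (rule synthetic_div_correct)
      have "poly (q + smult ?N s) x = poly (pCons (poly q ?N) s) x"
        by (rule arg_cong[OF e])
      then show ?thesis by (simp add: algebra_simps)
    qed
    have s0: "poly s 0 = (\<Sum>i=1..n. c i * poly s (of_nat i))"
    proof (cases "n = 0")
      case True
      then have "degree q = 0" using dq by simp
      then have "s = 0" unfolding s_def by (metis degree_0_id synthetic_div_0 synthetic_div_pCons synthetic_div_eq_0_iff)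
      then show ?thesis by simp
    next
      case False
      then have "degree s < n" using dq by (simp add: s_def degree_synthetic_div)
      then show ?thesis by (rule c)
    qed
    have "poly q 0 = poly q ?N - ?N * poly s 0" using q[of 0] by (simp del: of_nat_Suc)
    also have "?N * poly s 0 = (\<Sum>i=1..n. - c' i * (poly q (of_nat i) - poly q ?N))"
      unfolding s0 sum_distrib_left
    proof (rule sum.cong[OF refl])
      fix i assume "i \<in> {1..n}"
      then have "of_nat i \<noteq> ?N" by (simp only: of_nat_eq_iff) auto
      then have "?N - of_nat i \<noteq> 0" by simp
      then show "?N * (c i * poly s (of_nat i)) = - c' i * (poly q (of_nat i) - poly q ?N)"
        using q[of "of_nat i"] by (simp add: c'_def divide_simps del: of_nat_Suc) (simp add: algebra_simps del: of_nat_Suc)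
    qed
    also have "poly q ?N - \<dots> = (\<Sum>i=1..n. c' i * poly q (of_nat i)) + (1 - (\<Sum>i=1..n. c' i)) * poly q ?N"
      by (simp add: algebra_simps sum_subtractf sum_negf sum_distrib_left sum_distrib_right)
    also have "\<dots> = (\<Sum>i=1..Suc n. c'' i * poly q (of_nat i))"
      by (simp add: c''_def)
    finally show ?thesis .
  qed
  then show ?case by blast
qed

text \<open>The inverse inequality and the uniqueness of restrictions look at a polynomial only
  along lines, so this is all that is kept of it. The degree bound is uniform in the line, which
  makes the number of nodes uniform.\<close>

definition line_poly :: "nat \<Rightarrow> (R2 \<Rightarrow> complex) \<Rightarrow> bool" where
  "line_poly m p \<longleftrightarrow> (\<forall>x d. \<exists>q. degree q \<le> m \<and> (\<forall>t::real. p (x + t *\<^sub>R d) = poly q (of_real t)))"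

lemma Pk_line_poly:
  assumes "p \<in> Pk k" shows "line_poly k p"
  unfolding line_poly_def
proof (intro allI)
  fix x d :: R2
  obtain c where p: "p = (\<lambda>x. \<Sum>a\<le>k. \<Sum>b\<le>k - a. c a b * of_real ((x$1) ^ a * (x$2) ^ b))"
    using assms unfolding Pk_def by auto
  let ?l = "\<lambda>i::2. [:of_real (x$i), of_real (d$i):] :: complex poly"
  let ?q = "\<Sum>a\<le>k. \<Sum>b\<le>k - a. smult (c a b) (?l 1 ^ a * ?l 2 ^ b)"
  have "degree (smult (c a b) (?l 1 ^ a * ?l 2 ^ b)) \<le> k" if "a \<le> k" "b \<le> k - a" for a b
  proof -
    have "degree (?l i ^ n) \<le> n" for i n
      by (rule order_trans[OF degree_power_le]) simp
    then have "degree (?l 1 ^ a * ?l 2 ^ b) \<le> a + b"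
      by (meson add_mono degree_mult_le order_trans)
    with that show ?thesis using degree_smult_le order_trans by fastforce
  qed
  then have "degree ?q \<le> k" by (intro degree_sum_le) auto
  moreover have "p (x + t *\<^sub>R d) = poly ?q (of_real t)" for t
    unfolding p by (simp add: poly_sum algebra_simps)
  ultimately show "\<exists>q. degree q \<le> k \<and> (\<forall>t::real. p (x + t *\<^sub>R d) = poly q (of_real t))" by blast
qed

lemma line_poly_diff:
  assumes "line_poly m p" "line_poly n q" shows "line_poly (max m n) (\<lambda>x. p x - q x)"
  unfolding line_poly_def
proof (intro allI)
  fix x d :: R2
  obtain a where a: "degree a \<le> m" "\<And>t::real. p (x + t *\<^sub>R d) = poly a (of_real t)"
    using assms(1) unfolding line_poly_def by blast
  obtain b where b: "degree b \<le> n" "\<And>t::real. q (x + t *\<^sub>R d) = poly b (of_real t)"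
    using assms(2) unfolding line_poly_def by blast
  show "\<exists>r. degree r \<le> max m n \<and> (\<forall>t::real. p (x + t *\<^sub>R d) - q (x + t *\<^sub>R d) = poly r (of_real t))"
    by (rule exI[of _ "a - b"]) (use a b in \<open>auto intro: degree_diff_le\<close>)
qed

text \<open>The line from a point of \<open>S\<close> to \<open>x\<close> stays in \<open>S\<close>
  for an interval of parameters, on which the univariate restriction has infinitely many
  roots.\<close>

lemma line_poly_zero_on_open:
  assumes "line_poly m p" "open S" "S \<noteq> {}" "\<And>x. x \<in> S \<Longrightarrow> p x = 0"
  shows "p x = 0"
proof -
  obtain y where y: "y \<in> S" using assms(3) by blast
  obtain q where q: "\<And>t::real. p (y + t *\<^sub>R (x - y)) = poly q (of_real t)"
    using assms(1) unfolding line_poly_def by blast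
  have "open ((\<lambda>t::real. y + t *\<^sub>R (x - y)) -` S)"
    by (intro open_vimage assms(2) continuous_intros)
  moreover have "0 \<in> (\<lambda>t::real. y + t *\<^sub>R (x - y)) -` S" using y by simp
  ultimately obtain e where e: "e > 0" "ball 0 e \<subseteq> (\<lambda>t::real. y + t *\<^sub>R (x - y)) -` S"
    using open_contains_ball by blast
  have "poly q (of_real t) = 0" if "t \<in> ball 0 e" for t :: real
    using e(2) that assms(4) q[of t] by auto
  then have "of_real ` ball 0 e \<subseteq> {z. poly q z = 0}" by auto
  moreover have "infinite (of_real ` ball (0::real) e :: complex set)"
  proof -
    have "ball (0::real) e = {-e<..<e}" by (auto simp: dist_real_def)
    then show ?thesis using e(1) by (subst finite_image_iff) (auto simp: inj_on_def)
  qed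
  ultimately have "q = 0" using poly_roots_finite finite_subset by blast
  then show ?thesis using q[of 1] by simp
qed

lemma sum_power_le_card:
  fixes f :: "'a \<Rightarrow> real"
  assumes "finite A" "\<And>i. i \<in> A \<Longrightarrow> f i \<ge> 0" "r > 0"
  shows "(\<Sum>i\<in>A. f i) ^ r \<le> real (card A) ^ r * (\<Sum>i\<in>A. f i ^ r)"
proof (cases "A = {}")
  case True then show ?thesis using assms(3) by (simp add: zero_power)
next
  case A: False
  define m where "m = Max (f ` A)"
  have m: "f i \<le> m" if "i \<in> A" for i using that assms(1) by (simp add: m_def)
  have "m \<in> f ` A" unfolding m_def using A assms(1) by (intro Max_in) auto
  then obtain j where j: "j \<in> A" "m = f j" by blast
  have "(\<Sum>i\<in>A. f i) \<le> real (card A) * m"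
    using sum_bounded_above[of A f m] m by simp
  then have "(\<Sum>i\<in>A. f i) ^ r \<le> (real (card A) * m) ^ r"
    by (intro power_mono sum_nonneg assms(2)) auto
  also have "\<dots> = real (card A) ^ r * m ^ r" by (simp add: power_mult_distrib)
  also have "m ^ r \<le> (\<Sum>i\<in>A. f i ^ r)"
    unfolding j by (rule member_le_sum) (use j assms in auto)
  finally show ?thesis by (simp add: mult_left_mono)
qed

lemma homothety_nn_integral:
  fixes f :: "'a::euclidean_space \<Rightarrow> ennreal"
  assumes "f \<in> borel_measurable borel" "\<theta> > 0"
  shows "(\<integral>\<^sup>+z. f (x + \<theta> *\<^sub>R (z - x)) \<partial>lborel) * ennreal (\<theta> ^ DIM('a)) = (\<integral>\<^sup>+z. f z \<partial>lborel)"
proof -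
  let ?T = "\<lambda>z. (x - \<theta> *\<^sub>R x) + \<theta> *\<^sub>R z"
  have "(\<integral>\<^sup>+z. f z \<partial>lborel) = (\<integral>\<^sup>+z. f z \<partial>density (distr lborel borel ?T) (\<lambda>_. ennreal (\<bar>\<theta>\<bar> ^ DIM('a))))"
    using lborel_affine[of \<theta> "x - \<theta> *\<^sub>R x"] assms(2) by simp
  also have "\<dots> = (\<integral>\<^sup>+z. ennreal (\<theta> ^ DIM('a)) * f (?T z) \<partial>lborel)"
    using assms by (subst nn_integral_density) (auto simp: nn_integral_distr)
  also have "\<dots> = (\<integral>\<^sup>+z. f (?T z) \<partial>lborel) * ennreal (\<theta> ^ DIM('a))"
    using assms(1) by (subst nn_integral_cmult) (auto simp: mult.commute)
  also have "(\<lambda>z. f (?T z)) = (\<lambda>z. f (x + \<theta> *\<^sub>R (z - x)))"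
    by (simp add: algebra_simps)
  finally show ?thesis by simp
qed

text \<open>The value at \<open>x\<close> is a fixed combination of the values at \<open>x + (i/n)(z - x)\<close> for \<open>1 \<le> i \<le> n\<close>;
  integrating over \<open>z \<in> K\<close> keeps these points in \<open>K\<close>, so the constant does not depend on the shape of \<open>K\<close>.\<close>

lemma inverse_inequality_nn:
  "\<exists>C>0. \<forall>p K x. line_poly m p \<longrightarrow> continuous_on UNIV p \<longrightarrow> compact K \<longrightarrow> convex K \<longrightarrow> x \<in> K \<longrightarrow>
     ennreal (cmod (p x) ^ r) * emeasure lborel K
       \<le> ennreal C * (\<integral>\<^sup>+z\<in>K. ennreal (cmod (p z) ^ r) \<partial>lborel)"
proof -
  obtain c :: "nat \<Rightarrow> complex"
    where c: "\<And>q. degree q < Suc m \<Longrightarrow> poly q 0 = (\<Sum>i=1..Suc m. c i * poly q (of_nat i))"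
    using poly_at_0_from_nodes by blast
  let ?n = "Suc m"
  define \<theta> where "\<theta> i = real i / real ?n" for i
  \<comment> \<open>\<open>D\<close> comes from the \<open>r\<close>-th power of the combination
    with coefficients \<open>c i\<close>. In \<open>C\<close> the factor
    \<open>1 / \<theta> i ^ 2\<close> is the inverse Jacobian of the planar contraction by
    \<open>\<theta> i\<close> towards \<open>x\<close>.\<close>
  define D where "D = real ?n ^ r * (1 + (\<Sum>i=1..?n. cmod (c i) ^ r))"
  define C where "C = D * (\<Sum>i=1..?n. 1 / \<theta> i ^ 2)"
  have D: "D > 0" unfolding D_def by (intro mult_pos_pos add_pos_nonneg sum_nonneg) auto
  have th: "0 < \<theta> i" "\<theta> i \<le> 1" if "i \<in> {1..?n}" for i using that by (auto simp: \<theta>_def field_simps)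
  have "1 / \<theta> i ^ 2 > 0" if "i \<in> {1..?n}" for i using th(1)[OF that] by simp
  then have "(\<Sum>i=1..?n. 1 / \<theta> i ^ 2) > 0" by (intro sum_pos) auto
  then have C: "C > 0" unfolding C_def using D by simp
  have main: "ennreal (cmod (p x) ^ r) * emeasure lborel K
       \<le> ennreal C * (\<integral>\<^sup>+z\<in>K. ennreal (cmod (p z) ^ r) \<partial>lborel)"
    if lp: "line_poly m p" and cont: "continuous_on UNIV p" and K: "compact K" "convex K" and x: "x \<in> K"
    for p :: "R2 \<Rightarrow> complex" and K x
  proof -
    have bp: "p \<in> borel_measurable borel" using cont by (rule borel_measurable_continuous_onI)
    have bK: "K \<in> sets borel" using K(1) by (simp add: borel_closed compact_imp_closed)
    have pt: "cmod (p x) ^ r \<le> D * (\<Sum>i=1..?n. cmod (p (x + \<theta> i *\<^sub>R (z - x))) ^ r)" for z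
    proof -
      obtain q where q: "degree q \<le> m" "\<And>t::real. p (x + t *\<^sub>R ((1 / real ?n) *\<^sub>R (z - x))) = poly q (of_real t)"
        using lp unfolding line_poly_def by blast
      have "poly q (of_nat i) = p (x + \<theta> i *\<^sub>R (z - x))" for i
        using q(2)[of "real i"] by (simp add: \<theta>_def)
      then have px: "p x = (\<Sum>i=1..?n. c i * p (x + \<theta> i *\<^sub>R (z - x)))"
        using c[of q] q(1) q(2)[of 0] by simp
      show ?thesis
      proof (cases "r = 0")
        \<comment> \<open>The exponent \<open>0\<close> does occur later: it is
          \<open>2 * (m - 1)\<close> for \<open>m = 1\<close>.\<close>
        case True
        have "1 \<le> (1 + real ?n) * real ?n" by (simp add: algebra_simps)
        then show ?thesis using True by (simp add: D_def)
      next
        case False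
        have "cmod (p x) \<le> (\<Sum>i=1..?n. cmod (c i) * cmod (p (x + \<theta> i *\<^sub>R (z - x))))"
          unfolding px by (rule order_trans[OF norm_sum]) (simp add: norm_mult)
        then have "cmod (p x) ^ r \<le> (\<Sum>i=1..?n. cmod (c i) * cmod (p (x + \<theta> i *\<^sub>R (z - x)))) ^ r"
          by (intro power_mono) auto
        also have "\<dots> \<le> real ?n ^ r * (\<Sum>i=1..?n. (cmod (c i) * cmod (p (x + \<theta> i *\<^sub>R (z - x)))) ^ r)"
          using sum_power_le_card[of "{1..?n}" "\<lambda>i. cmod (c i) * cmod (p (x + \<theta> i *\<^sub>R (z - x)))" r] False by auto
        also have "\<dots> \<le> real ?n ^ r * (\<Sum>i=1..?n. (1 + (\<Sum>i=1..?n. cmod (c i) ^ r)) * cmod (p (x + \<theta> i *\<^sub>R (z - x))) ^ r)"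
        proof (intro mult_left_mono sum_mono)
          fix i assume "i \<in> {1..?n}"
          then have "cmod (c i) ^ r \<le> (\<Sum>i=1..?n. cmod (c i) ^ r)" by (intro member_le_sum) auto
          then show "(cmod (c i) * cmod (p (x + \<theta> i *\<^sub>R (z - x)))) ^ r
            \<le> (1 + (\<Sum>i=1..?n. cmod (c i) ^ r)) * cmod (p (x + \<theta> i *\<^sub>R (z - x))) ^ r"
            unfolding power_mult_distrib by (intro mult_right_mono) auto
        qed auto
        also have "\<dots> = D * (\<Sum>i=1..?n. cmod (p (x + \<theta> i *\<^sub>R (z - x))) ^ r)"
          unfolding D_def by (simp only: sum_distrib_left[symmetric] mult.assoc)
        finally show ?thesis .
      qed
    qed
    define f where "f z = ennreal (cmod (p z) ^ r) * indicator K z" for z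
    have fm: "f \<in> borel_measurable borel" unfolding f_def using bp bK by measurable
    let ?I = "\<integral>\<^sup>+z. f z \<partial>lborel"
    have "ennreal (cmod (p x) ^ r) * emeasure lborel K = (\<integral>\<^sup>+z. ennreal (cmod (p x) ^ r) * indicator K z \<partial>lborel)"
      using bK by (simp add: nn_integral_cmult_indicator)
    also have "\<dots> \<le> (\<integral>\<^sup>+z. ennreal D * (\<Sum>i=1..?n. f (x + \<theta> i *\<^sub>R (z - x))) \<partial>lborel)"
    proof (rule nn_integral_mono)
      fix z
      show "ennreal (cmod (p x) ^ r) * indicator K z \<le> ennreal D * (\<Sum>i=1..?n. f (x + \<theta> i *\<^sub>R (z - x)))"
      proof (cases "z \<in> K")
        case True
        have "x + \<theta> i *\<^sub>R (z - x) \<in> K" if "i \<in> {1..?n}" for i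
        proof -
          have "(1 - \<theta> i) *\<^sub>R x + \<theta> i *\<^sub>R z \<in> K"
            using K(2) x True th[OF that] unfolding convex_alt by auto
          then show ?thesis by (simp add: algebra_simps)
        qed
        then have "(\<Sum>i=1..?n. f (x + \<theta> i *\<^sub>R (z - x))) = ennreal (\<Sum>i=1..?n. cmod (p (x + \<theta> i *\<^sub>R (z - x))) ^ r)"
          by (subst sum_ennreal[symmetric]) (auto simp: f_def simp del: sum.cl_ivl_Suc intro!: sum.cong)
        then show ?thesis using pt[of z] True D
          by (simp add: ennreal_mult[symmetric] sum_nonneg del: sum.cl_ivl_Suc)
      qed simp
    qed
    also have "\<dots> = ennreal D * (\<Sum>i=1..?n. \<integral>\<^sup>+z. f (x + \<theta> i *\<^sub>R (z - x)) \<partial>lborel)"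
      using fm by (subst nn_integral_cmult) (auto simp: nn_integral_sum simp del: sum.cl_ivl_Suc)
    also have "(\<Sum>i=1..?n. \<integral>\<^sup>+z. f (x + \<theta> i *\<^sub>R (z - x)) \<partial>lborel) = (\<Sum>i=1..?n. ennreal (1 / \<theta> i ^ 2) * ?I)"
    proof (rule sum.cong[OF refl])
      fix i assume i: "i \<in> {1..?n}"
      have "(\<integral>\<^sup>+z. f (x + \<theta> i *\<^sub>R (z - x)) \<partial>lborel) * ennreal (\<theta> i ^ 2) = ?I"
        using homothety_nn_integral[OF fm th(1)[OF i]] by simp
      then have eq: "?I = (\<integral>\<^sup>+z. f (x + \<theta> i *\<^sub>R (z - x)) \<partial>lborel) * ennreal (\<theta> i ^ 2)" by simp
      have "ennreal (1 / \<theta> i ^ 2) * ?I = (\<integral>\<^sup>+z. f (x + \<theta> i *\<^sub>R (z - x)) \<partial>lborel) * (ennreal (1 / \<theta> i ^ 2) * ennreal (\<theta> i ^ 2))"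
        unfolding eq by (simp only: mult_ac)
      also have "ennreal (1 / \<theta> i ^ 2) * ennreal (\<theta> i ^ 2) = 1"
        using th(1)[OF i] by (subst ennreal_mult[symmetric]) auto
      finally show "(\<integral>\<^sup>+z. f (x + \<theta> i *\<^sub>R (z - x)) \<partial>lborel) = ennreal (1 / \<theta> i ^ 2) * ?I" by simp
    qed
    also have "\<dots> = ennreal (\<Sum>i=1..?n. 1 / \<theta> i ^ 2) * ?I"
      by (subst sum_distrib_right[symmetric], subst sum_ennreal) auto
    also have "ennreal D * (\<dots>) = ennreal C * ?I"
      unfolding C_def using D by (subst ennreal_mult) (auto intro!: sum_nonneg simp: mult.assoc simp del: sum.cl_ivl_Suc)
    finally show ?thesis by (simp add: f_def)
  qed
  show ?thesis using C main by blast
qed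


section \<open>Edges and their adjacent elements\<close>

text \<open>This predicate and the next are the conditions of \<open>edge_normals\<close>,
  \<open>elem1\<close> and \<open>elem2\<close> for a single edge and a free vector, so that
  \<open>- n\<close> can take the place of \<open>n\<close>: the second element is the one with
  \<open>points_out (- n) E K\<close>.\<close>

definition unit_normal :: "R2 \<Rightarrow> R2 set \<Rightarrow> bool" where
  "unit_normal n E \<longleftrightarrow> norm n = 1 \<and> (\<forall>x\<in>E. \<forall>y\<in>E. n \<bullet> (y - x) = 0)"

definition points_out :: "R2 \<Rightarrow> R2 set \<Rightarrow> R2 set \<Rightarrow> bool" where
  "points_out n E K \<longleftrightarrow> (\<forall>x\<in>E. \<forall>y\<in>K. n \<bullet> (y - x) \<le> 0)"

lemma unit_normal_uminus [simp]: "unit_normal (- n) E \<longleftrightarrow> unit_normal n E"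
  by (simp add: unit_normal_def)

lemma orthogonal_parallel_R2:
  fixes n v w :: R2
  assumes "n \<noteq> 0" "w \<noteq> 0" "n \<bullet> w = 0" "n \<bullet> v = 0"
  shows "\<exists>\<mu>. v = \<mu> *\<^sub>R w"
proof -
  have n: "n$1 \<noteq> 0 \<or> n$2 \<noteq> 0" and w: "w$1 \<noteq> 0 \<or> w$2 \<noteq> 0"
    using assms(1,2) by (auto simp: vec_eq_iff forall_2)
  have nw: "n$1 * w$1 = - (n$2 * w$2)" and nv: "n$1 * v$1 = - (n$2 * v$2)"
    using assms(3,4) by (auto simp: inner_vec_def sum_2)
  have "n$1 * (v$1 * w$2) = n$1 * (v$2 * w$1)" "n$2 * (v$1 * w$2) = n$2 * (v$2 * w$1)"
    using nw nv by algebra+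
  then have c: "v$1 * w$2 = v$2 * w$1" using n by auto
  show ?thesis
  proof (cases "w$1 = 0")
    case True
    then have "v = (v$2 / w$2) *\<^sub>R w" using w c by (auto simp: vec_eq_iff forall_2)
    then show ?thesis ..
  next
    case False
    then have "v = (v$1 / w$1) *\<^sub>R w" using c by (auto simp: vec_eq_iff forall_2 field_simps)
    then show ?thesis ..
  qed
qed

text \<open>A face of a simplex is the hull of a subset of its vertices, and dimension one leaves
  exactly two of them. Naming the third vertex gives barycentric coordinates for the later arguments
  on a single triangle.\<close>

lemma edge_of_triangle:
  fixes K :: "R2 set"
  assumes "2 simplex K" "E edge_of K"
  obtains p q r where "E = closed_segment p q" "K = convex hull {p,q,r}" "p \<noteq> q" "\<not> collinear {p,q,r}"
proof -
  obtain C where C: "\<not> affine_dependent C" "int (card C) = 3" "K = convex hull C" "finite C"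
    using assms(1) unfolding simplex by auto
  obtain c where c: "c \<subseteq> C" "E = convex hull c"
    using assms(2) face_of_convex_hull_affine_independent[OF C(1)] C(3) unfolding edge_of_def by blast
  have fc: "finite c" using c(1) C(4) finite_subset by blast
  have nc: "\<not> affine_dependent c" using C(1) c(1) affine_dependent_subset by blast
  have "int (card c) = 2"
    using assms(2) c(2) aff_dim_affine_independent[OF nc] unfolding edge_of_def by (simp add: aff_dim_convex_hull)
  then have "card c = 2" by simp
  then obtain p q where pq: "c = {p,q}" "p \<noteq> q" by (meson card_2_iff)
  have "card (C - c) = 1" using C(2,4) \<open>card c = 2\<close> c(1) fc by (simp add: card_Diff_subset)
  then obtain r where r: "C - c = {r}" by (meson card_1_singletonE)
  then have Cp: "C = {p,q,r}" "r \<noteq> p" "r \<noteq> q" using pq c(1) by auto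
  show thesis
  proof
    show "E = closed_segment p q" using c(2) pq(1) by (simp add: segment_convex_hull)
    show "K = convex hull {p,q,r}" using C(3) Cp by simp
    show "\<not> collinear {p,q,r}" using C(1) Cp pq(2) collinear_3_eq_affine_dependent[of p q r] by auto
  qed (rule pq(2))
qed

lemma triangle_edge_side:
  assumes "unit_normal n (closed_segment p q)" "p \<noteq> q" "\<not> collinear {p,q,r}"
  shows "n \<bullet> (q - p) = 0" "n \<bullet> (r - p) \<noteq> 0"
proof -
  show nq: "n \<bullet> (q - p) = 0" using assms(1) by (simp add: unit_normal_def)
  show "n \<bullet> (r - p) \<noteq> 0"
  proof
    assume "n \<bullet> (r - p) = 0"
    moreover have "n \<noteq> 0" using assms(1) by (auto simp: unit_normal_def)
    moreover have "q - p \<noteq> 0" using assms(2) by simp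
    ultimately obtain \<mu> where rp: "r - p = \<mu> *\<^sub>R (q - p)"
      using orthogonal_parallel_R2[OF _ _ nq] by blast
    have "r = p + (r - p)" by simp
    also have "\<dots> = (1 - \<mu>) *\<^sub>R p + \<mu> *\<^sub>R q"
      unfolding rp by (simp add: scaleR_diff_left scaleR_diff_right)
    finally have r: "r = (1 - \<mu>) *\<^sub>R p + \<mu> *\<^sub>R q" .
    have "r \<in> affine hull {p,q}" unfolding affine_hull_2
      by (rule CollectI, rule exI[of _ "1-\<mu>"], rule exI[of _ \<mu>]) (use r in simp)
    then have "collinear {p,q,r}"
      unfolding collinear_affine_hull by (intro exI[of _ p] exI[of _ q]) (simp add: hull_inc)
    then show False using assms(3) by simp
  qed
qed

text \<open>For \<open>x\<close> on the edge and \<open>y\<close> in \<open>K\<close>,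
  \<open>n \<bullet> (y - x)\<close> equals \<open>n \<bullet> (r - p)\<close> times the barycentric
  coordinate of \<open>y\<close> at the opposite vertex \<open>r\<close>. That coordinate is
  nonnegative, so the sign cannot change on \<open>K\<close>.\<close>

lemma points_out_cases:
  assumes "2 simplex K" "E edge_of K" "unit_normal n E"
  shows "points_out n E K \<or> points_out (- n) E K"
proof -
  obtain p q r where E: "E = closed_segment p q" and K: "K = convex hull {p,q,r}"
    and pq: "p \<noteq> q" and nc: "\<not> collinear {p,q,r}"
    using edge_of_triangle[OF assms(1,2)] by blast
  have n: "n \<bullet> (q - p) = 0" using triangle_edge_side[OF _ pq nc] assms(3) E by auto
  have *: "n \<bullet> (y - x) = w * (n \<bullet> (r - p))" if "x \<in> E" "y = u *\<^sub>R p + v *\<^sub>R q + w *\<^sub>R r" "u + v + w = 1" for x y u v w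
  proof -
    have "n \<bullet> (x - p) = 0" using assms(3) that(1) E by (simp add: unit_normal_def)
    moreover have "y - x = v *\<^sub>R (q - p) + w *\<^sub>R (r - p) - (x - p)"
      unfolding that(2) using that(3) by (simp add: algebra_simps) (metis add.assoc scaleR_add_left scaleR_one)
    ultimately show ?thesis using n by (simp add: inner_diff_right inner_add_right)
  qed
  have "n \<bullet> (y - x) = 0 \<or> sgn (n \<bullet> (y - x)) = sgn (n \<bullet> (r - p))" if x: "x \<in> E" and y: "y \<in> K" for x y
  proof -
    obtain u v w where "y = u *\<^sub>R p + v *\<^sub>R q + w *\<^sub>R r" "u + v + w = 1" "0 \<le> w"
      using y unfolding K convex_hull_3 by auto
    then show ?thesis using *[OF x] by (auto simp: sgn_mult)
  qed
  then show ?thesis unfolding points_out_def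
    by (smt (verit) inner_minus_left sgn_neg sgn_pos sgn_0)
qed

text \<open>The direction splits as \<open>d = \<mu> (q - p) + l (r - p)\<close> with
  \<open>l > 0\<close>. In the relative interior of the edge the coordinates of \<open>p\<close> and
  \<open>q\<close> are positive, so a short move along \<open>d\<close> keeps all three coordinates
  nonnegative.\<close>

lemma inward_direction:
  assumes "2 simplex K" "E edge_of K" "unit_normal n E" "points_out n E K"
    and "x \<in> rel_interior E" "n \<bullet> d < 0"
  shows "\<exists>s0>0. \<forall>s\<in>{0..s0}. x + s *\<^sub>R d \<in> K"
proof -
  obtain p q r where E: "E = closed_segment p q" and K: "K = convex hull {p,q,r}"
    and pq: "p \<noteq> q" and nc: "\<not> collinear {p,q,r}"
    using edge_of_triangle[OF assms(1,2)] by blast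
  have n: "n \<bullet> (q - p) = 0" "n \<bullet> (r - p) \<noteq> 0" using triangle_edge_side[OF _ pq nc] assms(3) E by auto
  have "r \<in> K" unfolding K by (simp add: hull_inc)
  then have nr: "n \<bullet> (r - p) < 0" using assms(4) n(2) E ends_in_segment(1)[of p q] unfolding points_out_def by (meson less_eq_real_def)
  have "x \<in> open_segment p q"
    using assms(5) pq unfolding E by (simp add: rel_interior_closed_segment)
  then obtain t where t: "0 < t" "t < 1" "x = (1 - t) *\<^sub>R p + t *\<^sub>R q"
    unfolding in_segment by blast
  define l where "l = (n \<bullet> d) / (n \<bullet> (r - p))"
  have lpos: "l > 0" unfolding l_def using nr assms(6) by (simp add: divide_neg_neg)
  have "n \<bullet> (d - l *\<^sub>R (r - p)) = 0" using nr by (simp add: inner_diff_right l_def)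
  moreover have "n \<noteq> 0" using assms(3) by (auto simp: unit_normal_def)
  moreover have "q - p \<noteq> 0" using pq by simp
  ultimately obtain \<mu> where dl: "d - l *\<^sub>R (r - p) = \<mu> *\<^sub>R (q - p)"
    using orthogonal_parallel_R2[OF _ _ n(1)] by blast
  have d: "d = \<mu> *\<^sub>R (q - p) + l *\<^sub>R (r - p)" unfolding dl[symmetric] by simp
  define s0 where "s0 = min t (1 - t) / (1 + \<bar>\<mu>\<bar> + l)"
  have s0: "s0 > 0" unfolding s0_def using t lpos by (auto intro!: divide_pos_pos)
  have "x + s *\<^sub>R d \<in> K" if s: "s \<in> {0..s0}" for s
  proof -
    have "s * (1 + \<bar>\<mu>\<bar> + l) \<le> min t (1 - t)"
      using s lpos by (auto simp: s0_def pos_le_divide_eq)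
    then have b: "s + s * \<bar>\<mu>\<bar> + s * l \<le> t" "s + s * \<bar>\<mu>\<bar> + s * l \<le> 1 - t" by (auto simp: algebra_simps)
    have s0': "s \<ge> 0" using s by simp
    have "\<bar>s * \<mu>\<bar> \<le> s * \<bar>\<mu>\<bar>" using s0' by (simp add: abs_mult)
    moreover have "0 \<le> s * l" "0 \<le> s * \<bar>\<mu>\<bar>" using s0' lpos by auto
    ultimately have sm: "s * \<mu> \<le> s * \<bar>\<mu>\<bar>" "- (s * \<mu>) \<le> s * \<bar>\<mu>\<bar>" "0 \<le> s * l" "0 \<le> s * \<bar>\<mu>\<bar>" "s \<ge> 0"
      using s0' by (auto simp: abs_le_iff)
    have "x + s *\<^sub>R d = (1 - t - s * \<mu> - s * l) *\<^sub>R p + (t + s * \<mu>) *\<^sub>R q + (s * l) *\<^sub>R r"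
      unfolding t(3) d by (simp add: algebra_simps)
    moreover have "0 \<le> 1 - t - s * \<mu> - s * l" "0 \<le> t + s * \<mu>" using b sm by linarith+
    ultimately show ?thesis unfolding K convex_hull_3 using sm
      by (intro CollectI exI[of _ "1 - t - s * \<mu> - s * l"] exI[of _ "t + s * \<mu>"] exI[of _ "s * l"]) auto
  qed
  then show ?thesis using s0 by blast
qed

lemma edge_of_convex_closed:
  assumes "2 simplex (K :: R2 set)" "E edge_of K"
  shows "convex E" "closed E" "E \<noteq> {}" "rel_interior E \<noteq> {}" "E \<subseteq> K" "compact E"
proof -
  obtain p q where E: "E = closed_segment p q" using edge_of_triangle[OF assms] by metis
  show "convex E" "closed E" "E \<noteq> {}" "compact E" unfolding E by auto
  then show "rel_interior E \<noteq> {}" by (simp add: rel_interior_eq_empty)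
  show "E \<subseteq> K" using assms(2) by (rule edge_of_imp_subset)
qed

lemma triangulation_face_Int:
  assumes "triangulation M" "K \<in> M" "K' \<in> M"
  shows "K \<inter> K' face_of K" "K \<inter> K' face_of K'"
proof -
  have "K \<inter> K' face_of K" "K' \<inter> K face_of K'"
    using assms unfolding triangulation_def by blast+
  then show "K \<inter> K' face_of K" "K \<inter> K' face_of K'" by (auto simp: Int_commute)
qed

text \<open>Both triangles contain points just inside \<open>E\<close>. Their common face is
  therefore larger than \<open>E\<close>, has dimension two, and is all of both.\<close>

lemma unique_element_on_side:
  assumes "triangulation M" "K \<in> M" "K' \<in> M" "2 simplex K" "2 simplex K'"
    and "E edge_of K" "E edge_of K'" "unit_normal n E" "points_out n E K" "points_out n E K'"
  shows "K = K'"
proof -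
  obtain x where x: "x \<in> rel_interior E" using edge_of_convex_closed[OF assms(4,6)] by blast
  have nn: "n \<bullet> n = 1" using assms(8) by (simp add: unit_normal_def dot_square_norm)
  obtain s1 where s1: "s1 > 0" "\<forall>s\<in>{0..s1}. x + s *\<^sub>R (- n) \<in> K"
    using inward_direction[OF assms(4,6,8,9) x, of "- n"] nn by auto
  obtain s2 where s2: "s2 > 0" "\<forall>s\<in>{0..s2}. x + s *\<^sub>R (- n) \<in> K'"
    using inward_direction[OF assms(5,7,8,10) x, of "- n"] nn by auto
  define y where "y = x + min s1 s2 *\<^sub>R (- n)"
  have y: "y \<in> K \<inter> K'" using s1 s2 by (auto simp: y_def)
  have xE: "x \<in> E" using x rel_interior_subset by blast
  have "n \<bullet> (y - x) \<noteq> 0" using s1(1) s2(1) nn by (auto simp: y_def)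
  then have "y \<notin> E" using assms(8) xE by (auto simp: unit_normal_def)
  have f: "K \<inter> K' face_of K" "K \<inter> K' face_of K'"
    using triangulation_face_Int[OF assms(1-3)] .
  have "E face_of (K \<inter> K')"
    using assms(6,7) unfolding edge_of_def by (meson face_of_imp_subset face_of_subset le_inf_iff inf_le1)
  then have "aff_dim E < aff_dim (K \<inter> K')"
    using \<open>y \<notin> E\<close> y f(1) by (intro face_of_aff_dim_lt) (auto dest: face_of_imp_convex)
  then have "aff_dim (K \<inter> K') \<ge> 2" using assms(6) by (simp add: edge_of_def)
  moreover have "aff_dim K = 2" "aff_dim K' = 2" using assms(4,5) by (auto dest: aff_dim_simplex)
  ultimately have "K \<inter> K' = K" "K \<inter> K' = K'"
    using face_of_aff_dim_lt[OF _ f(1)] face_of_aff_dim_lt[OF _ f(2)] convex_simplex assms(4,5) by fastforce+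
  then show ?thesis by blast
qed

text \<open>Some relative interior point \<open>x\<close> of \<open>E\<close> lies in the open
  domain, and near \<open>x\<close> only elements containing \<open>x\<close> occur. A point
  slightly beyond \<open>E\<close> lies in such an element \<open>K'\<close>; its common face with
  \<open>K\<close> contains \<open>x\<close>, hence \<open>E\<close>, and misses that point, so it
  has dimension one and equals \<open>E\<close>.\<close>

lemma element_across_edge:
  assumes "open \<Omega>" "conforming_mesh \<Omega> M" "K \<in> M" "E edge_of K" "unit_normal n E" "points_out n E K"
    and "\<not> E \<subseteq> frontier \<Omega>"
  shows "\<exists>K'\<in>M. E edge_of K' \<and> points_out (- n) E K'"
proof -
  have M: "triangulation M" "\<And>K. K \<in> M \<Longrightarrow> 2 simplex K" "\<Union>M = closure \<Omega>" "finite M"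
    using assms(2) by (auto simp: conforming_mesh_def triangulation_def)
  note E = edge_of_convex_closed[OF M(2)[OF assms(3)] assms(4)]
  obtain z where z: "z \<in> E" "z \<notin> frontier \<Omega>" using assms(7) by blast
  have "z \<in> closure \<Omega>" using z(1) E(5) assms(3) M(3) by blast
  then have "z \<in> \<Omega>" using z(2) assms(1) by (simp add: frontier_def interior_open)
  have "closure (rel_interior E) = E" using E(1,2) by (simp add: convex_closure_rel_interior)
  then have "rel_interior E \<inter> \<Omega> \<noteq> {}"
    using open_Int_closure_eq_empty[OF assms(1), of "rel_interior E"] \<open>z \<in> \<Omega>\<close> z(1) by blast
  then obtain x where x: "x \<in> rel_interior E" "x \<in> \<Omega>" by blast
  have xE: "x \<in> E" using x rel_interior_subset by blast
  let ?N = "\<Union>{K'\<in>M. x \<notin> K'}"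
  have "closed ?N" using M(2,4) by (intro closed_Union) (auto dest: closed_simplex)
  then have "open (\<Omega> - ?N)" using assms(1) by blast
  then obtain e where e: "e > 0" "ball x e \<subseteq> \<Omega> - ?N" using x(2) openE by (metis (no_types, lifting) DiffI UnionE mem_Collect_eq)
  have nn: "n \<bullet> n = 1" "norm n = 1" using assms(5) by (auto simp: unit_normal_def dot_square_norm)
  define y where "y = x + (e/2) *\<^sub>R n"
  have "y \<in> ball x e" using e(1) nn by (simp add: y_def dist_norm)
  then have y: "y \<in> \<Omega>" "y \<notin> ?N" using e(2) by auto
  then obtain K' where K': "K' \<in> M" "y \<in> K'" "x \<in> K'" using M(3) closure_subset by blast
  have f: "K \<inter> K' face_of K" "K \<inter> K' face_of K'"
    using triangulation_face_Int[OF M(1) assms(3) K'(1)] .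
  have EF: "E \<subseteq> K \<inter> K'"
    using subset_of_face_of[OF f(1) E(5)] x(1) xE E(5) K'(3) by blast
  have nyx: "n \<bullet> (y - x) > 0" using e(1) nn by (simp add: y_def)
  have "y \<notin> K" using assms(6) xE nyx unfolding points_out_def by fastforce
  then have "K \<inter> K' \<noteq> K'" using K'(2) by blast
  then have "aff_dim (K \<inter> K') < aff_dim K'"
    by (rule face_of_aff_dim_lt[OF convex_simplex[OF M(2)[OF K'(1)]] f(2)])
  then have "aff_dim (K \<inter> K') < 2" using aff_dim_simplex[OF M(2)[OF K'(1)]] by simp
  moreover have "E face_of (K \<inter> K')" using assms(4) EF unfolding edge_of_def by (meson face_of_subset inf_le1)
  moreover have "aff_dim E = 1" using assms(4) by (simp add: edge_of_def)
  ultimately have "E = K \<inter> K'"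
    using face_of_aff_dim_lt[of "K \<inter> K'" E] f(1) face_of_imp_convex by force
  then have "E edge_of K'" using f(2) \<open>aff_dim E = 1\<close> by (simp add: edge_of_def)
  moreover have "\<not> points_out n E K'" using xE K'(2) nyx unfolding points_out_def by fastforce
  ultimately show ?thesis using points_out_cases[OF M(2)[OF K'(1)] _ assms(5)] K'(1) by blast
qed

text \<open>By convexity the whole domain lies on the inner side of the outward normal, and so does
  every element; uniqueness on one side then leaves a single element at \<open>E\<close>.\<close>

lemma boundary_edge_elements:
  assumes "conforming_mesh \<Omega> M" "edge_normals \<Omega> M n" "E \<in> edges M" "boundary_edge \<Omega> E"
  shows "{K\<in>M. E edge_of K} = {elem1 M n E}" "points_out (n E) E (elem1 M n E)"
proof -
  have M: "triangulation M" "\<And>K. K \<in> M \<Longrightarrow> 2 simplex K" "\<Union>M = closure \<Omega>"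
    using assms(1) by (auto simp: conforming_mesh_def)
  have un: "unit_normal (n E) E" using assms(2,3) by (simp add: edge_normals_def unit_normal_def)
  have po: "points_out (n E) E K" if "K \<in> M" for K
    unfolding points_out_def
  proof (intro ballI)
    fix x y assume x: "x \<in> E" and "y \<in> K"
    then have y: "y \<in> closure \<Omega>" using that M(3) by blast
    have "\<forall>y\<in>\<Omega>. n E \<bullet> (y - x) \<le> 0"
      using assms(2-4) x unfolding edge_normals_def by blast
    then have "\<Omega> \<subseteq> {y. n E \<bullet> y \<le> n E \<bullet> x}"
      by (auto simp: inner_diff_right)
    then have "closure \<Omega> \<subseteq> {y. n E \<bullet> y \<le> n E \<bullet> x}"
      by (intro closure_minimal closed_halfspace_le) auto
    then show "n E \<bullet> (y - x) \<le> 0" using y by (auto simp: inner_diff_right)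
  qed
  obtain K where K: "K \<in> M" "E edge_of K" using assms(3) by (auto simp: edges_def)
  have uni: "K' = K" if "K' \<in> M" "E edge_of K'" for K'
    using unique_element_on_side[OF M(1) that(1) K(1) M(2) M(2) that(2) K(2) un po po] that(1) K(1) by blast
  have "elem1 M n E = K"
    unfolding elem1_def
  proof (rule the_equality)
    show "K \<in> M \<and> E edge_of K \<and> (\<forall>x\<in>E. \<forall>y\<in>K. n E \<bullet> (y - x) \<le> 0)"
      using K po[OF K(1)] unfolding points_out_def by blast
  qed (use uni in blast)
  then show "{K\<in>M. E edge_of K} = {elem1 M n E}" "points_out (n E) E (elem1 M n E)"
    using K po uni by blast+
qed

text \<open>An edge that is not contained in the frontier has an element on either side, and each
  side carries only one. Besides listing the neighbours this makes the descriptions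
  \<open>elem1\<close> and \<open>elem2\<close> meaningful.\<close>

lemma interior_edge_elements:
  assumes "open \<Omega>" "conforming_mesh \<Omega> M" "edge_normals \<Omega> M n" "E \<in> edges M" "\<not> boundary_edge \<Omega> E"
  shows "{K\<in>M. E edge_of K} = {elem1 M n E, elem2 M n E}" "elem1 M n E \<noteq> elem2 M n E"
    "points_out (n E) E (elem1 M n E)" "points_out (- n E) E (elem2 M n E)"
proof -
  have M: "triangulation M" "\<And>K. K \<in> M \<Longrightarrow> 2 simplex K"
    using assms(2) by (auto simp: conforming_mesh_def)
  have un: "unit_normal (n E) E" using assms(3,4) by (simp add: edge_normals_def unit_normal_def)
  have nf: "\<not> E \<subseteq> frontier \<Omega>" using assms(5) by (simp add: boundary_edge_def)
  obtain K where K: "K \<in> M" "E edge_of K" using assms(4) by (auto simp: edges_def)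
  have "\<exists>K1\<in>M. \<exists>K2\<in>M. E edge_of K1 \<and> E edge_of K2 \<and> points_out (n E) E K1 \<and> points_out (- n E) E K2"
    using points_out_cases[OF M(2)[OF K(1)] K(2) un]
  proof
    assume po: "points_out (n E) E K"
    then show ?thesis using element_across_edge[OF assms(1,2) K un po nf] K by blast
  next
    assume po: "points_out (- n E) E K"
    then show ?thesis using element_across_edge[OF assms(1,2) K _ po nf] un K by auto
  qed
  then obtain K1 K2 where K1: "K1 \<in> M" "E edge_of K1" "points_out (n E) E K1"
    and K2: "K2 \<in> M" "E edge_of K2" "points_out (- n E) E K2" by blast
  have u1: "K' = K1" if "K' \<in> M" "E edge_of K'" "points_out (n E) E K'" for K'
    using unique_element_on_side[OF M(1) that(1) K1(1) M(2) M(2) that(2) K1(2) un that(3) K1(3)] that(1) K1(1) by blast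
  have u2: "K' = K2" if "K' \<in> M" "E edge_of K'" "points_out (- n E) E K'" for K'
    using unique_element_on_side[OF M(1) that(1) K2(1) M(2) M(2) that(2) K2(2) _ that(3) K2(3)] that(1) K2(1) un by simp
  have e1: "elem1 M n E = K1"
    unfolding elem1_def by (rule the_equality) (use K1 u1 in \<open>unfold points_out_def, blast+\<close>)
  have e2: "elem2 M n E = K2"
  proof -
    have po: "points_out (- n E) E K \<longleftrightarrow> (\<forall>x\<in>E. \<forall>y\<in>K. n E \<bullet> (y - x) \<ge> 0)" for K
      by (simp add: points_out_def)
    show ?thesis
      unfolding elem2_def by (rule the_equality) (use K2 u2 in \<open>unfold po, blast+\<close>)
  qed
  have "K1 \<noteq> K2"
  proof
    assume eq: "K1 = K2"
    obtain x where x: "x \<in> rel_interior E" using edge_of_convex_closed[OF M(2)[OF K1(1)] K1(2)] by blast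
    have nn: "n E \<bullet> n E = 1" using un by (simp add: unit_normal_def dot_square_norm)
    obtain s where s: "s > 0" "\<forall>s'\<in>{0..s}. x + s' *\<^sub>R (- n E) \<in> K1"
      using inward_direction[OF M(2)[OF K1(1)] K1(2) un K1(3) x, of "- n E"] nn by auto
    then have "x + s *\<^sub>R (- n E) \<in> K2" using eq by auto
    moreover have "x \<in> E" using x rel_interior_subset by blast
    ultimately have "- n E \<bullet> ((x + s *\<^sub>R (- n E)) - x) \<le> 0" using K2(3) unfolding points_out_def by blast
    then show False using s(1) nn by simp
  qed
  then show "elem1 M n E \<noteq> elem2 M n E" "points_out (n E) E (elem1 M n E)" "points_out (- n E) E (elem2 M n E)"
    using e1 e2 K1 K2 by auto
  show "{K\<in>M. E edge_of K} = {elem1 M n E, elem2 M n E}"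
    unfolding e1 e2 using K1 K2 u1 u2 points_out_cases[OF M(2) _ un] by blast
qed


section \<open>Slices along coordinate lines\<close>

text \<open>Horizontal and vertical lines are treated by one argument with the direction
  \<open>i\<close> as a parameter: \<open>pt i s y\<close> moves along direction \<open>i\<close>
  with \<open>s\<close>, on the line where the coordinate \<open>co i\<close> equals
  \<open>y\<close>.\<close>

definition co :: "2 \<Rightarrow> 2" where "co i = (if i = 1 then 2 else 1)"

definition pt :: "2 \<Rightarrow> real \<Rightarrow> real \<Rightarrow> R2" where
  "pt i s y = (\<chi> l. if l = i then s else y)"

lemma co_neq [simp]: "co i \<noteq> i" "i \<noteq> co i"
  by (use exhaust_2[of i] in \<open>auto simp: co_def\<close>)

lemma co_cases: "l = i \<or> l = co i"
  by (use exhaust_2[of i] exhaust_2[of l] in \<open>auto simp: co_def\<close>)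

lemma UNIV_co: "UNIV = {i, co i}"
  using co_cases[of _ i] by blast

lemma pt_nth [simp]: "pt i s y $ i = s" "pt i s y $ co i = y"
  by (auto simp: pt_def)

lemma pt_collapse [simp]: "pt i (x $ i) (x $ co i) = x"
  unfolding vec_eq_iff
proof
  fix l show "pt i (x $ i) (x $ co i) $ l = x $ l" using co_cases[of l i] by auto
qed

lemma pt_add: "pt i s y + t *\<^sub>R axis i 1 = pt i (s + t) y"
  by (auto simp: vec_eq_iff pt_def axis_def)

lemma pt_diff: "pt i s y - pt i t y = (s - t) *\<^sub>R axis i 1"
  by (auto simp: vec_eq_iff pt_def axis_def)

lemma pt_affine: "pt i s y = s *\<^sub>R axis i 1 + y *\<^sub>R axis (co i) 1"
  unfolding vec_eq_iff
proof
  fix l show "pt i s y $ l = (s *\<^sub>R axis i 1 + y *\<^sub>R axis (co i) 1) $ l"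
    using co_cases[of l i] by (auto simp: axis_def)
qed

lemma continuous_pt [continuous_intros]:
  "continuous_on A f \<Longrightarrow> continuous_on A g \<Longrightarrow> continuous_on A (\<lambda>x. pt i (f x) (g x))"
  unfolding pt_affine by (intro continuous_intros)

lemma inner_axis_R2: "(n::R2) \<bullet> axis i 1 = n $ i"
  by (simp add: inner_axis)

text \<open>Only finitely many values of \<open>y\<close> are excluded. For the others the line
  passes through no vertex and contains no edge, so each end point of a slice is in the relative
  interior of exactly one edge, whose normal is not orthogonal to the line.\<close>

definition generic :: "2 \<Rightarrow> real \<Rightarrow> R2 set \<Rightarrow> bool" where
  "generic i y K \<longleftrightarrow> (\<forall>v. v extreme_point_of K \<longrightarrow> v $ co i \<noteq> y)"

text \<open>The end points of \<open>E\<close> are vertices of \<open>K\<close>, so the line avoids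
  them. If the normal had no component along the line, the edge would be parallel to the line and
  share a point with it, which would put its end points on the line.\<close>

lemma crossing_edge:
  assumes "2 simplex K" "E edge_of K" "generic i y K" "pt i s y \<in> E" "unit_normal n E"
  shows "pt i s y \<in> rel_interior E" "n $ i \<noteq> 0" "\<And>t. pt i t y \<in> E \<Longrightarrow> t = s"
proof -
  obtain p q r where E: "E = closed_segment p q" and pq: "p \<noteq> q"
    using edge_of_triangle[OF assms(1,2)] by blast
  have "{p} face_of E" "{q} face_of E"
    unfolding E face_of_singleton by (auto simp: extreme_point_of_segment)
  then have "{p} face_of K" "{q} face_of K" using assms(2) unfolding edge_of_def by (blast intro: face_of_trans)+
  then have ext: "p $ co i \<noteq> y" "q $ co i \<noteq> y" using assms(3) by (auto simp: generic_def face_of_singleton)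
  have "pt i s y \<noteq> p" "pt i s y \<noteq> q" using ext by auto
  then have os: "pt i s y \<in> open_segment p q" using assms(4) E by (auto simp: open_segment_def)
  then show "pt i s y \<in> rel_interior E" unfolding E using pq by (simp add: rel_interior_closed_segment)
  show ni: "n $ i \<noteq> 0"
  proof
    assume n0: "n $ i = 0"
    have "n \<noteq> 0" using assms(5) by (auto simp: unit_normal_def)
    then obtain l where "n $ l \<noteq> 0" by (auto simp: vec_eq_iff)
    then have nc: "n $ co i \<noteq> 0" using n0 co_cases[of l i] by auto
    have *: "n \<bullet> v = n $ co i * v $ co i" for v :: R2
      unfolding inner_vec_def UNIV_co[of i] by (simp add: n0)
    have "n \<bullet> (pt i s y - p) = 0" using assms(4,5) E by (simp add: unit_normal_def)
    then have "(pt i s y - p) $ co i = 0" unfolding * using nc by simp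
    then show False using ext by simp
  qed
  fix t assume "pt i t y \<in> E"
  then have "n \<bullet> (pt i t y - pt i s y) = 0" using assms(4,5) by (simp add: unit_normal_def)
  then show "t = s" using ni by (simp add: pt_diff inner_axis_R2)
qed

text \<open>The slice is compact and convex, so it is an interval. Its end points are not interior
  to \<open>K\<close> and hence lie on edges; since \<open>inward_direction\<close> leads from an
  edge into \<open>K\<close>, the sign of the normal component along the line tells the left end
  from the right one. For the same reason the interval is not degenerate.\<close>

lemma slice_interval:
  assumes "2 simplex K" "generic i y K" "pt i s0 y \<in> K"
    and no: "\<And>E. E edge_of K \<Longrightarrow> unit_normal (no E) E \<and> points_out (no E) E K"
  obtains a b Ea Eb where "a < b" "\<And>s. pt i s y \<in> K \<longleftrightarrow> a \<le> s \<and> s \<le> b"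
    "\<And>E s. E edge_of K \<and> pt i s y \<in> E \<longleftrightarrow> E = Ea \<and> s = a \<or> E = Eb \<and> s = b"
    "no Ea $ i < 0" "no Eb $ i > 0" "Ea \<noteq> Eb"
proof -
  let ?S = "{s. pt i s y \<in> K}"
  have K: "compact K" "convex K" using assms(1) by (auto dest: compact_simplex convex_simplex)
  have "closed (?S)"
  proof -
    have "closed ((\<lambda>s. pt i s y) -` K)"
      by (intro closed_vimage compact_imp_closed K(1) continuous_intros)
    then show ?thesis by (simp add: vimage_def)
  qed
  moreover have "bounded ?S"
  proof -
    obtain B where B: "\<And>x. x \<in> K \<Longrightarrow> norm x \<le> B" using K(1) compact_imp_bounded bounded_iff by metis
    have "norm s \<le> B" if "s \<in> ?S" for s
      using component_le_norm_cart[of "pt i s y" i] B[of "pt i s y"] that by simp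
    then show ?thesis unfolding bounded_iff by blast
  qed
  ultimately have cS: "compact ?S" by (simp add: compact_eq_bounded_closed)
  have "convex ?S"
    unfolding convex_alt
  proof (intro ballI allI impI)
    fix s t u :: real assume st: "s \<in> ?S" "t \<in> ?S" "0 \<le> u \<and> u \<le> 1"
    have "(1 - u) *\<^sub>R pt i s y + u *\<^sub>R pt i t y \<in> K"
      using K(2) st unfolding convex_alt by auto
    moreover have "(1 - u) *\<^sub>R pt i s y + u *\<^sub>R pt i t y = pt i ((1 - u) *\<^sub>R s + u *\<^sub>R t) y"
      by (simp add: pt_affine algebra_simps)
    ultimately show "(1 - u) *\<^sub>R s + u *\<^sub>R t \<in> ?S" by simp
  qed
  then have "connected ?S" by (rule convex_connected)
  then obtain a b where "?S = {a..b}" using cS connected_compact_interval_1 by blast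
  then have S: "pt i s y \<in> K \<longleftrightarrow> a \<le> s \<and> s \<le> b" for s by auto
  have ab: "a \<le> b" using S assms(3) by force
  have "aff_dim K = int DIM(R2)" using aff_dim_simplex[OF assms(1)] by simp
  then have "affine hull K = UNIV" by (rule iffD1[OF aff_dim_eq_full])
  then have ri: "rel_interior K = interior K" by (simp add: rel_interior_interior)
  have on_edge: "\<exists>E. E edge_of K \<and> x \<in> E" if "x \<in> K" "x \<notin> interior K" for x
  proof -
    have "x \<in> rel_frontier K" using that ri closure_subset by (auto simp: rel_frontier_def)
    then obtain F where "F facet_of K" "x \<in> F"
      using rel_frontier_of_polyhedron[OF simplex_imp_polyhedron[OF assms(1)]] by blast
    then show ?thesis using aff_dim_simplex[OF assms(1)] by (auto simp: facet_of_def edge_of_def)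
  qed
  have not_int: "pt i t y \<notin> interior K" if "t = a \<or> t = b" for t
  proof
    assume "pt i t y \<in> interior K"
    then obtain e where e: "e > 0" "ball (pt i t y) e \<subseteq> K" by (meson mem_interior)
    have "dist (pt i t y) (pt i (t + u) y) < e" if "\<bar>u\<bar> < e" for u
      using that by (simp add: dist_norm pt_diff)
    then have "pt i (t + e/2) y \<in> K" "pt i (t + (- e/2)) y \<in> K"
      using e by (auto intro!: subsetD[OF e(2)] simp del: add_uminus_conv_diff)
    then show False using that e(1) S by auto
  qed
  obtain Ea where Ea: "Ea edge_of K" "pt i a y \<in> Ea" using on_edge not_int S ab by blast
  obtain Eb where Eb: "Eb edge_of K" "pt i b y \<in> Eb" using on_edge not_int S ab by blast
  have sign: "(no E $ i < 0 \<longrightarrow> s = a \<and> s < b) \<and> (no E $ i > 0 \<longrightarrow> s = b \<and> a < s)"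
    if E: "E edge_of K" "pt i s y \<in> E" for E s
  proof -
    have n: "unit_normal (no E) E" "points_out (no E) E K" using no[OF E(1)] by auto
    have r: "pt i s y \<in> rel_interior E" using crossing_edge[OF assms(1) E(1) assms(2) E(2) n(1)] by simp
    have out: "(t - s) * no E $ i \<le> 0" if "a \<le> t" "t \<le> b" for t
    proof -
      have "no E \<bullet> (pt i t y - pt i s y) \<le> 0" using n(2) E(2) S that unfolding points_out_def by blast
      then show ?thesis by (simp add: pt_diff inner_axis_R2)
    qed
    have sab: "a \<le> s" "s \<le> b" using S E edge_of_imp_subset by blast+
    show ?thesis
    proof (intro conjI impI)
      assume neg: "no E $ i < 0"
      have "\<exists>s0>0. \<forall>u\<in>{0..s0}. pt i s y + u *\<^sub>R axis i 1 \<in> K"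
        by (rule inward_direction[OF assms(1) E(1) n r]) (simp add: inner_axis_R2 neg)
      then obtain s0 where "s0 > 0" "pt i s y + s0 *\<^sub>R axis i 1 \<in> K" by auto
      then show "s < b" using S by (auto simp: pt_add)
      show "s = a" using out[of a] neg sab ab by (auto simp: mult_le_0_iff)
    next
      assume pos: "no E $ i > 0"
      have "\<exists>s0>0. \<forall>u\<in>{0..s0}. pt i s y + u *\<^sub>R (- axis i 1) \<in> K"
        by (rule inward_direction[OF assms(1) E(1) n r]) (simp add: inner_axis_R2 pos)
      then obtain s0 where "s0 > 0" "pt i s y + s0 *\<^sub>R (- axis i 1) \<in> K" by auto
      then show "a < s" using S pt_add[of i s y "- s0"] by auto
      show "s = b" using out[of b] pos sab ab by (auto simp: mult_le_0_iff)
    qed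
  qed
  have nz: "no E $ i \<noteq> 0" if "E edge_of K" "pt i s y \<in> E" for E s
    using crossing_edge(2)[OF assms(1) that(1) assms(2) that(2)] no[OF that(1)] by blast
  have uniq: "E = E'" if E: "E edge_of K" "pt i s y \<in> E" and E': "E' edge_of K" "pt i s y \<in> E'" for E E' s
  proof -
    have r: "pt i s y \<in> rel_interior E" "pt i s y \<in> rel_interior E'"
      using crossing_edge(1)[OF assms(1) E(1) assms(2) E(2)] crossing_edge(1)[OF assms(1) E'(1) assms(2) E'(2)]
        no[OF E(1)] no[OF E'(1)] by auto
    have "E \<subseteq> E'" "E' \<subseteq> E"
      using subset_of_face_of[of E' K E] subset_of_face_of[of E K E'] r E E'
      by (auto simp: edge_of_def dest: face_of_imp_subset)
    then show ?thesis by blast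
  qed
  have na: "no Ea $ i < 0" using sign[OF Ea] nz[OF Ea] by linarith
  have nb: "no Eb $ i > 0" using sign[OF Eb] nz[OF Eb] by linarith
  have alt: "s = a \<or> s = b" if "E edge_of K" "pt i s y \<in> E" for E s
    using sign[OF that] nz[OF that] by linarith
  show thesis
  proof (rule that)
    show "a < b" using sign[OF Ea] na by blast
    show "pt i s y \<in> K \<longleftrightarrow> a \<le> s \<and> s \<le> b" for s by (rule S)
    show "E edge_of K \<and> pt i s y \<in> E \<longleftrightarrow> E = Ea \<and> s = a \<or> E = Eb \<and> s = b" for E s
      using alt uniq Ea Eb by blast
    show "no Ea $ i < 0" "no Eb $ i > 0" by (rule na nb)+
    show "Ea \<noteq> Eb" using na nb by auto
  qed
qed

definition crossing :: "2 \<Rightarrow> real \<Rightarrow> R2 set \<Rightarrow> R2" where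
  "crossing i y E = pt i (THE s. pt i s y \<in> E) y"

lemma norm_increment_le_nn_integral:
  fixes g :: "real \<Rightarrow> complex"
  assumes "a \<le> t" "\<And>s. (g has_vector_derivative g' s) (at s)" "continuous_on UNIV g'"
  shows "ennreal (norm (g t - g a)) \<le> (\<integral>\<^sup>+s\<in>{a..t}. ennreal (norm (g' s)) \<partial>lborel)"
proof -
  have "(g' has_integral (g t - g a)) {a..t}"
    using assms(1,2) by (intro fundamental_theorem_of_calculus) (auto intro: has_vector_derivative_at_within)
  then have eq: "g t - g a = integral {a..t} g'" by (simp add: integral_unique)
  have c: "continuous_on {a..t} g'" using assms(3) continuous_on_subset by blast
  have cn: "continuous_on {a..t} (\<lambda>s. norm (g' s))" using c by (intro continuous_intros)
  note i = integrable_continuous_real[OF c] integrable_continuous_real[OF cn]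
  have "norm (g t - g a) \<le> integral {a..t} (\<lambda>s. norm (g' s))"
    unfolding eq by (rule integral_norm_bound_integral[OF i]) simp
  then have "ennreal (norm (g t - g a)) \<le> ennreal (integral {a..t} (\<lambda>s. norm (g' s)))" by (rule ennreal_leI)
  also have "\<dots> = (\<integral>\<^sup>+s. ennreal (if s \<in> {a..t} then norm (g' s) else 0) \<partial>lborel)"
  proof (rule nn_integral_has_integral_lborel[symmetric])
    have "g' \<in> borel_measurable borel" using assms(3) by (rule borel_measurable_continuous_onI)
    then show "(\<lambda>s. if s \<in> {a..t} then norm (g' s) else 0) \<in> borel_measurable borel" by measurable
    show "((\<lambda>s. if s \<in> {a..t} then norm (g' s) else 0) has_integral integral {a..t} (\<lambda>s. norm (g' s))) UNIV"
      using i(2) by (simp only: has_integral_restrict_UNIV integrable_integral)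
  qed simp
  also have "\<dots> = (\<integral>\<^sup>+s\<in>{a..t}. ennreal (norm (g' s)) \<partial>lborel)"
    by (rule nn_integral_cong) simp
  finally show ?thesis .
qed

text \<open>Each end point of the slice lies on exactly one edge, and the sign of the normal tells which end it
  is. Summed over all elements, the edge terms below combine to jumps.\<close>

lemma slice_identity:
  fixes g :: "R2 \<Rightarrow> complex"
  assumes "2 simplex K" "generic i y K"
    and no: "\<And>E. E edge_of K \<Longrightarrow> unit_normal (no E) E \<and> points_out (no E) E K"
    and x0: "\<And>E. E edge_of K \<Longrightarrow> pt i x0 y \<notin> E"
    and g: "\<And>s. ((\<lambda>s. g (pt i s y)) has_vector_derivative g' (pt i s y)) (at s)" "continuous_on UNIV g'"
  shows "\<exists>J. (if pt i x0 y \<in> K then g (pt i x0 y) else 0)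
        = J - (\<Sum>E | E edge_of K \<and> (\<exists>s<x0. pt i s y \<in> E). sgn (no E $ i) *\<^sub>R g (crossing i y E))
      \<and> ennreal (norm J) \<le> (\<integral>\<^sup>+s. ennreal (norm (g' (pt i s y))) * indicator K (pt i s y) \<partial>lborel)"
proof (cases "\<exists>s0. pt i s0 y \<in> K")
  case False
  then have A: "{E. E edge_of K \<and> (\<exists>s<x0. pt i s y \<in> E)} = {}" using edge_of_imp_subset by blast
  have "pt i x0 y \<notin> K" using False by blast
  then show ?thesis unfolding A by (intro exI[of _ 0]) simp
next
  case True
  then obtain s0 where s0: "pt i s0 y \<in> K" by blast
  obtain a b Ea Eb where ab: "a < b" and S: "\<And>s. pt i s y \<in> K \<longleftrightarrow> a \<le> s \<and> s \<le> b"
    and cr: "\<And>E s. E edge_of K \<and> pt i s y \<in> E \<longleftrightarrow> E = Ea \<and> s = a \<or> E = Eb \<and> s = b"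
    and sg: "no Ea $ i < 0" "no Eb $ i > 0" "Ea \<noteq> Eb"
  proof (rule slice_interval[OF assms(1,2) s0, of no])
    show "unit_normal (no E) E \<and> points_out (no E) E K" if "E edge_of K" for E using that by (rule no)
  qed (rule that)
  have Ea: "Ea edge_of K" "pt i a y \<in> Ea" and Eb: "Eb edge_of K" "pt i b y \<in> Eb"
    using cr[of Ea a] cr[of Eb b] by simp_all
  have only: "E = Ea \<and> s = a \<or> E = Eb \<and> s = b" if "E edge_of K" "pt i s y \<in> E" for E s
    using cr[of E s] that by simp
  have "(THE s. pt i s y \<in> Ea) = a"
    by (rule the_equality) (use Ea(2) only[OF Ea(1)] sg(3) in blast)+
  moreover have "(THE s. pt i s y \<in> Eb) = b"
    by (rule the_equality) (use Eb(2) only[OF Eb(1)] sg(3) in blast)+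
  ultimately have ca: "crossing i y Ea = pt i a y" and cb: "crossing i y Eb = pt i b y"
    by (simp_all add: crossing_def)
  have ne: "x0 \<noteq> a" "x0 \<noteq> b" using x0[OF Ea(1)] x0[OF Eb(1)] Ea(2) Eb(2) by auto
  have A: "{E. E edge_of K \<and> (\<exists>s<x0. pt i s y \<in> E)} = (if x0 < a then {} else if x0 < b then {Ea} else {Ea,Eb})"
    (is "?A = _")
  proof -
    have "(E edge_of K \<and> (\<exists>s<x0. pt i s y \<in> E)) \<longleftrightarrow> E = Ea \<and> a < x0 \<or> E = Eb \<and> b < x0" for E
    proof
      assume "E edge_of K \<and> (\<exists>s<x0. pt i s y \<in> E)"
      then obtain s where "s < x0" "E edge_of K" "pt i s y \<in> E" by blast
      then show "E = Ea \<and> a < x0 \<or> E = Eb \<and> b < x0" using only[of E s] by auto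
    next
      assume "E = Ea \<and> a < x0 \<or> E = Eb \<and> b < x0"
      then show "E edge_of K \<and> (\<exists>s<x0. pt i s y \<in> E)" using Ea Eb by blast
    qed
    then have "?A = {E. E = Ea \<and> a < x0 \<or> E = Eb \<and> b < x0}" by (rule Collect_cong)
    then show ?thesis using ab ne by auto
  qed
  have c: "continuous_on UNIV (\<lambda>s. g' (pt i s y))"
    by (rule continuous_on_compose2[OF g(2)]) (intro continuous_intros, auto)
  have J: "ennreal (norm (g (pt i t y) - g (pt i a y)))
      \<le> (\<integral>\<^sup>+s. ennreal (norm (g' (pt i s y))) * indicator K (pt i s y) \<partial>lborel)" if "a \<le> t" "t \<le> b" for t
  proof -
    have "ennreal (norm (g (pt i t y) - g (pt i a y))) \<le> (\<integral>\<^sup>+s\<in>{a..t}. ennreal (norm (g' (pt i s y))) \<partial>lborel)"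
      by (rule norm_increment_le_nn_integral[OF that(1) g(1) c])
    also have "\<dots> \<le> (\<integral>\<^sup>+s. ennreal (norm (g' (pt i s y))) * indicator K (pt i s y) \<partial>lborel)"
      using that S by (intro nn_integral_mono mult_left_mono) (auto simp: indicator_def)
    finally show ?thesis .
  qed
  \<comment> \<open>To the left of the slice every term vanishes; inside it \<open>J\<close> is the
    increment from the left end; to the right of it \<open>J\<close> is the full increment, which
    the two end terms cancel.\<close>
  consider "x0 < a" | "a < x0" "x0 < b" | "b < x0" using ne by linarith
  then show ?thesis
  proof cases
    case 1
    then show ?thesis unfolding A using S by (intro exI[of _ 0]) simp
  next
    case 2
    then show ?thesis unfolding A using S J[of x0] sg ca by (intro exI[of _ "g (pt i x0 y) - g (pt i a y)"]) simp
  next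
    case 3
    then show ?thesis unfolding A using S J[of b] sg ca cb ab by (intro exI[of _ "g (pt i b y) - g (pt i a y)"]) simp
  qed
qed

lemma finite_edges:
  assumes "conforming_mesh \<Omega> M" shows "finite (edges M)"
proof -
  have "edges M = (\<Union>K\<in>M. {E. E edge_of K})" by (auto simp: edges_def)
  moreover have "finite {E. E edge_of K}" if "K \<in> M" for K
  proof -
    have "polytope K" using assms that by (auto simp: conforming_mesh_def dest: simplex_imp_polytope)
    then have "finite {F. F face_of K}" by (rule finite_polytope_faces)
    then show ?thesis by (rule rev_finite_subset) (auto simp: edge_of_def)
  qed
  ultimately show ?thesis using assms by (auto simp: conforming_mesh_def triangulation_def)
qed

text \<open>Exchanging the sums over elements and edges collects the terms of
  \<open>slice_identity\<close> at each edge. Neighbouring elements have opposite outward normals,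
  so what is collected is the jump up to sign; on a boundary edge it is the single trace, in
  agreement with the convention for jumps there.\<close>

lemma piecewise_slice_bound:
  fixes f :: "R2 set \<Rightarrow> R2 \<Rightarrow> complex"
  assumes "open \<Omega>" "conforming_mesh \<Omega> M" "edge_normals \<Omega> M n"
    and gen: "\<And>K. K \<in> M \<Longrightarrow> generic i y K"
    and x0: "\<And>E. E \<in> edges M \<Longrightarrow> pt i x0 y \<notin> E"
    and f: "\<And>K s. K \<in> M \<Longrightarrow> ((\<lambda>s. f K (pt i s y)) has_vector_derivative f' K (pt i s y)) (at s)" "\<And>K. K \<in> M \<Longrightarrow> continuous_on UNIV (f' K)"
  shows "ennreal (norm (\<Sum>K\<in>M. if pt i x0 y \<in> K then f K (pt i x0 y) else 0))
     \<le> (\<Sum>K\<in>M. \<integral>\<^sup>+s. ennreal (norm (f' K (pt i s y))) * indicator K (pt i s y) \<partial>lborel)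
      + (\<Sum>E | E \<in> edges M \<and> (\<exists>s. pt i s y \<in> E). ennreal (norm (edge_jump \<Omega> M n E f (crossing i y E))))"
proof -
  have M: "finite M" "\<And>K. K \<in> M \<Longrightarrow> 2 simplex K"
    using assms(2) by (auto simp: conforming_mesh_def triangulation_def)
  have fE: "finite (edges M)" using assms(2) by (rule finite_edges)
  \<comment> \<open>The outward normal of \<open>K\<close> on \<open>E\<close>, recovered from the
    one fixed normal of the edge.\<close>
  define no where "no K E = (if K = elem1 M n E then n E else - n E)" for K E
  have no: "unit_normal (no K E) E \<and> points_out (no K E) E K" if "K \<in> M" "E edge_of K" for K E
  proof -
    have E: "E \<in> edges M" using that by (auto simp: edges_def)
    then have un: "unit_normal (n E) E" using assms(3) by (simp add: edge_normals_def unit_normal_def)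
    show ?thesis
    proof (cases "boundary_edge \<Omega> E")
      case True
      have "K \<in> {elem1 M n E}" using boundary_edge_elements(1)[OF assms(2,3) E True] that by blast
      then show ?thesis using boundary_edge_elements(2)[OF assms(2,3) E True] un by (simp add: no_def)
    next
      case False
      note ie = interior_edge_elements[OF assms(1-3) E False]
      have "K \<in> {elem1 M n E, elem2 M n E}" using ie(1) that by blast
      then show ?thesis using ie(2-4) un by (auto simp: no_def)
    qed
  qed
  let ?A = "{E \<in> edges M. \<exists>s<x0. pt i s y \<in> E}"
  let ?R = "\<lambda>K E. sgn (no K E $ i) *\<^sub>R f K (crossing i y E)"
  let ?I = "\<lambda>K. \<integral>\<^sup>+s. ennreal (norm (f' K (pt i s y))) * indicator K (pt i s y) \<partial>lborel"
  let ?S = "\<lambda>K. \<Sum>E | E edge_of K \<and> (\<exists>s<x0. pt i s y \<in> E). ?R K E"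
  have "\<forall>K\<in>M. \<exists>J. (if pt i x0 y \<in> K then f K (pt i x0 y) else 0) = J - ?S K \<and> ennreal (norm J) \<le> ?I K"
  proof
    fix K assume K: "K \<in> M"
    show "\<exists>J. (if pt i x0 y \<in> K then f K (pt i x0 y) else 0) = J - ?S K \<and> ennreal (norm J) \<le> ?I K"
    proof (rule slice_identity[OF M(2)[OF K] gen[OF K]])
      show "unit_normal (no K E) E \<and> points_out (no K E) E K" if "E edge_of K" for E
        using K that by (rule no)
      show "pt i x0 y \<notin> E" if "E edge_of K" for E
        using K that by (intro x0) (auto simp: edges_def)
    qed (use K in \<open>rule f\<close>)+
  qed
  from bchoice[OF this] obtain J where
    JJ: "\<forall>K\<in>M. (if pt i x0 y \<in> K then f K (pt i x0 y) else 0) = J K - ?S K \<and> ennreal (norm (J K)) \<le> ?I K"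
    by blast
  have J: "(if pt i x0 y \<in> K then f K (pt i x0 y) else 0) = J K - ?S K" if "K \<in> M" for K
    using JJ that by blast
  have Jb: "ennreal (norm (J K)) \<le> ?I K" if "K \<in> M" for K
    using JJ that by blast
  have swap: "(\<Sum>K\<in>M. \<Sum>E | E edge_of K \<and> (\<exists>s<x0. pt i s y \<in> E). ?R K E)
     = (\<Sum>E\<in>?A. \<Sum>K | K \<in> M \<and> E edge_of K. ?R K E)"
  proof -
    have "(\<Sum>K\<in>M. \<Sum>E | E edge_of K \<and> (\<exists>s<x0. pt i s y \<in> E). ?R K E)
      = (\<Sum>K\<in>M. \<Sum>E | E \<in> ?A \<and> E edge_of K. ?R K E)"
      by (intro sum.cong refl) (auto simp: edges_def)
    also have "\<dots> = (\<Sum>E\<in>?A. \<Sum>K | K \<in> M \<and> E edge_of K. ?R K E)"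
      using M(1) fE by (intro sum.swap_restrict) auto
    finally show ?thesis .
  qed
  have jump: "norm (\<Sum>K | K \<in> M \<and> E edge_of K. ?R K E) = norm (edge_jump \<Omega> M n E f (crossing i y E))"
    if "E \<in> ?A" for E
  proof -
    have E: "E \<in> edges M" using that by simp
    then have un: "unit_normal (n E) E" using assms(3) by (simp add: edge_normals_def unit_normal_def)
    obtain K where K: "K \<in> M" "E edge_of K" using E by (auto simp: edges_def)
    have nz: "n E $ i \<noteq> 0" using that crossing_edge(2)[OF M(2)[OF K(1)] K(2) gen[OF K(1)] _ un] by blast
    have s1: "\<bar>sgn (n E $ i)\<bar> = 1" using nz by (simp add: abs_sgn_eq)
    show ?thesis
    proof (cases "boundary_edge \<Omega> E")
      case True
      show ?thesis unfolding boundary_edge_elements(1)[OF assms(2,3) E True] edge_jump_def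
        using True s1 by (simp add: no_def)
    next
      case False
      note ie = interior_edge_elements[OF assms(1-3) E False]
      have "(\<Sum>K | K \<in> M \<and> E edge_of K. ?R K E)
         = sgn (n E $ i) *\<^sub>R (f (elem1 M n E) (crossing i y E) - f (elem2 M n E) (crossing i y E))"
        unfolding ie(1) using ie(2) by (simp add: no_def sgn_minus scaleR_diff_right)
      then show ?thesis using s1 False by (simp add: edge_jump_def)
    qed
  qed
  have "norm (\<Sum>K\<in>M. if pt i x0 y \<in> K then f K (pt i x0 y) else 0)
     = norm ((\<Sum>K\<in>M. J K) - (\<Sum>E\<in>?A. \<Sum>K | K \<in> M \<and> E edge_of K. ?R K E))"
    unfolding swap[symmetric] sum_subtractf[symmetric] by (intro arg_cong[where f=norm] sum.cong refl J)
  also have "\<dots> \<le> (\<Sum>K\<in>M. norm (J K)) + (\<Sum>E\<in>?A. norm (edge_jump \<Omega> M n E f (crossing i y E)))"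
  proof (rule order_trans[OF norm_triangle_ineq4], rule add_mono[OF norm_sum], rule order_trans[OF norm_sum])
    show "(\<Sum>E\<in>?A. norm (\<Sum>K | K \<in> M \<and> E edge_of K. ?R K E)) \<le> (\<Sum>E\<in>?A. norm (edge_jump \<Omega> M n E f (crossing i y E)))"
      by (intro sum_mono eq_refl jump)
  qed
  finally have "ennreal (norm (\<Sum>K\<in>M. if pt i x0 y \<in> K then f K (pt i x0 y) else 0))
     \<le> ennreal (\<dots>)" by (rule ennreal_leI)
  also have "\<dots> = (\<Sum>K\<in>M. ennreal (norm (J K))) + (\<Sum>E\<in>?A. ennreal (norm (edge_jump \<Omega> M n E f (crossing i y E))))"
    by (simp add: sum_nonneg)
  also have "\<dots> \<le> (\<Sum>K\<in>M. \<integral>\<^sup>+s. ennreal (norm (f' K (pt i s y))) * indicator K (pt i s y) \<partial>lborel)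
      + (\<Sum>E | E \<in> edges M \<and> (\<exists>s. pt i s y \<in> E). ennreal (norm (edge_jump \<Omega> M n E f (crossing i y E))))"
    by (intro add_mono sum_mono Jb sum_mono2) (use fE in auto)
  finally show ?thesis .
qed


section \<open>A bound in terms of the gradient and the jumps\<close>

lemma integrable_lebesgue_on_compact:
  fixes f :: "'a::euclidean_space \<Rightarrow> 'b::{banach,second_countable_topology}"
  assumes "compact K" "continuous_on UNIV f"
  shows "integrable (lebesgue_on K) f"
proof -
  have K: "K \<in> sets borel" using assms(1) by (simp add: borel_closed compact_imp_closed)
  have "integrable lborel (\<lambda>x. indicator K x *\<^sub>R f x)"
    by (rule borel_integrable_compact[OF assms(1)]) (rule continuous_on_subset[OF assms(2)], simp)
  moreover have "(\<lambda>x. indicator K x *\<^sub>R f x) \<in> borel_measurable borel"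
    using borel_measurable_continuous_onI[OF assms(2)] K by measurable
  ultimately have "integrable lebesgue (\<lambda>x. indicator K x *\<^sub>R f x)"
    by (simp add: integrable_completion)
  then show ?thesis using K by (subst integrable_restrict_space) auto
qed

lemma LINT_lebesgue_on_eq_nn_integral:
  fixes f :: "'a::euclidean_space \<Rightarrow> real"
  assumes "compact K" "continuous_on UNIV f" "\<And>x. f x \<ge> 0"
  shows "ennreal (LINT x|lebesgue_on K. f x) = (\<integral>\<^sup>+x\<in>K. ennreal (f x) \<partial>lborel)"
proof -
  have K: "K \<in> sets borel" using assms(1) by (simp add: borel_closed compact_imp_closed)
  have "ennreal (LINT x|lebesgue_on K. f x) = (\<integral>\<^sup>+x. ennreal (f x) \<partial>lebesgue_on K)"
    using integrable_lebesgue_on_compact[OF assms(1,2)] assms(3)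
    by (intro nn_integral_eq_integral[symmetric]) auto
  also have "\<dots> = (\<integral>\<^sup>+x\<in>K. ennreal (f x) \<partial>lebesgue)"
    using K by (subst nn_integral_restrict_space) auto
  also have "\<dots> = (\<integral>\<^sup>+x\<in>K. ennreal (f x) \<partial>lborel)" by (rule nn_integral_completion)
  finally show ?thesis .
qed

text \<open>The end points are chosen from \<open>E\<close> alone, so one pair serves all integrands
  at once; linearity and monotonicity of edge integrals rest on this.\<close>

lemma edge_integral_eq:
  assumes "E = closed_segment p q"
  shows "\<exists>p q. E = closed_segment p q \<and> (\<forall>f::R2 \<Rightarrow> 'b::{banach,second_countable_topology}.
     edge_integral E f = dist p q *\<^sub>R (LINT t|lebesgue_on {0..1}. f (linepath p q t)))"
proof -
  define pq where "pq = (SOME (p, q). E = closed_segment p q)"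
  have "case pq of (p, q) \<Rightarrow> E = closed_segment p q"
    unfolding pq_def by (rule someI[of _ "(p,q)"]) (use assms(1) in simp)
  moreover obtain p' q' where "pq = (p', q')" by force
  ultimately show ?thesis unfolding edge_integral_def pq_def[symmetric] by auto
qed

text \<open>Points of the plane are vectors, not pairs. This image measure, identified by its values
  on boxes, makes Tonelli's theorem available in the direction \<open>i\<close>.\<close>

lemma distr_pt: "distr (lborel \<Otimes>\<^sub>M lborel) borel (\<lambda>(s, y). pt i s y) = (lborel :: R2 measure)"
proof (rule lborel_eqI[symmetric])
  show "sets (distr (lborel \<Otimes>\<^sub>M lborel) borel (\<lambda>(s, y). pt i s y)) = sets (borel :: R2 measure)" by simp
  have meas: "(\<lambda>(s, y). pt i s y) \<in> measurable (lborel \<Otimes>\<^sub>M lborel) (borel :: R2 measure)"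
  proof -
    have "continuous_on UNIV (\<lambda>z::real \<times> real. pt i (fst z) (snd z))" by (intro continuous_intros)
    then have "(\<lambda>z::real \<times> real. pt i (fst z) (snd z)) \<in> borel_measurable borel" by (rule borel_measurable_continuous_onI)
    then show ?thesis unfolding lborel_prod by (simp add: case_prod_beta')
  qed
  fix l u :: R2 assume le: "\<And>b. b \<in> Basis \<Longrightarrow> l \<bullet> b \<le> u \<bullet> b"
  have le': "l $ j \<le> u $ j" for j using le[of "axis j 1"] by (simp add: inner_axis)
  have "(\<lambda>(s, y). pt i s y) -` box l u \<inter> space (lborel \<Otimes>\<^sub>M lborel)
     = {l $ i <..< u $ i} \<times> {l $ co i <..< u $ co i}"
  proof -
    have all: "(\<forall>j. P j) \<longleftrightarrow> P i \<and> P (co i)" for P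
    proof -
      have "(\<forall>j\<in>UNIV. P j) \<longleftrightarrow> P i \<and> P (co i)" unfolding UNIV_co[of i] by simp
      then show ?thesis by simp
    qed
    have "(\<forall>j. l $ j < pt i s y $ j \<and> pt i s y $ j < u $ j) \<longleftrightarrow>
        l $ i < s \<and> s < u $ i \<and> l $ co i < y \<and> y < u $ co i" for s y
      by (subst all) auto
    then show ?thesis by (auto simp: mem_box_cart space_pair_measure)
  qed
  then have "emeasure (distr (lborel \<Otimes>\<^sub>M lborel) borel (\<lambda>(s, y). pt i s y)) (box l u)
     = emeasure (lborel \<Otimes>\<^sub>M lborel) ({l $ i <..< u $ i} \<times> {l $ co i <..< u $ co i})"
    using meas by (simp add: emeasure_distr)
  also have "\<dots> = ennreal (u $ i - l $ i) * ennreal (u $ co i - l $ co i)"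
    using le' by (subst lborel.emeasure_pair_measure_Times) auto
  also have "\<dots> = ennreal (\<Prod>b\<in>Basis. (u - l) \<bullet> b)"
  proof -
    have B: "Basis = {axis i 1, axis (co i) (1::real)}"
      unfolding Basis_vec_def UNIV_co[of i] by auto
    have "axis i 1 \<noteq> axis (co i) (1::real)" by (simp add: axis_eq_axis)
    then have "(\<Prod>b\<in>Basis. (u - l) \<bullet> b) = (u $ i - l $ i) * (u $ co i - l $ co i)"
      unfolding B by (simp add: inner_axis)
    then show ?thesis using le' by (simp add: ennreal_mult)
  qed
  finally show "emeasure (distr (lborel \<Otimes>\<^sub>M lborel) borel (\<lambda>(s, y). pt i s y)) (box l u)
     = ennreal (\<Prod>b\<in>Basis. (u - l) \<bullet> b)" .
qed

lemma measurable_pt [measurable]: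
  assumes "f \<in> borel_measurable M" "g \<in> borel_measurable M"
  shows "(\<lambda>x. pt i (f x) (g x)) \<in> borel_measurable M"
proof -
  have "continuous_on UNIV (\<lambda>z::real \<times> real. pt i (fst z) (snd z))" by (intro continuous_intros)
  then have "(\<lambda>z::real \<times> real. pt i (fst z) (snd z)) \<in> borel_measurable (borel \<Otimes>\<^sub>M borel)"
    unfolding borel_prod by (rule borel_measurable_continuous_onI)
  from measurable_compose[OF measurable_Pair[OF assms] this] show ?thesis by simp
qed

lemma nn_integral_pt:
  assumes [measurable]: "f \<in> borel_measurable (borel :: R2 measure)"
  shows "(\<integral>\<^sup>+x. f x \<partial>lborel) = (\<integral>\<^sup>+y. \<integral>\<^sup>+s. f (pt i s y) \<partial>lborel \<partial>lborel)"
proof -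
  have "(\<integral>\<^sup>+x. f x \<partial>lborel) = (\<integral>\<^sup>+x. f x \<partial>distr (lborel \<Otimes>\<^sub>M lborel) borel (\<lambda>(s, y). pt i s y))"
    by (simp only: distr_pt)
  also have "\<dots> = (\<integral>\<^sup>+z. f (case z of (s, y) \<Rightarrow> pt i s y) \<partial>(lborel \<Otimes>\<^sub>M lborel))"
    by (rule nn_integral_distr) simp_all
  also have "\<dots> = (\<integral>\<^sup>+y. \<integral>\<^sup>+s. f (pt i s y) \<partial>lborel \<partial>lborel)"
    by (subst lborel_pair.nn_integral_snd[symmetric]) simp_all
  finally show ?thesis .
qed

text \<open>The two bounds depend on different coordinates, so the integral of their product
  factorises. This is the point where the dimension two of the domain is exploited.\<close>

lemma nn_integral_square_le_product:
  assumes [measurable]: "F1 \<in> borel_measurable (borel :: real measure)" "F2 \<in> borel_measurable (borel :: real measure)"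
    and "AE x in lborel. \<Phi> x \<le> F1 (x $ 2)" "AE x in lborel. \<Phi> x \<le> F2 (x $ 1)"
  shows "(\<integral>\<^sup>+x. (\<Phi> x)\<^sup>2 \<partial>(lborel::R2 measure)) \<le> (\<integral>\<^sup>+y. F1 y \<partial>lborel) * (\<integral>\<^sup>+s. F2 s \<partial>lborel)"
proof -
  have co1: "co 1 = 2" by (simp add: co_def)
  have [measurable]: "(\<lambda>x::R2. x $ l) \<in> borel_measurable borel" for l
    by (intro borel_measurable_continuous_onI continuous_intros)
  have "(\<integral>\<^sup>+x. (\<Phi> x)\<^sup>2 \<partial>(lborel::R2 measure)) \<le> (\<integral>\<^sup>+x. F1 (x $ 2) * F2 (x $ 1) \<partial>(lborel::R2 measure))"
  proof (rule nn_integral_mono_AE)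
    show "AE x in lborel. (\<Phi> x)\<^sup>2 \<le> F1 (x $ 2) * F2 (x $ 1)"
      using assms(3,4)
    proof eventually_elim
      case (elim x)
      then show ?case unfolding power2_eq_square by (intro mult_mono) auto
    qed
  qed
  also have "\<dots> = (\<integral>\<^sup>+y. \<integral>\<^sup>+s. F1 y * F2 s \<partial>lborel \<partial>lborel)"
    by (subst nn_integral_pt[of _ 1]) (simp_all add: pt_nth(2)[of 1, unfolded co1])
  also have "\<dots> = (\<integral>\<^sup>+y. F1 y \<partial>lborel) * (\<integral>\<^sup>+s. F2 s \<partial>lborel)"
    by (simp add: nn_integral_cmult nn_integral_multc)
  finally show ?thesis .
qed

section \<open>Exceptional lines and points\<close>

lemma AE_not_on_hyperplane:
  fixes a :: "'a::euclidean_space"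
  assumes "a \<noteq> 0" shows "AE x in lborel. a \<bullet> x \<noteq> b"
proof -
  have "{x. a \<bullet> x = b} \<in> null_sets lebesgue"
    using negligible_hyperplane[of a b] assms by (simp add: negligible_iff_null_sets)
  then have "AE x in lebesgue. x \<notin> {x. a \<bullet> x = b}" by (rule AE_not_in)
  then show ?thesis unfolding AE_completion_iff by simp
qed

lemma AE_generic:
  assumes "conforming_mesh \<Omega> M"
  shows "AE x in lborel. \<forall>K\<in>M. generic i (x $ co i) K"
proof -
  have M: "finite M" using assms by (auto simp: conforming_mesh_def triangulation_def)
  have "AE x in lborel. generic i (x $ co i) K" if "K \<in> M" for K
  proof -
    have "polytope K" using assms that by (auto simp: conforming_mesh_def dest: simplex_imp_polytope)
    then have "finite {F. F face_of K}" by (rule finite_polytope_faces)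
    then have "finite ((\<lambda>v. {v}) -` {F. F face_of K})" by (intro finite_vimageI) (auto simp: inj_on_def)
    then have fin: "finite {v. v extreme_point_of K}" by (simp add: vimage_def face_of_singleton)
    have "AE x in lborel. \<forall>v\<in>{v. v extreme_point_of K}. axis (co i) (1::real) \<bullet> x \<noteq> v $ co i"
      using fin by (intro AE_finite_allI AE_not_on_hyperplane) auto
    then show ?thesis by eventually_elim (auto simp: generic_def inner_axis')
  qed
  then show ?thesis using M by (intro AE_finite_allI)
qed

lemma AE_not_on_edges:
  assumes "conforming_mesh \<Omega> M" "edge_normals \<Omega> M n"
  shows "AE x in lborel. \<forall>E\<in>edges M. x \<notin> E"
proof (rule AE_finite_allI[OF finite_edges[OF assms(1)]])
  fix E assume E: "E \<in> edges M"
  then have un: "unit_normal (n E) E" using assms(2) by (simp add: edge_normals_def unit_normal_def)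
  obtain K where "2 simplex K" "E edge_of K" using E assms(1) by (auto simp: edges_def conforming_mesh_def)
  then obtain p where p: "p \<in> E" using edge_of_convex_closed(3) by blast
  have "AE x in lborel. n E \<bullet> x \<noteq> n E \<bullet> p"
    using un by (intro AE_not_on_hyperplane) (auto simp: unit_normal_def)
  then show "AE x in lborel. x \<notin> E"
  proof eventually_elim
    case (elim x)
    have "n E \<bullet> (x - p) = 0" if "x \<in> E" using un p that unfolding unit_normal_def by blast
    then show ?case using elim by (auto simp: inner_diff_right)
  qed
qed

text \<open>Otherwise the intersection would be a proper face of one of the elements, thus part of
  its relative frontier, which is covered by edges.\<close>

lemma mesh_point_unique:
  assumes "conforming_mesh \<Omega> M" "K \<in> M" "K' \<in> M" "x \<in> K" "x \<in> K'" "\<And>E. E \<in> edges M \<Longrightarrow> x \<notin> E"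
  shows "K = K'"
proof -
  have M: "triangulation M" "\<And>K. K \<in> M \<Longrightarrow> 2 simplex K"
    using assms(1) by (auto simp: conforming_mesh_def)
  have *: "K \<inter> K' = K" if K: "K \<in> M" "K' \<in> M" "x \<in> K" "x \<in> K'" for K K'
  proof (rule ccontr)
    assume "K \<inter> K' \<noteq> K"
    then have "K \<inter> K' \<subseteq> rel_frontier K"
      using triangulation_face_Int(1)[OF M(1) K(1,2)] by (intro face_of_subset_rel_frontier)
    then have "x \<in> rel_frontier K" using K by blast
    then obtain F where F: "F facet_of K" "x \<in> F"
      using rel_frontier_of_polyhedron[OF simplex_imp_polyhedron[OF M(2)[OF K(1)]]] by blast
    then have "F edge_of K" using aff_dim_simplex[OF M(2)[OF K(1)]] by (auto simp: facet_of_def edge_of_def)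
    then show False using F(2) assms(6) K(1) by (auto simp: edges_def)
  qed
  show ?thesis using *[OF assms(2,3,4,5)] *[OF assms(3,2,5,4)] by blast
qed

text \<open>The crossing point is fixed by its coordinate \<open>co i\<close>, so its parameter on
  the segment is affine in \<open>y\<close>. This is the formula built into
  \<open>edge_trace\<close> below.\<close>

lemma crossing_on_segment:
  assumes "2 simplex K" "E edge_of K" "generic i y K" "unit_normal n E" "pt i s y \<in> E" "E = closed_segment p q"
  shows "p $ co i \<noteq> q $ co i" "(y - p $ co i) / (q $ co i - p $ co i) \<in> {0..1}"
    "crossing i y E = linepath p q ((y - p $ co i) / (q $ co i - p $ co i))"
proof -
  obtain t where t: "t \<in> {0..1}" "pt i s y = linepath p q t"
    using assms(5,6) by (auto simp: closed_segment_def linepath_def)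
  have "pt i s y $ co i = (1 - t) * p $ co i + t * q $ co i" unfolding t(2) by (simp add: linepath_def)
  then have y: "y = (1 - t) * p $ co i + t * q $ co i" by simp
  have "{p} face_of E" unfolding assms(6) face_of_singleton by (auto simp: extreme_point_of_segment)
  then have "{p} face_of K" using assms(2) unfolding edge_of_def by (blast intro: face_of_trans)
  then have "p $ co i \<noteq> y" using assms(3) by (auto simp: generic_def face_of_singleton)
  then show ne: "p $ co i \<noteq> q $ co i" using y by (auto simp: algebra_simps)
  then have te: "(y - p $ co i) / (q $ co i - p $ co i) = t" using y by (simp add: field_simps)
  show "(y - p $ co i) / (q $ co i - p $ co i) \<in> {0..1}" using te t(1) by simp
  have "(THE s. pt i s y \<in> E) = s"
    by (rule the_equality) (fact assms(5), rule crossing_edge(3)[OF assms(1-3,5,4)])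
  then show "crossing i y E = linepath p q ((y - p $ co i) / (q $ co i - p $ co i))"
    unfolding te by (simp add: crossing_def t(2))
qed

section \<open>Continuously differentiable pieces and their traces on edges\<close>

lemma Cn1_continuous:
  assumes "Cn 1 f"
  shows "continuous_on UNIV f" "continuous_on UNIV (partial_deriv i f)" "continuous_on UNIV (grad f)"
proof -
  have d: "\<And>x. f differentiable (at x)" and c: "\<And>i. continuous_on UNIV (partial_deriv i f)"
    using assms by auto
  show "continuous_on UNIV f"
    using d by (meson continuous_at_imp_continuous_on differentiable_imp_continuous_within)
  show "continuous_on UNIV (partial_deriv i f)" by (rule c)
  show "continuous_on UNIV (grad f)"
    unfolding grad_def[abs_def] by (intro continuous_on_vec_lambda c)
qed

lemma Cn1_has_vector_derivative_pt:
  assumes "Cn 1 f"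
  shows "((\<lambda>s. f (pt i s y)) has_vector_derivative partial_deriv i f (pt i s y)) (at s)"
proof -
  have "f differentiable (at (pt i s y))" using assms by auto
  then have "(f has_derivative frechet_derivative f (at (pt i s y))) (at (pt i s y))"
    by (simp add: frechet_derivative_works)
  moreover have "((\<lambda>s. pt i s y) has_vector_derivative axis i 1) (at s)"
    unfolding pt_affine by (auto intro!: derivative_eq_intros simp: has_vector_derivative_def)
  ultimately have "((f \<circ> (\<lambda>s. pt i s y)) has_vector_derivative frechet_derivative f (at (pt i s y)) (axis i 1)) (at s)"
    by (metis vector_derivative_diff_chain_within has_derivative_at_withinI)
  then show ?thesis by (simp add: o_def partial_deriv_def)
qed

lemma elem_in_mesh:
  assumes "open \<Omega>" "conforming_mesh \<Omega> M" "edge_normals \<Omega> M n" "E \<in> edges M"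
  shows "elem1 M n E \<in> M" "E edge_of elem1 M n E"
    "\<not> boundary_edge \<Omega> E \<Longrightarrow> elem2 M n E \<in> M" "\<not> boundary_edge \<Omega> E \<Longrightarrow> E edge_of elem2 M n E"
proof -
  have "elem1 M n E \<in> {K\<in>M. E edge_of K}"
    using boundary_edge_elements(1)[OF assms(2-4)] interior_edge_elements(1)[OF assms] by blast
  then show "elem1 M n E \<in> M" "E edge_of elem1 M n E" by auto
  have "elem2 M n E \<in> {K\<in>M. E edge_of K}" if "\<not> boundary_edge \<Omega> E"
    using interior_edge_elements(1)[OF assms that] by blast
  then show "\<not> boundary_edge \<Omega> E \<Longrightarrow> elem2 M n E \<in> M" "\<not> boundary_edge \<Omega> E \<Longrightarrow> E edge_of elem2 M n E" by auto
qed

lemma continuous_on_edge_jump: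
  assumes "open \<Omega>" "conforming_mesh \<Omega> M" "edge_normals \<Omega> M n" "E \<in> edges M"
    and "\<And>K. K \<in> M \<Longrightarrow> continuous_on A (f K)"
  shows "continuous_on A (edge_jump \<Omega> M n E f :: R2 \<Rightarrow> 'b::real_normed_vector)"
  using elem_in_mesh[OF assms(1-4)] assms(5)
  unfolding edge_jump_def[abs_def] by (cases "boundary_edge \<Omega> E") (auto intro!: continuous_intros)

text \<open>The value of \<open>g\<close> where the line through the points with \<open>co i\<close>-coordinate \<open>y\<close> meets the segment from
  \<open>p\<close> to \<open>q\<close>, and \<open>0\<close> if it does not meet it or is parallel to it.\<close>

definition edge_trace :: "2 \<Rightarrow> R2 \<Rightarrow> R2 \<Rightarrow> (R2 \<Rightarrow> real) \<Rightarrow> real \<Rightarrow> ennreal" where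
  "edge_trace i p q g y = (if p $ co i = q $ co i then 0 else
     ennreal (g (linepath p q ((y - p $ co i) / (q $ co i - p $ co i))))
       * indicator {0..1} ((y - p $ co i) / (q $ co i - p $ co i)))"

lemma continuous_on_linepath_compose:
  "continuous_on UNIV g \<Longrightarrow> continuous_on UNIV (\<lambda>t. g (linepath p q t))"
  by (rule continuous_on_compose2[of UNIV g]) (auto intro: continuous_on_linepath)

lemma edge_trace_measurable [measurable]:
  assumes "continuous_on UNIV g"
  shows "edge_trace i p q g \<in> borel_measurable borel"
proof -
  have [measurable]: "(\<lambda>t. g (linepath p q t)) \<in> borel_measurable borel"
    using continuous_on_linepath_compose[OF assms] by (rule borel_measurable_continuous_onI)
  have [measurable]: "(\<lambda>y. g (linepath p q ((y - p $ co i) / (q $ co i - p $ co i)))) \<in> borel_measurable borel"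
    by (rule measurable_compose[of _ _ borel "\<lambda>t. g (linepath p q t)"]) measurable
  show ?thesis unfolding edge_trace_def[abs_def] by measurable
qed

text \<open>Substituting the segment parameter for \<open>y\<close> produces the factor
  \<open>\<bar>q $ co i - p $ co i\<bar>\<close>, the length of the projection of the segment, which
  is at most the length of the segment.\<close>

lemma nn_integral_edge_trace:
  assumes g: "continuous_on UNIV g" "\<And>x. g x \<ge> 0"
  shows "(\<integral>\<^sup>+y. edge_trace i p q g y \<partial>lborel) \<le> ennreal (dist p q *\<^sub>R (LINT t|lebesgue_on {0..1}. g (linepath p q t)))"
proof (cases "p $ co i = q $ co i")
  case True
  then show ?thesis by (simp add: edge_trace_def)
next
  case False
  let ?c = "q $ co i - p $ co i"
  note [measurable] = edge_trace_measurable[OF g(1)]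
  have "(\<integral>\<^sup>+y. edge_trace i p q g y \<partial>lborel) = ennreal \<bar>?c\<bar> * (\<integral>\<^sup>+t. edge_trace i p q g (p $ co i + ?c * t) \<partial>lborel)"
    using False by (intro nn_integral_real_affine) auto
  also have "\<dots> = ennreal \<bar>?c\<bar> * (\<integral>\<^sup>+t\<in>{0..1}. ennreal (g (linepath p q t)) \<partial>lborel)"
    using False by (simp add: edge_trace_def)
  also have "\<dots> = ennreal \<bar>?c\<bar> * ennreal (LINT t|lebesgue_on {0..1}. g (linepath p q t))"
    using g continuous_on_linepath_compose[OF g(1)]
    by (subst LINT_lebesgue_on_eq_nn_integral) auto
  also have "\<dots> \<le> ennreal (dist p q) * ennreal (LINT t|lebesgue_on {0..1}. g (linepath p q t))"
  proof (intro mult_right_mono ennreal_leI)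
    show "\<bar>?c\<bar> \<le> dist p q"
      using component_le_norm_cart[of "q - p" "co i"] by (simp add: dist_norm norm_minus_commute)
  qed simp
  also have "\<dots> = ennreal (dist p q *\<^sub>R (LINT t|lebesgue_on {0..1}. g (linepath p q t)))"
    using g(2) by (simp add: ennreal_mult')
  finally show ?thesis .
qed

lemma edge_closed_segment:
  assumes "conforming_mesh \<Omega> M" "E \<in> edges M"
  obtains p q where "E = closed_segment p q" "p \<noteq> q"
    "\<And>f::R2 \<Rightarrow> 'b::{banach,second_countable_topology}.
       edge_integral E f = dist p q *\<^sub>R (LINT t|lebesgue_on {0..1}. f (linepath p q t))"
proof -
  obtain K where K: "2 simplex K" "E edge_of K" using assms by (auto simp: edges_def conforming_mesh_def)
  obtain p0 q0 where E: "E = closed_segment p0 q0" "p0 \<noteq> q0" using edge_of_triangle[OF K] by blast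
  obtain p q where pq: "E = closed_segment p q" "\<And>f::R2 \<Rightarrow> 'b::{banach,second_countable_topology}.
       edge_integral E f = dist p q *\<^sub>R (LINT t|lebesgue_on {0..1}. f (linepath p q t))"
    using edge_integral_eq[OF E(1), where 'b='b] by blast
  have "p0 \<in> closed_segment p q" "q0 \<in> closed_segment p q" using E(1) pq(1) by auto
  then have "p \<noteq> q" using E(2) by auto
  with pq that show thesis by blast
qed

text \<open>Integrating along both coordinate directions bounds the function by \<open>G 1 x\<^sub>2\<close> and by \<open>G 2 x\<^sub>1\<close>, so the
  integral of its square is at most the product of the integrals of \<open>G 1\<close> and \<open>G 2\<close>.\<close>

lemma piecewise_L2_le_BV:
  fixes f :: "R2 set \<Rightarrow> R2 \<Rightarrow> complex"
  assumes "open \<Omega>" "conforming_mesh \<Omega> M" "edge_normals \<Omega> M n"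
    and f: "\<And>K. K \<in> M \<Longrightarrow> Cn 1 (f K)"
  shows "(\<Sum>K\<in>M. LINT x|lebesgue_on K. (cmod (f K x))\<^sup>2)
     \<le> ((\<Sum>K\<in>M. LINT x|lebesgue_on K. norm (grad (f K) x))
        + (\<Sum>E\<in>edges M. edge_integral E (\<lambda>x. cmod (edge_jump \<Omega> M n E f x))))\<^sup>2" (is "?L \<le> ?B\<^sup>2")
proof -
  have M: "finite M" "\<And>K. K \<in> M \<Longrightarrow> 2 simplex K" "\<And>K. K \<in> M \<Longrightarrow> compact K"
    using assms(2) by (auto simp: conforming_mesh_def triangulation_def dest: compact_simplex)
  have Kb [measurable]: "K \<in> M \<Longrightarrow> K \<in> sets borel" for K
    using M(3) by (simp add: borel_closed compact_imp_closed)
  note fE = finite_edges[OF assms(2)]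
  let ?j = "\<lambda>E x. cmod (edge_jump \<Omega> M n E f x)"
  have jc: "continuous_on UNIV (?j E)" if "E \<in> edges M" for E
    by (intro continuous_on_norm continuous_on_edge_jump[OF assms(1-3) that] Cn1_continuous(1)[OF f])
  have "\<forall>E\<in>edges M. \<exists>pq. E = closed_segment (fst pq) (snd pq) \<and>
     edge_integral E (?j E) = dist (fst pq) (snd pq) *\<^sub>R (LINT t|lebesgue_on {0..1}. ?j E (linepath (fst pq) (snd pq) t))"
  proof
    fix E assume "E \<in> edges M"
    then obtain p q where "E = closed_segment p q" "\<And>f::R2 \<Rightarrow> real.
       edge_integral E f = dist p q *\<^sub>R (LINT t|lebesgue_on {0..1}. f (linepath p q t))"
      using edge_closed_segment[OF assms(2), where 'b=real] by blast
    then show "\<exists>pq. E = closed_segment (fst pq) (snd pq) \<and>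
     edge_integral E (?j E) = dist (fst pq) (snd pq) *\<^sub>R (LINT t|lebesgue_on {0..1}. ?j E (linepath (fst pq) (snd pq) t))"
      by (intro exI[of _ "(p, q)"]) simp
  qed
  from bchoice[OF this] obtain pq where
    pq: "\<forall>E\<in>edges M. E = closed_segment (fst (pq E)) (snd (pq E)) \<and>
     edge_integral E (?j E) = dist (fst (pq E)) (snd (pq E)) *\<^sub>R (LINT t|lebesgue_on {0..1}. ?j E (linepath (fst (pq E)) (snd (pq E)) t))"
    by blast
  let ?T = "\<lambda>i E. edge_trace i (fst (pq E)) (snd (pq E)) (?j E)"
  \<comment> \<open>All that the line at \<open>y\<close> can contribute, in a form whose
    measurability in \<open>y\<close> is visible: \<open>edge_trace\<close> replaces the values at
    the crossing points, which are given by a description.\<close>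
  define G where "G i y = (\<Sum>K\<in>M. \<integral>\<^sup>+s. ennreal (cmod (partial_deriv i (f K) (pt i s y))) * indicator K (pt i s y) \<partial>lborel)
     + (\<Sum>E\<in>edges M. ?T i E y)" for i y
  have pm [measurable]: "partial_deriv i (f K) \<in> borel_measurable borel" if "K \<in> M" for i K
    using Cn1_continuous(2)[OF f[OF that]] by (rule borel_measurable_continuous_onI)
  have tm: "?T i E \<in> borel_measurable borel" if "E \<in> edges M" for i E
    by (rule edge_trace_measurable[OF jc[OF that]])
  have km: "(\<lambda>y. \<integral>\<^sup>+s. ennreal (cmod (partial_deriv i (f K) (pt i s y))) * indicator K (pt i s y) \<partial>lborel) \<in> borel_measurable borel"
    if K: "K \<in> M" for K i
  proof -
    have [measurable]: "K \<in> sets borel" "partial_deriv i (f K) \<in> borel_measurable borel" using Kb[OF K] pm[OF K] .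
    show ?thesis by measurable
  qed
  have Gm: "G i \<in> borel_measurable borel" for i
    unfolding G_def[abs_def] by (intro borel_measurable_add borel_measurable_sum km tm)
  \<comment> \<open>Off the edges at most one summand is present, so \<open>\<Phi>\<close> is almost
    everywhere the modulus of the piecewise function.\<close>
  define \<Phi> where "\<Phi> x = ennreal (cmod (\<Sum>K\<in>M. if x \<in> K then f K x else 0))" for x
  have bound: "AE x in lborel. \<Phi> x \<le> G i (x $ co i)" for i
    using AE_generic[OF assms(2), of i] AE_not_on_edges[OF assms(2,3)]
  proof eventually_elim
    case (elim x)
    let ?y = "x $ co i"
    have "\<Phi> x \<le> (\<Sum>K\<in>M. \<integral>\<^sup>+s. ennreal (cmod (partial_deriv i (f K) (pt i s ?y))) * indicator K (pt i s ?y) \<partial>lborel)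
      + (\<Sum>E | E \<in> edges M \<and> (\<exists>s. pt i s ?y \<in> E). ennreal (?j E (crossing i ?y E)))"
      using piecewise_slice_bound[OF assms(1-3), of i ?y "x $ i" f "\<lambda>K. partial_deriv i (f K)",
          unfolded pt_collapse] elim Cn1_has_vector_derivative_pt[OF f] Cn1_continuous(2)[OF f]
      by (simp add: \<Phi>_def)
    also have "\<dots> \<le> G i ?y"
      unfolding G_def
    proof (rule add_left_mono)
      have "ennreal (?j E (crossing i ?y E)) \<le> ?T i E ?y" if E: "E \<in> edges M" and s: "pt i s ?y \<in> E" for E s
      proof -
        obtain K where K: "K \<in> M" "E edge_of K" using E by (auto simp: edges_def)
        have un: "unit_normal (n E) E" using assms(3) E by (simp add: edge_normals_def unit_normal_def)
        have "generic i ?y K" using elim(1) K(1) by blast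
        note c = crossing_on_segment[OF M(2)[OF K(1)] K(2) this un s, of "fst (pq E)" "snd (pq E)"]
        show ?thesis using c pq E unfolding edge_trace_def by simp
      qed
      then have "(\<Sum>E | E \<in> edges M \<and> (\<exists>s. pt i s ?y \<in> E). ennreal (?j E (crossing i ?y E)))
         \<le> (\<Sum>E | E \<in> edges M \<and> (\<exists>s. pt i s ?y \<in> E). ?T i E ?y)"
        by (intro sum_mono) blast
      also have "\<dots> \<le> (\<Sum>E\<in>edges M. ?T i E ?y)" using fE by (intro sum_mono2) auto
      finally show "(\<Sum>E | E \<in> edges M \<and> (\<exists>s. pt i s ?y \<in> E). ennreal (?j E (crossing i ?y E)))
         \<le> (\<Sum>E\<in>edges M. ?T i E ?y)" .
    qed
    finally show ?case .
  qed
  have Gint: "(\<integral>\<^sup>+y. G i y \<partial>lborel) \<le> ennreal ?B" for i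
  proof -
    have "(\<integral>\<^sup>+y. G i y \<partial>lborel) = (\<Sum>K\<in>M. \<integral>\<^sup>+y. \<integral>\<^sup>+s. ennreal (cmod (partial_deriv i (f K) (pt i s y))) * indicator K (pt i s y) \<partial>lborel \<partial>lborel)
     + (\<Sum>E\<in>edges M. \<integral>\<^sup>+y. ?T i E y \<partial>lborel)"
      unfolding G_def using km tm
      by (subst nn_integral_add) (auto simp: nn_integral_sum intro!: borel_measurable_sum)
    also have "\<dots> \<le> (\<Sum>K\<in>M. ennreal (LINT x|lebesgue_on K. norm (grad (f K) x)))
        + (\<Sum>E\<in>edges M. ennreal (edge_integral E (?j E)))"
    proof (intro add_mono sum_mono)
      fix K assume K: "K \<in> M"
      have [measurable]: "K \<in> sets borel" "partial_deriv i (f K) \<in> borel_measurable borel" using Kb[OF K] pm[OF K] .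
      have "(\<integral>\<^sup>+y. \<integral>\<^sup>+s. ennreal (cmod (partial_deriv i (f K) (pt i s y))) * indicator K (pt i s y) \<partial>lborel \<partial>lborel)
        = (\<integral>\<^sup>+x\<in>K. ennreal (cmod (partial_deriv i (f K) x)) \<partial>lborel)"
        by (rule nn_integral_pt[symmetric]) measurable
      also have "\<dots> \<le> (\<integral>\<^sup>+x\<in>K. ennreal (norm (grad (f K) x)) \<partial>lborel)"
      proof (intro nn_integral_mono mult_right_mono ennreal_leI)
        show "cmod (partial_deriv i (f K) x) \<le> norm (grad (f K) x)" for x
          using Finite_Cartesian_Product.norm_nth_le[of "grad (f K) x" i] by (simp add: grad_def)
      qed simp
      also have "\<dots> = ennreal (LINT x|lebesgue_on K. norm (grad (f K) x))"
        using Cn1_continuous(3)[OF f[OF K]] M(3)[OF K]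
        by (intro LINT_lebesgue_on_eq_nn_integral[symmetric] continuous_intros) auto
      finally show "(\<integral>\<^sup>+y. \<integral>\<^sup>+s. ennreal (cmod (partial_deriv i (f K) (pt i s y))) * indicator K (pt i s y) \<partial>lborel \<partial>lborel)
        \<le> ennreal (LINT x|lebesgue_on K. norm (grad (f K) x))" .
    next
      fix E assume E: "E \<in> edges M"
      show "(\<integral>\<^sup>+y. ?T i E y \<partial>lborel) \<le> ennreal (edge_integral E (?j E))"
        using nn_integral_edge_trace[OF jc[OF E], of i "fst (pq E)" "snd (pq E)"] pq E by simp
    qed
    also have "\<dots> = ennreal ?B"
    proof -
      have "edge_integral E (?j E) \<ge> 0" if "E \<in> edges M" for E
        using pq that by simp
      then show ?thesis by (simp add: sum_nonneg ennreal_plus)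
    qed
    finally show ?thesis .
  qed
  have B0: "?B \<ge> 0"
  proof -
    have "edge_integral E (?j E) \<ge> 0" if "E \<in> edges M" for E
      using pq that by simp
    then show ?thesis by (intro add_nonneg_nonneg sum_nonneg) auto
  qed
  have sq: "AE x in lborel. (\<Sum>K\<in>M. ennreal ((cmod (f K x))\<^sup>2) * indicator K x) = (\<Phi> x)\<^sup>2"
    using AE_not_on_edges[OF assms(2,3)]
  proof eventually_elim
    case (elim x)
    show ?case
    proof (cases "\<exists>K\<in>M. x \<in> K")
      case False
      then show ?thesis by (simp add: \<Phi>_def)
    next
      case True
      then obtain K where K: "K \<in> M" "x \<in> K" by blast
      have uni: "x \<in> K' \<longleftrightarrow> K' = K" if "K' \<in> M" for K'
        using mesh_point_unique[OF assms(2) K(1) that K(2)] elim K by blast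
      have "(\<Sum>K'\<in>M. ennreal ((cmod (f K' x))\<^sup>2) * indicator K' x) = (\<Sum>K'\<in>M. if K' = K then ennreal ((cmod (f K x))\<^sup>2) else 0)"
        using uni by (intro sum.cong refl) auto
      also have "\<dots> = ennreal ((cmod (f K x))\<^sup>2)" using M(1) K(1) by simp
      finally have 1: "(\<Sum>K'\<in>M. ennreal ((cmod (f K' x))\<^sup>2) * indicator K' x) = ennreal ((cmod (f K x))\<^sup>2)" .
      have "(\<Sum>K'\<in>M. if x \<in> K' then f K' x else 0) = (\<Sum>K'\<in>M. if K' = K then f K x else 0)"
        using uni by (intro sum.cong refl) auto
      also have "\<dots> = f K x" using M(1) K(1) by simp
      finally have 2: "(\<Sum>K'\<in>M. if x \<in> K' then f K' x else 0) = f K x" .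
      show ?thesis unfolding \<Phi>_def 1 2 by (simp add: ennreal_power)
    qed
  qed
  have "ennreal ?L = (\<Sum>K\<in>M. \<integral>\<^sup>+x\<in>K. ennreal ((cmod (f K x))\<^sup>2) \<partial>lborel)"
  proof -
    have "ennreal (LINT x|lebesgue_on K. (cmod (f K x))\<^sup>2) = (\<integral>\<^sup>+x\<in>K. ennreal ((cmod (f K x))\<^sup>2) \<partial>lborel)" if "K \<in> M" for K
      using Cn1_continuous(1)[OF f[OF that]] M(3)[OF that]
      by (intro LINT_lebesgue_on_eq_nn_integral continuous_intros) auto
    then show ?thesis by (subst sum_ennreal[symmetric]) auto
  qed
  also have "\<dots> = (\<integral>\<^sup>+x. (\<Sum>K\<in>M. ennreal ((cmod (f K x))\<^sup>2) * indicator K x) \<partial>lborel)"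
  proof (rule nn_integral_sum[symmetric])
    fix K assume K: "K \<in> M"
    have [measurable]: "K \<in> sets borel" "f K \<in> borel_measurable borel"
      using Kb[OF K] borel_measurable_continuous_onI[OF Cn1_continuous(1)[OF f[OF K]]] .
    show "(\<lambda>x. ennreal ((cmod (f K x))\<^sup>2) * indicator K x) \<in> borel_measurable lborel" by measurable
  qed
  also have "\<dots> = (\<integral>\<^sup>+x. (\<Phi> x)\<^sup>2 \<partial>lborel)" by (rule nn_integral_cong_AE[OF sq])
  also have "\<dots> \<le> (\<integral>\<^sup>+y. G 1 y \<partial>lborel) * (\<integral>\<^sup>+s. G 2 s \<partial>lborel)"
    using bound[of 1] bound[of 2] by (intro nn_integral_square_le_product Gm) (simp_all add: co_def)
  also have "\<dots> \<le> ennreal ?B * ennreal ?B" by (intro mult_mono Gint) auto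
  also have "\<dots> = ennreal (?B\<^sup>2)" using B0 by (simp add: ennreal_mult power2_eq_square)
  finally show ?thesis by (simp add: ennreal_le_iff)
qed


section \<open>The discontinuous Galerkin space\<close>

lemma partial_deriv_eq:
  "(f has_derivative f') (at x) \<Longrightarrow> partial_deriv i f x = f' (axis i 1)"
  unfolding partial_deriv_def by (metis frechet_derivative_at)

lemma Cn1_has_derivative:
  "Cn 1 f \<Longrightarrow> (f has_derivative frechet_derivative f (at x)) (at x)"
  by (simp add: frechet_derivative_works)

lemma Cn1I:
  assumes "\<And>x. (f has_derivative f' x) (at x)" "\<And>i. continuous_on UNIV (\<lambda>x. f' x (axis i 1))"
  shows "Cn 1 f"
proof -
  have "partial_deriv i f = (\<lambda>x. f' x (axis i 1))" for i
    using partial_deriv_eq[OF assms(1)] by blast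
  moreover have "f differentiable (at x)" for x using assms(1) differentiable_def by blast
  ultimately show ?thesis using assms(2) by simp
qed

lemma Cn1_const: "Cn 1 (\<lambda>x. c)"
  by (rule Cn1I[where f'="\<lambda>_ _. 0"]) (auto intro: continuous_intros)

lemma Cn1_coord: "Cn 1 (\<lambda>x. of_real (x $ i))"
proof (rule Cn1I)
  show "((\<lambda>x::R2. complex_of_real (x $ i)) has_derivative (\<lambda>h. of_real (h $ i))) (at x)" for x
    by (intro bounded_linear_imp_has_derivative bounded_linear_compose[OF bounded_linear_of_real] bounded_linear_vec_nth)
qed (intro continuous_intros)

lemma partial_deriv_add:
  assumes "Cn 1 f" "Cn 1 g"
  shows "partial_deriv i (\<lambda>x. f x + g x) x = partial_deriv i f x + partial_deriv i g x"
  by (subst partial_deriv_eq[OF has_derivative_add[OF assms[THEN Cn1_has_derivative]]])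
     (simp add: partial_deriv_def)

lemma partial_deriv_mult:
  assumes "Cn 1 f" "Cn 1 g"
  shows "partial_deriv i (\<lambda>x. f x * g x) x = f x * partial_deriv i g x + partial_deriv i f x * g x"
  by (subst partial_deriv_eq[OF has_derivative_mult[OF assms[THEN Cn1_has_derivative]]])
     (simp add: partial_deriv_def)

lemma partial_deriv_cmult:
  assumes "Cn 1 f"
  shows "partial_deriv i (\<lambda>x. c * f x) x = c * partial_deriv i f x"
  by (subst partial_deriv_eq[OF has_derivative_mult_right[OF Cn1_has_derivative[OF assms]]])
     (simp add: partial_deriv_def)

lemma Cn1_add:
  assumes "Cn 1 f" "Cn 1 g"
  shows "Cn 1 (\<lambda>x. f x + g x)"
proof (rule Cn1I)
  show "((\<lambda>x. f x + g x) has_derivative (\<lambda>h. frechet_derivative f (at x) h + frechet_derivative g (at x) h)) (at x)" for x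
    by (rule has_derivative_add[OF assms[THEN Cn1_has_derivative]])
  show "continuous_on UNIV (\<lambda>x. frechet_derivative f (at x) (axis i 1) + frechet_derivative g (at x) (axis i 1))" for i
    using assms[THEN Cn1_continuous(2), of i] unfolding partial_deriv_def[abs_def] by (rule continuous_on_add)
qed

lemma Cn1_mult:
  assumes "Cn 1 f" "Cn 1 g"
  shows "Cn 1 (\<lambda>x. f x * g x)"
proof (rule Cn1I)
  show "((\<lambda>x. f x * g x) has_derivative (\<lambda>h. f x * frechet_derivative g (at x) h + frechet_derivative f (at x) h * g x)) (at x)" for x
    by (rule has_derivative_mult[OF assms[THEN Cn1_has_derivative]])
  show "continuous_on UNIV (\<lambda>x. f x * frechet_derivative g (at x) (axis i 1) + frechet_derivative f (at x) (axis i 1) * g x)" for i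
    using assms[THEN Cn1_continuous(2), of i] assms[THEN Cn1_continuous(1)]
    unfolding partial_deriv_def[abs_def] by (intro continuous_intros)
qed

lemma Cn1_power: "Cn 1 f \<Longrightarrow> Cn 1 (\<lambda>x. f x ^ m)"
  by (induction m) (use Cn1_const Cn1_mult in \<open>auto simp del: Cn.simps\<close>)

lemma Cn1_sum: "(\<And>a. a \<in> A \<Longrightarrow> Cn 1 (f a)) \<Longrightarrow> Cn 1 (\<lambda>x. \<Sum>a\<in>A. f a x)"
  by (induction A rule: infinite_finite_induct) (simp_all add: Cn1_const Cn1_add del: Cn.simps One_nat_def)

lemma partial_deriv_power:
  assumes "Cn 1 f"
  shows "partial_deriv i (\<lambda>x. f x ^ m) x = of_nat m * f x ^ (m - 1) * partial_deriv i f x"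
proof (induction m)
  case 0
  show ?case by (simp add: partial_deriv_eq[OF has_derivative_const])
next
  case (Suc m)
  have "partial_deriv i (\<lambda>x. f x ^ Suc m) x = f x * partial_deriv i (\<lambda>x. f x ^ m) x + partial_deriv i f x * f x ^ m"
    unfolding power_Suc by (rule partial_deriv_mult[OF assms Cn1_power[OF assms]])
  also have "\<dots> = of_nat (Suc m) * f x ^ m * partial_deriv i f x"
    unfolding Suc by (cases m) (simp_all add: algebra_simps)
  finally show ?case by simp
qed

lemma Pk_Cn1:
  assumes "p \<in> Pk k" shows "Cn 1 p"
proof -
  obtain c where p: "p = (\<lambda>x. \<Sum>a\<le>k. \<Sum>b\<le>k - a. c a b * of_real ((x$1) ^ a * (x$2) ^ b))"
    using assms unfolding Pk_def by auto
  show ?thesis unfolding p of_real_mult of_real_power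
    by (intro Cn1_sum Cn1_mult Cn1_const Cn1_power Cn1_coord)
qed

lemma Pk_add:
  assumes "p \<in> Pk k" "q \<in> Pk k" shows "(\<lambda>x. p x + q x) \<in> Pk k"
proof -
  obtain c where p: "p = (\<lambda>x. \<Sum>a\<le>k. \<Sum>b\<le>k - a. c a b * of_real ((x$1) ^ a * (x$2) ^ b))"
    using assms unfolding Pk_def by auto
  obtain d where q: "q = (\<lambda>x. \<Sum>a\<le>k. \<Sum>b\<le>k - a. d a b * of_real ((x$1) ^ a * (x$2) ^ b))"
    using assms unfolding Pk_def by auto
  show ?thesis unfolding Pk_def p q
    by (intro CollectI exI[of _ "\<lambda>a b. c a b + d a b"]) (simp add: sum.distrib algebra_simps)
qed

lemma Pk_cmult:
  assumes "p \<in> Pk k" shows "(\<lambda>x. z * p x) \<in> Pk k"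
proof -
  obtain c where p: "p = (\<lambda>x. \<Sum>a\<le>k. \<Sum>b\<le>k - a. c a b * of_real ((x$1) ^ a * (x$2) ^ b))"
    using assms unfolding Pk_def by auto
  show ?thesis unfolding Pk_def p
    by (intro CollectI exI[of _ "\<lambda>a b. z * c a b"]) (simp add: sum_distrib_left algebra_simps)
qed

section \<open>Elementwise restrictions of members of the space\<close>

lemma triangle_interior_nonempty:
  assumes "2 simplex (K::R2 set)" shows "interior K \<noteq> {}"
proof -
  have K: "aff_dim K = 2" "convex K" using assms by (auto dest: aff_dim_simplex convex_simplex)
  then have "affine hull K = UNIV" using aff_dim_eq_full[of K] by simp
  then have "rel_interior K = interior K" by (simp add: rel_interior_interior)
  moreover have "K \<noteq> {}" using K(1) by auto
  ultimately show ?thesis using K(2) by (metis rel_interior_eq_empty)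
qed

text \<open>Continuity upgrades equality almost everywhere to equality on the interior of
  \<open>K\<close>, and the line argument extends it to the plane. Two degrees \<open>k\<close> and
  \<open>l\<close> appear because the description in \<open>restr\<close> ranges over polynomials of
  all degrees.\<close>

lemma Pk_AE_unique:
  assumes "2 simplex K" "p \<in> Pk k" "q \<in> Pk l" "AE x in lebesgue_on K. p x = q x"
  shows "p = q"
proof
  fix x
  have K: "K \<in> sets lebesgue" using assms(1) by (simp add: closed_simplex)
  have "AE x in lebesgue. x \<in> K \<longrightarrow> p x = q x"
    using assms(4) K by (subst (asm) AE_restrict_space_iff) auto
  then have "AE x\<in>interior K in lebesgue. x \<in> {x. p x - q x = 0}"
    by eventually_elim (use interior_subset in auto)
  moreover have "closed {x. p x - q x = 0}"
    using Cn1_continuous(1)[OF Pk_Cn1[OF assms(2)]] Cn1_continuous(1)[OF Pk_Cn1[OF assms(3)]]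
    by (intro closed_Collect_eq continuous_intros)
  ultimately have z: "p x - q x = 0" if "x \<in> interior K" for x
    using mem_closed_if_AE_lebesgue_open[of "interior K" "{x. p x - q x = 0}" x] that by auto
  have "p x - q x = 0"
    by (rule line_poly_zero_on_open[OF line_poly_diff[OF Pk_line_poly[OF assms(2)] Pk_line_poly[OF assms(3)]]
          open_interior triangle_interior_nonempty[OF assms(1)] z])
  then show "p x = q x" by simp
qed

lemma restr_eqI:
  assumes "2 simplex K" "p \<in> Pk k" "AE x in lebesgue_on K. v x = p x"
  shows "restr v K = p"
  unfolding restr_def
proof (rule the_equality)
  show "p \<in> (\<Union>k. Pk k) \<and> (AE x in lebesgue_on K. v x = p x)" using assms(2,3) by blast
next
  fix q assume q: "q \<in> (\<Union>k. Pk k) \<and> (AE x in lebesgue_on K. v x = q x)"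
  then obtain l where "q \<in> Pk l" by blast
  moreover have "AE x in lebesgue_on K. q x = p x"
    using q assms(3) by (auto elim: eventually_elim2)
  ultimately show "q = p" using Pk_AE_unique[OF assms(1) _ assms(2)] by blast
qed

lemma Vh_restr:
  assumes "conforming_mesh \<Omega> M" "v \<in> Vh k \<Omega> M" "K \<in> M"
  shows "restr v K \<in> Pk k" "AE x in lebesgue_on K. v x = restr v K x"
proof -
  have K: "2 simplex K" using assms(1,3) by (simp add: conforming_mesh_def)
  obtain p where p: "p \<in> Pk k" "AE x in lebesgue_on K. v x = p x"
    using assms(2,3) unfolding Vh_def by blast
  have "restr v K = p" by (rule restr_eqI[OF K p])
  then show "restr v K \<in> Pk k" "AE x in lebesgue_on K. v x = restr v K x" using p by auto
qed

lemma L2_add: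
  assumes "u \<in> L2 \<Omega>" "v \<in> L2 \<Omega>" shows "(\<lambda>x. u x + v x) \<in> L2 \<Omega>"
proof -
  have [measurable]: "u \<in> borel_measurable (lebesgue_on \<Omega>)" "v \<in> borel_measurable (lebesgue_on \<Omega>)"
    using assms by (auto simp: L2_def)
  have "integrable (lebesgue_on \<Omega>) (\<lambda>x. 2 * (cmod (u x))\<^sup>2 + 2 * (cmod (v x))\<^sup>2)"
    using assms by (auto simp: L2_def)
  then have "integrable (lebesgue_on \<Omega>) (\<lambda>x. (cmod (u x + v x))\<^sup>2)"
  proof (rule Bochner_Integration.integrable_bound)
    have "(cmod (u x + v x))\<^sup>2 \<le> 2 * (cmod (u x))\<^sup>2 + 2 * (cmod (v x))\<^sup>2" for x
    proof -
      have "(cmod (u x + v x))\<^sup>2 \<le> (cmod (u x) + cmod (v x))\<^sup>2"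
        by (intro power_mono norm_triangle_ineq) auto
      also have "\<dots> \<le> 2 * (cmod (u x))\<^sup>2 + 2 * (cmod (v x))\<^sup>2"
        using zero_le_power2[of "cmod (u x) - cmod (v x)"] by (simp add: power2_sum power2_diff)
      finally show ?thesis .
    qed
    then show "AE x in lebesgue_on \<Omega>. norm ((cmod (u x + v x))\<^sup>2) \<le> norm (2 * (cmod (u x))\<^sup>2 + 2 * (cmod (v x))\<^sup>2)"
      by simp
  qed measurable
  then show ?thesis by (simp add: L2_def)
qed

lemma L2_cmult:
  assumes "u \<in> L2 \<Omega>" shows "(\<lambda>x. c * u x) \<in> L2 \<Omega>"
  using assms by (auto simp: L2_def norm_mult power_mult_distrib)

lemma Vh_iff:
  "v \<in> Vh k \<Omega> M \<longleftrightarrow> v \<in> L2 \<Omega> \<and> (\<forall>K\<in>M. \<exists>p\<in>Pk k. AE x in lebesgue_on K. v x = p x)"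
  by (simp add: Vh_def)

lemma Vh_add:
  assumes "conforming_mesh \<Omega> M" "u \<in> Vh k \<Omega> M" "v \<in> Vh k \<Omega> M"
  shows "(\<lambda>x. u x + v x) \<in> Vh k \<Omega> M"
    "\<And>K. K \<in> M \<Longrightarrow> restr (\<lambda>x. u x + v x) K = (\<lambda>x. restr u K x + restr v K x)"
proof -
  have ae: "AE x in lebesgue_on K. u x + v x = restr u K x + restr v K x" if "K \<in> M" for K
    using Vh_restr(2)[OF assms(1,2) that] Vh_restr(2)[OF assms(1,3) that] by eventually_elim simp
  have pk: "(\<lambda>x. restr u K x + restr v K x) \<in> Pk k" if "K \<in> M" for K
    using Vh_restr(1)[OF assms(1,2) that] Vh_restr(1)[OF assms(1,3) that] by (rule Pk_add)
  have "(\<lambda>x. u x + v x) \<in> L2 \<Omega>" using assms(2,3) by (intro L2_add) (simp_all add: Vh_iff)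
  then show "(\<lambda>x. u x + v x) \<in> Vh k \<Omega> M"
    unfolding Vh_iff
  proof (intro conjI ballI)
    fix K assume K: "K \<in> M"
    show "\<exists>p\<in>Pk k. AE x in lebesgue_on K. u x + v x = p x"
      by (rule bexI[OF _ pk[OF K]]) (rule ae[OF K])
  qed
  show "restr (\<lambda>x. u x + v x) K = (\<lambda>x. restr u K x + restr v K x)" if "K \<in> M" for K
  proof (rule restr_eqI[OF _ pk ae])
    show "2 simplex K" using assms(1) that by (simp add: conforming_mesh_def)
  qed (use that in simp_all)
qed

lemma Vh_cmult:
  assumes "conforming_mesh \<Omega> M" "u \<in> Vh k \<Omega> M"
  shows "(\<lambda>x. c * u x) \<in> Vh k \<Omega> M"
    "\<And>K. K \<in> M \<Longrightarrow> restr (\<lambda>x. c * u x) K = (\<lambda>x. c * restr u K x)"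
proof -
  have ae: "AE x in lebesgue_on K. c * u x = c * restr u K x" if "K \<in> M" for K
    using Vh_restr(2)[OF assms(1,2) that] by eventually_elim simp
  have pk: "(\<lambda>x. c * restr u K x) \<in> Pk k" if "K \<in> M" for K
    using Vh_restr(1)[OF assms(1,2) that] by (rule Pk_cmult)
  have "(\<lambda>x. c * u x) \<in> L2 \<Omega>" using assms(2) by (intro L2_cmult) (simp add: Vh_iff)
  then show "(\<lambda>x. c * u x) \<in> Vh k \<Omega> M"
    unfolding Vh_iff
  proof (intro conjI ballI)
    fix K assume K: "K \<in> M"
    show "\<exists>p\<in>Pk k. AE x in lebesgue_on K. c * u x = p x"
      by (rule bexI[OF _ pk[OF K]]) (rule ae[OF K])
  qed
  show "restr (\<lambda>x. c * u x) K = (\<lambda>x. c * restr u K x)" if "K \<in> M" for K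
  proof (rule restr_eqI[OF _ pk ae])
    show "2 simplex K" using assms(1) that by (simp add: conforming_mesh_def)
  qed (use that in simp_all)
qed


section \<open>Broken Gagliardo--Nirenberg inequalities\<close>

lemma diameter_closed_segment:
  fixes p q :: "'a::euclidean_space"
  shows "diameter (closed_segment p q) = dist p q"
proof (rule antisym)
  show "diameter (closed_segment p q) \<le> dist p q"
  proof (rule diameter_le)
    fix x y assume "x \<in> closed_segment p q" "y \<in> closed_segment p q"
    then obtain s t where s: "0 \<le> s" "s \<le> 1" "x = (1 - s) *\<^sub>R p + s *\<^sub>R q"
      and t: "0 \<le> t" "t \<le> 1" "y = (1 - t) *\<^sub>R p + t *\<^sub>R q" by (auto simp: in_segment)
    have "x - y = (t - s) *\<^sub>R (p - q)" unfolding s(3) t(3) by (simp add: algebra_simps)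
    then have "norm (x - y) = \<bar>t - s\<bar> * dist p q" by (simp add: dist_norm)
    also have "\<dots> \<le> 1 * dist p q" using s t by (intro mult_right_mono) auto
    finally show "norm (x - y) \<le> dist p q" by simp
  qed simp
  show "dist p q \<le> diameter (closed_segment p q)"
    by (rule diameter_bounded_bound) (auto intro: compact_imp_bounded)
qed

lemma edge_integral_facts:
  assumes "conforming_mesh \<Omega> M" "E \<in> edges M"
  shows edge_integral_add: "\<And>f g :: R2 \<Rightarrow> 'b::{banach,second_countable_topology}.
      continuous_on UNIV f \<Longrightarrow> continuous_on UNIV g \<Longrightarrow>
      edge_integral E (\<lambda>x. f x + g x) = edge_integral E f + edge_integral E g"
    and edge_integral_bounded_linear: "\<And>(f :: R2 \<Rightarrow> 'b) (T :: 'b \<Rightarrow> 'b).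
      continuous_on UNIV f \<Longrightarrow> bounded_linear T \<Longrightarrow> edge_integral E (\<lambda>x. T (f x)) = T (edge_integral E f)"
proof -
  obtain p q where E: "E = closed_segment p q"
    and e: "\<And>f::R2 \<Rightarrow> 'b. edge_integral E f = dist p q *\<^sub>R (LINT t|lebesgue_on {0..1}. f (linepath p q t))"
    using edge_closed_segment[OF assms, where 'b='b] by metis
  have i: "integrable (lebesgue_on {0..1}) (\<lambda>t. f (linepath p q t))" if "continuous_on UNIV f" for f :: "R2 \<Rightarrow> 'b"
    by (rule integrable_lebesgue_on_compact[OF _ continuous_on_linepath_compose[OF that]]) simp
  show "edge_integral E (\<lambda>x. f x + g x) = edge_integral E f + edge_integral E g"
    if "continuous_on UNIV f" "continuous_on UNIV g" for f g :: "R2 \<Rightarrow> 'b"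
    unfolding e by (simp add: Bochner_Integration.integral_add[OF i[OF that(1)] i[OF that(2)]] scaleR_add_right)
  show "edge_integral E (\<lambda>x. T (f x)) = T (edge_integral E f)"
    if "continuous_on UNIV f" "bounded_linear T" for f :: "R2 \<Rightarrow> 'b" and T :: "'b \<Rightarrow> 'b"
    unfolding e using integral_bounded_linear[OF that(2) i[OF that(1)]] that(2)
    by (simp add: linear_simps(5))
qed

lemma edge_integral_mono:
  assumes "conforming_mesh \<Omega> M" "E \<in> edges M" "continuous_on UNIV f" "continuous_on UNIV g"
    and "\<And>x. x \<in> E \<Longrightarrow> f x \<le> g x"
  shows "edge_integral E f \<le> (edge_integral E g :: real)"
proof -
  obtain p q where E: "E = closed_segment p q"
    and e: "\<And>f::R2 \<Rightarrow> real. edge_integral E f = dist p q *\<^sub>R (LINT t|lebesgue_on {0..1}. f (linepath p q t))"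
    using edge_closed_segment[OF assms(1,2), where 'b=real] by metis
  have i: "integrable (lebesgue_on {0..1}) (\<lambda>t. f (linepath p q t))" if "continuous_on UNIV f" for f :: "R2 \<Rightarrow> real"
    by (rule integrable_lebesgue_on_compact[OF _ continuous_on_linepath_compose[OF that]]) simp
  have "f (linepath p q t) \<le> g (linepath p q t)" if "t \<in> {0..1}" for t
    using that by (intro assms(5)) (auto simp: E linepath_in_path)
  then have "(LINT t|lebesgue_on {0..1}. f (linepath p q t)) \<le> (LINT t|lebesgue_on {0..1}. g (linepath p q t))"
    by (intro integral_mono i assms(3,4)) (simp add: space_restrict_space)
  then show ?thesis unfolding e by (simp add: mult_left_mono)
qed

lemma edge_integral_const:
  assumes "conforming_mesh \<Omega> M" "E \<in> edges M"
  shows "edge_integral E (\<lambda>x. c) = diameter E * (c::real)"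
proof -
  obtain p q where E: "E = closed_segment p q"
    and e: "\<And>f::R2 \<Rightarrow> real. edge_integral E f = dist p q *\<^sub>R (LINT t|lebesgue_on {0..1}. f (linepath p q t))"
    using edge_closed_segment[OF assms, where 'b=real] by metis
  show ?thesis unfolding e by (simp add: E measure_restrict_space diameter_closed_segment)
qed

lemma edge_integral_nonneg:
  assumes "conforming_mesh \<Omega> M" "E \<in> edges M" "continuous_on UNIV f" "\<And>x. f x \<ge> (0::real)"
  shows "edge_integral E f \<ge> 0"
  using edge_integral_mono[OF assms(1,2) continuous_on_const[of UNIV 0] assms(3)]
    edge_integral_const[OF assms(1,2), of 0] assms(4) by simp

lemma edge_diameter:
  assumes "conforming_mesh \<Omega> M" "K \<in> M" "E edge_of K"
  shows "diameter E > 0" "diameter E \<le> mesh_size M"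
proof -
  have M: "finite M" "2 simplex K" using assms by (auto simp: conforming_mesh_def triangulation_def)
  obtain p q where E: "E = closed_segment p q" "p \<noteq> q" using edge_of_triangle[OF M(2) assms(3)] by metis
  show "diameter E > 0" using E by (simp add: diameter_closed_segment)
  have "diameter E \<le> diameter K"
    using edge_of_imp_subset[OF assms(3)] compact_simplex[OF M(2)]
    by (intro diameter_subset) (auto simp: compact_imp_bounded)
  also have "\<dots> \<le> mesh_size M" unfolding mesh_size_def using M(1) assms(2) by (intro Max_ge) auto
  finally show "diameter E \<le> mesh_size M" .
qed

text \<open>The inverse inequality bounds \<open>|p|^r\<close> on \<open>K\<close> by a multiple of
  its mean value over \<open>K\<close>. Quasi-uniformity bounds the area of \<open>K\<close> below
  by a multiple of the squared mesh size, and this is compensated by two factors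
  \<open>diameter E\<close>, one on the left and one from integrating over \<open>E\<close>.\<close>

lemma edge_trace_inequality:
  assumes "quasi_uniform mesh" "\<And>j. conforming_mesh \<Omega> (mesh j)"
  shows "\<exists>C>0. \<forall>j. \<forall>K\<in>mesh j. \<forall>E p. E edge_of K \<longrightarrow> p \<in> Pk k \<longrightarrow>
    diameter E * edge_integral E (\<lambda>x. cmod (p x) ^ r) \<le> C * (LINT x|lebesgue_on K. cmod (p x) ^ r)"
proof -
  obtain \<rho> where \<rho>: "\<rho> > 0" "\<And>j K. K \<in> mesh j \<Longrightarrow> \<exists>x. ball x (\<rho> * mesh_size (mesh j)) \<subseteq> K"
    using assms(1) unfolding quasi_uniform_def by blast
  obtain C0 where C0: "C0 > 0" and inv: "\<And>p K x. line_poly k p \<Longrightarrow> continuous_on UNIV p \<Longrightarrow> compact K \<Longrightarrow> convex K \<Longrightarrow> x \<in> K \<Longrightarrow>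
     ennreal (cmod (p x) ^ r) * emeasure lborel K
       \<le> ennreal C0 * (\<integral>\<^sup>+z\<in>K. ennreal (cmod (p z) ^ r) \<partial>lborel)"
    using inverse_inequality_nn[of k r] by blast
  define C where "C = C0 / (pi * \<rho>\<^sup>2)"
  have C: "C > 0" using C0 \<rho>(1) by (simp add: C_def)
  have "diameter E * edge_integral E (\<lambda>x. cmod (p x) ^ r) \<le> C * (LINT x|lebesgue_on K. cmod (p x) ^ r)"
    if K: "K \<in> mesh j" and E: "E edge_of K" and p: "p \<in> Pk k" for j K E p
  proof -
    let ?h = "mesh_size (mesh j)" and ?I = "LINT x|lebesgue_on K. cmod (p x) ^ r"
    have Ks: "2 simplex K" using assms(2) K by (auto simp: conforming_mesh_def)
    have Kc: "compact K" "convex K" using Ks by (auto dest: compact_simplex convex_simplex)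
    note d = edge_diameter[OF assms(2) K E]
    have h: "?h > 0" using d by linarith
    have pc: "continuous_on UNIV p" by (rule Cn1_continuous(1)[OF Pk_Cn1[OF p]])
    have prc: "continuous_on UNIV (\<lambda>x. cmod (p x) ^ r)" using pc by (intro continuous_intros)
    have Ed: "E \<in> edges (mesh j)" using K E by (auto simp: edges_def)
    obtain x0 where x0: "ball x0 (\<rho> * ?h) \<subseteq> K" using \<rho>(2)[OF K] by blast
    have "measure lebesgue (ball x0 (\<rho> * ?h)) \<le> measure lebesgue K"
      using x0 Kc(1) by (intro measure_mono_fmeasurable) (auto simp: lmeasurable_compact)
    then have vol: "pi * (\<rho> * ?h)\<^sup>2 \<le> measure lebesgue K"
      using \<rho>(1) h by (simp add: content_ball unit_ball_vol_2)
    have I0: "?I \<ge> 0" by simp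
    have px: "cmod (p x) ^ r \<le> C0 / (pi * (\<rho> * ?h)\<^sup>2) * ?I" if "x \<in> K" for x
    proof -
      have "emeasure lborel K = ennreal (measure lebesgue K)"
      proof -
        have "K \<in> sets lborel" using Kc(1) by (simp add: borel_closed compact_imp_closed)
        moreover have "emeasure lborel K < \<infinity>" using Kc(1) by (rule emeasure_compact_finite)
        ultimately show ?thesis by (simp add: emeasure_eq_ennreal_measure less_top)
      qed
      then have "ennreal (cmod (p x) ^ r * measure lebesgue K) \<le> ennreal (C0 * ?I)"
        using inv[OF Pk_line_poly[OF p] pc Kc that] LINT_lebesgue_on_eq_nn_integral[OF Kc(1) prc] C0
        by (simp add: ennreal_mult)
      then have "cmod (p x) ^ r * measure lebesgue K \<le> C0 * ?I"
        using C0 I0 by (simp add: ennreal_le_iff)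
      then have "cmod (p x) ^ r * (pi * (\<rho> * ?h)\<^sup>2) \<le> C0 * ?I"
        using mult_left_mono[OF vol, of "cmod (p x) ^ r"] by simp
      then show ?thesis using \<rho>(1) h by (simp add: pos_le_divide_eq)
    qed
    have "edge_integral E (\<lambda>x. cmod (p x) ^ r) \<le> edge_integral E (\<lambda>x. C0 / (pi * (\<rho> * ?h)\<^sup>2) * ?I)"
      using px edge_of_imp_subset[OF E]
      by (intro edge_integral_mono[OF assms(2) Ed prc continuous_on_const]) blast
    also have "\<dots> = diameter E * (C0 / (pi * (\<rho> * ?h)\<^sup>2) * ?I)"
      by (rule edge_integral_const[OF assms(2) Ed])
    finally have le: "edge_integral E (\<lambda>x. cmod (p x) ^ r) \<le> diameter E * (C0 / (pi * (\<rho> * ?h)\<^sup>2) * ?I)" .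
    have "diameter E * edge_integral E (\<lambda>x. cmod (p x) ^ r)
        \<le> diameter E * (diameter E * (C0 / (pi * (\<rho> * ?h)\<^sup>2) * ?I))"
      by (rule mult_left_mono[OF le]) (use d(1) in simp)
    also have "\<dots> = (diameter E)\<^sup>2 * (C0 / (pi * (\<rho> * ?h)\<^sup>2) * ?I)"
      by (simp add: power2_eq_square)
    also have "\<dots> \<le> ?h\<^sup>2 * (C0 / (pi * (\<rho> * ?h)\<^sup>2) * ?I)"
      using d C0 I0 by (intro mult_right_mono power_mono) auto
    also have "\<dots> = C * ?I" using h \<rho>(1) by (simp add: C_def power_mult_distrib)
    finally show ?thesis .
  qed
  then show ?thesis using C by blast
qed

text \<open>The number 8 counts all subsets of the three vertices; a count independent of the mesh
  is all that matters.\<close>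

lemma card_edges_le:
  assumes "2 simplex (K::R2 set)"
  shows "finite {E. E edge_of K}" "card {E. E edge_of K} \<le> 8"
proof -
  obtain C where C: "\<not> affine_dependent C" "int (card C) = 3" "K = convex hull C" "finite C"
    using assms(1) unfolding simplex by auto
  have sub: "{E. E edge_of K} \<subseteq> (hull) convex ` Pow C"
    using face_of_convex_hull_affine_independent[OF C(1)] unfolding edge_of_def C(3) by auto
  show "finite {E. E edge_of K}" using finite_subset[OF sub] C(4) by simp
  have "card {E. E edge_of K} \<le> card ((hull) convex ` Pow C)" using sub C(4) by (intro card_mono) auto
  also have "\<dots> \<le> card (Pow C)" using C(4) by (intro card_image_le) simp
  also have "\<dots> = 8" using C(2,4) by (simp add: card_Pow)
  finally show "card {E. E edge_of K} \<le> 8" .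
qed

text \<open>Elements overlap only on edges, and they cover the closure of the domain; edges and the
  frontier of a convex set are null. With an arbitrary continuous \<open>h\<close> one statement
  serves all powers of the modulus.\<close>

lemma LINT_mesh:
  assumes "open \<Omega>" "convex \<Omega>" "conforming_mesh \<Omega> M" "edge_normals \<Omega> M n" "v \<in> Vh k \<Omega> M"
    and h: "continuous_on UNIV (h :: complex \<Rightarrow> real)"
  shows "integrable (lebesgue_on \<Omega>) (\<lambda>x. h (v x))"
    "(LINT x|lebesgue_on \<Omega>. h (v x)) = (\<Sum>K\<in>M. LINT x|lebesgue_on K. h (restr v K x))"
proof -
  have M: "finite M" "\<And>K. K \<in> M \<Longrightarrow> 2 simplex K" "\<Union>M = closure \<Omega>" "\<And>K. K \<in> M \<Longrightarrow> compact K"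
    using assms(3) by (auto simp: conforming_mesh_def triangulation_def dest: compact_simplex)
  have Ks: "K \<in> sets lebesgue" if "K \<in> M" for K using M(4)[OF that] by (simp add: compact_imp_closed)
  have O: "\<Omega> \<in> sets lebesgue" using assms(1) by simp
  let ?g = "\<lambda>x. \<Sum>K\<in>M. indicator K x *\<^sub>R h (restr v K x)"
  have "AE x in lebesgue. x \<in> K \<longrightarrow> v x = restr v K x" if "K \<in> M" for K
    using Vh_restr(2)[OF assms(3,5) that] Ks[OF that] by (subst (asm) AE_restrict_space_iff) auto
  then have 1: "AE x in lebesgue. \<forall>K\<in>M. x \<in> K \<longrightarrow> v x = restr v K x" using M(1) by (intro AE_finite_allI)
  have "negligible (frontier \<Omega>)" using assms(2) by (rule negligible_convex_frontier)
  then have 2: "AE x in lebesgue. x \<notin> frontier \<Omega>" by (intro AE_not_in) (simp add: negligible_iff_null_sets)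
  have 3: "AE x in lebesgue. \<forall>E\<in>edges M. x \<notin> E" using AE_not_on_edges[OF assms(3,4)] by (rule AE_completion)
  have ae: "AE x in lebesgue. ?g x = indicator \<Omega> x *\<^sub>R h (v x)"
    using 1 2 3
  proof eventually_elim
    case (elim x)
    show ?case
    proof (cases "x \<in> \<Omega>")
      case True
      then obtain K where K: "K \<in> M" "x \<in> K" using M(3) closure_subset by blast
      have uni: "x \<in> K' \<longleftrightarrow> K' = K" if "K' \<in> M" for K'
        using mesh_point_unique[OF assms(3) K(1) that K(2)] elim K by blast
      have "?g x = (\<Sum>K'\<in>M. if K' = K then h (restr v K x) else 0)"
        using uni by (intro sum.cong refl) auto
      then show ?thesis using M(1) K elim(1) True by simp
    next
      case False
      then have "x \<notin> closure \<Omega>" using elim(2) assms(1) by (simp add: frontier_def interior_open)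
      then have "x \<notin> K" if "K \<in> M" for K using M(3) that by blast
      then show ?thesis using False by simp
    qed
  qed
  have i: "integrable lebesgue (\<lambda>x. indicator K x *\<^sub>R h (restr v K x))" if "K \<in> M" for K
  proof -
    have c: "continuous_on UNIV (restr v K)"
      by (rule Cn1_continuous(1)[OF Pk_Cn1[OF Vh_restr(1)[OF assms(3,5) that]]])
    have "continuous_on UNIV (\<lambda>x. h (restr v K x))"
      by (rule continuous_on_compose2[OF h c]) simp
    then have "integrable (lebesgue_on K) (\<lambda>x. h (restr v K x))"
      by (rule integrable_lebesgue_on_compact[OF M(4)[OF that]])
    then show ?thesis using Ks[OF that] by (subst (asm) integrable_restrict_space) auto
  qed
  have ig: "integrable lebesgue ?g" using i by (rule Bochner_Integration.integrable_sum)
  have vm: "v \<in> borel_measurable (lebesgue_on \<Omega>)" using assms(5) by (simp add: Vh_iff L2_def)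
  have "(\<lambda>x. h (v x)) \<in> borel_measurable (lebesgue_on \<Omega>)"
    by (rule measurable_compose[OF vm borel_measurable_continuous_onI[OF h]])
  then have hm: "(\<lambda>x. indicator \<Omega> x *\<^sub>R h (v x)) \<in> borel_measurable lebesgue"
    using O by (subst (asm) borel_measurable_restrict_space_iff) auto
  have "integrable lebesgue (\<lambda>x. indicator \<Omega> x *\<^sub>R h (v x))"
    by (rule integrable_cong_AE_imp[OF ig hm]) (use ae in \<open>auto elim: eventually_mono\<close>)
  then show "integrable (lebesgue_on \<Omega>) (\<lambda>x. h (v x))"
    using O by (subst integrable_restrict_space) auto
  have "(LINT x|lebesgue_on \<Omega>. h (v x)) = (LINT x|lebesgue. indicator \<Omega> x *\<^sub>R h (v x))"
    using O by (subst integral_restrict_space) auto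
  also have "\<dots> = (LINT x|lebesgue. ?g x)"
    by (rule integral_cong_AE[OF hm]) (use ae ig in \<open>auto elim: eventually_mono\<close>)
  also have "\<dots> = (\<Sum>K\<in>M. LINT x|lebesgue. indicator K x *\<^sub>R h (restr v K x))"
    using i by (rule Bochner_Integration.integral_sum)
  also have "\<dots> = (\<Sum>K\<in>M. LINT x|lebesgue_on K. h (restr v K x))"
    using Ks by (intro sum.cong refl) (subst integral_restrict_space, auto)
  finally show "(LINT x|lebesgue_on \<Omega>. h (v x)) = (\<Sum>K\<in>M. LINT x|lebesgue_on K. h (restr v K x))" .
qed

text \<open>The weight \<open>t = B / (2 * X)\<close> makes the first term \<open>B / 2\<close>; for
  \<open>X = 0\<close> a large weight rules out \<open>B > 0\<close>. This turns Young's inequality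
  back into Cauchy-Schwarz after bounds for many elements and edges have been added with a common
  weight.\<close>

lemma square_le_of_weighted:
  fixes B X Y :: real
  assumes "X \<ge> 0" "Y \<ge> 0" "B \<ge> 0" "\<And>t. t > 0 \<Longrightarrow> B \<le> t * X + Y / t"
  shows "B\<^sup>2 \<le> 4 * X * Y"
proof (cases "B = 0")
  case True then show ?thesis using assms(1,2) by simp
next
  case False
  then have B: "B > 0" using assms(3) by simp
  show ?thesis
  proof (cases "X = 0")
    case True
    have "B \<le> Y / (2 * (Y + 1) / B)" using assms(4)[of "2 * (Y + 1) / B"] assms(2) B True by simp
    also have "\<dots> = B * (Y / (2 * (Y + 1)))" by simp
    also have "\<dots> < B * 1" using assms(2) B by (intro mult_strict_left_mono) simp_all
    finally show ?thesis by simp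
  next
    case False
    then have X: "X > 0" using assms(1) by simp
    have "B \<le> B / (2 * X) * X + Y / (B / (2 * X))" using assms(4)[of "B / (2 * X)"] B X by simp
    then have "B \<le> B / 2 + 2 * X * Y / B" using X B by (simp add: field_simps)
    then show ?thesis using B by (simp add: field_simps power2_eq_square)
  qed
qed

text \<open>In the factorisation of \<open>a ^ m - b ^ m\<close> by \<open>a - b\<close>, each of
  the \<open>m\<close> terms of the second factor is at most the larger modulus to the power
  \<open>m - 1\<close>.\<close>

lemma norm_power_diff_le:
  fixes a b :: complex
  shows "cmod (a ^ m - b ^ m) \<le> real m * cmod (a - b) * (cmod a ^ (m - 1) + cmod b ^ (m - 1))"
proof -
  have "cmod (\<Sum>i<m. b ^ (m - Suc i) * a ^ i) \<le> (\<Sum>i<m. cmod a ^ (m - 1) + cmod b ^ (m - 1))"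
  proof (rule order_trans[OF norm_sum], rule sum_mono)
    fix i assume i: "i \<in> {..<m}"
    let ?M = "max (cmod a) (cmod b)"
    have "cmod (b ^ (m - Suc i) * a ^ i) \<le> ?M ^ (m - Suc i) * ?M ^ i"
      unfolding norm_mult norm_power by (intro mult_mono power_mono) (auto simp: le_max_iff_disj)
    also have "\<dots> = ?M ^ (m - 1)" using i by (simp flip: power_add)
    also have "\<dots> \<le> cmod a ^ (m - 1) + cmod b ^ (m - 1)" by (simp add: max_def)
    finally show "cmod (b ^ (m - Suc i) * a ^ i) \<le> cmod a ^ (m - 1) + cmod b ^ (m - 1)" .
  qed
  then have "cmod (a - b) * cmod (\<Sum>i<m. b ^ (m - Suc i) * a ^ i) \<le> cmod (a - b) * (real m * (cmod a ^ (m - 1) + cmod b ^ (m - 1)))"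
    by (intro mult_left_mono) auto
  then show ?thesis unfolding power_diff_sumr2 norm_mult by (simp add: mult_ac)
qed

lemma weighted_product_le:
  fixes a b t :: real
  assumes "t > 0"
  shows "a * b \<le> t * (b\<^sup>2 / 2) + a\<^sup>2 / (2 * t)"
proof -
  have "0 \<le> (a - t * b)\<^sup>2 / (2 * t)" using assms by simp
  also have "\<dots> = t * (b\<^sup>2 / 2) + a\<^sup>2 / (2 * t) - a * b"
    using assms by (simp add: power2_eq_square field_simps)
  finally show ?thesis by simp
qed

text \<open>The gradient of \<open>v ^ m\<close> carries the factor \<open>m |v| ^ (m - 1)\<close>,
  and its jump is bounded with the same factor taken from both sides. Young's inequality separates
  this factor, whose square integrates to the lower power on the right, from the gradient and the
  jump of \<open>v\<close>, whose squares form the DG norm.\<close>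

lemma broken_Gagliardo_Nirenberg:
  assumes "open \<Omega>" "convex \<Omega>" "\<And>j. conforming_mesh \<Omega> (mesh j)" "quasi_uniform mesh"
    "\<And>j. edge_normals \<Omega> (mesh j) (n j)" and m: "m \<ge> 1"
  shows "\<exists>C>0. \<forall>j. \<forall>v\<in>Vh k \<Omega> (mesh j).
    (LINT x|lebesgue_on \<Omega>. cmod (v x) ^ (2 * m))
      \<le> C * (DG_norm \<Omega> (mesh j) (n j) v)\<^sup>2 * (LINT x|lebesgue_on \<Omega>. cmod (v x) ^ (2 * (m - 1)))"
proof -
  obtain C0 where C0: "C0 > 0" and tr: "\<And>j K E p. K \<in> mesh j \<Longrightarrow> E edge_of K \<Longrightarrow> p \<in> Pk k \<Longrightarrow>
    diameter E * edge_integral E (\<lambda>x. cmod (p x) ^ (2 * (m - 1))) \<le> C0 * (LINT x|lebesgue_on K. cmod (p x) ^ (2 * (m - 1)))"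
    using edge_trace_inequality[OF assms(4,3), of k "2 * (m - 1)"] by metis
  \<comment> \<open>\<open>1/2\<close> comes from the gradients and \<open>8 * C0\<close> from the
    edges, at most \<open>8\<close> per element; the \<open>4\<close> and the product are those of
    \<open>square_le_of_weighted\<close>. The final \<open>1\<close> makes positivity
    evident.\<close>
  define C where "C = 4 * (real m * (1/2 + 8 * C0)) * (real m / 2) + 1"
  have C: "C > 0" unfolding C_def using C0 by (intro add_nonneg_pos) auto
  have "(LINT x|lebesgue_on \<Omega>. cmod (v x) ^ (2 * m))
      \<le> C * (DG_norm \<Omega> (mesh j) (n j) v)\<^sup>2 * (LINT x|lebesgue_on \<Omega>. cmod (v x) ^ (2 * (m - 1)))"
    if v: "v \<in> Vh k \<Omega> (mesh j)" for j v
  proof -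
    let ?M = "mesh j" and ?n = "n j"
    note cm = assms(3)[of j] and en = assms(5)[of j]
    have M: "finite ?M" "\<And>K. K \<in> ?M \<Longrightarrow> 2 simplex K" "\<And>K. K \<in> ?M \<Longrightarrow> compact K"
      using cm by (auto simp: conforming_mesh_def triangulation_def dest: compact_simplex)
    note fE = finite_edges[OF cm]
    define p where "p = restr v"
    have pk: "p K \<in> Pk k" if "K \<in> ?M" for K unfolding p_def by (rule Vh_restr(1)[OF cm v that])
    have p1: "Cn 1 (p K)" if "K \<in> ?M" for K by (rule Pk_Cn1[OF pk[OF that]])
    note pc = Cn1_continuous(1)[OF p1] and gc = Cn1_continuous(3)[OF p1]
    define f where "f K x = p K x ^ m" for K x
    have f1: "Cn 1 (f K)" if "K \<in> ?M" for K unfolding f_def[abs_def] by (rule Cn1_power[OF p1[OF that]])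
    define I where "I K = (LINT x|lebesgue_on K. cmod (p K x) ^ (2 * (m - 1)))" for K
    have I0: "I K \<ge> 0" for K unfolding I_def by simp
    define P where "P = (\<Sum>K\<in>?M. I K)"
    define Q1 where "Q1 = (\<Sum>K\<in>?M. LINT x|lebesgue_on K. (norm (grad (p K) x))\<^sup>2)"
    define J where "J E = 1 / diameter E * edge_integral E (\<lambda>x. (cmod (edge_jump \<Omega> ?M ?n E p x))\<^sup>2)" for E
    define Q2 where "Q2 = (\<Sum>E\<in>edges ?M. J E)"
    have jc: "continuous_on UNIV (edge_jump \<Omega> ?M ?n E p)" if "E \<in> edges ?M" for E
      by (rule continuous_on_edge_jump[OF assms(1) cm en that pc])
    have jfc: "continuous_on UNIV (edge_jump \<Omega> ?M ?n E f)" if "E \<in> edges ?M" for E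
      by (rule continuous_on_edge_jump[OF assms(1) cm en that Cn1_continuous(1)[OF f1]])
    have dE: "diameter E > 0" if "E \<in> edges ?M" for E
      using that edge_diameter(1)[OF cm] by (auto simp: edges_def)
    have J0: "J E \<ge> 0" if "E \<in> edges ?M" for E
      unfolding J_def using dE[OF that]
      by (intro mult_nonneg_nonneg edge_integral_nonneg[OF cm that] continuous_intros jc[OF that]) auto
    have P0: "P \<ge> 0" and Q10: "Q1 \<ge> 0" and Q20: "Q2 \<ge> 0"
      unfolding P_def Q1_def Q2_def using I0 J0 by (auto intro!: sum_nonneg)
    have DG: "(DG_norm \<Omega> ?M ?n v)\<^sup>2 = Q1 + Q2"
      using Q10 Q20 unfolding DG_norm_def Q1_def Q2_def J_def p_def by simp
    define BG where "BG = (\<Sum>K\<in>?M. LINT x|lebesgue_on K. norm (grad (f K) x))"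
    define BE where "BE = (\<Sum>E\<in>edges ?M. edge_integral E (\<lambda>x. cmod (edge_jump \<Omega> ?M ?n E f x)))"
    have BE0: "BE \<ge> 0"
      unfolding BE_def by (intro sum_nonneg edge_integral_nonneg[OF cm] continuous_intros jfc) auto
    have BG0: "BG \<ge> 0" unfolding BG_def by (intro sum_nonneg) auto
    have GB: "BG \<le> real m * (t * (P / 2) + Q1 / (2 * t))" if t: "t > 0" for t
    proof -
      have "(LINT x|lebesgue_on K. norm (grad (f K) x))
        \<le> real m * (t * (I K / 2) + (LINT x|lebesgue_on K. (norm (grad (p K) x))\<^sup>2) / (2 * t))" if K: "K \<in> ?M" for K
      proof -
        have i1: "integrable (lebesgue_on K) (\<lambda>x. norm (grad (f K) x))"
          by (intro integrable_lebesgue_on_compact[OF M(3)[OF K]] continuous_intros Cn1_continuous(3)[OF f1[OF K]])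
        have i2: "integrable (lebesgue_on K) (\<lambda>x. cmod (p K x) ^ (2 * (m - 1)))"
          by (intro integrable_lebesgue_on_compact[OF M(3)[OF K]] continuous_intros pc[OF K])
        have i3: "integrable (lebesgue_on K) (\<lambda>x. (norm (grad (p K) x))\<^sup>2)"
          by (intro integrable_lebesgue_on_compact[OF M(3)[OF K]] continuous_intros gc[OF K])
        have pw: "norm (grad (f K) x) \<le> real m * (t * (cmod (p K x) ^ (2 * (m - 1)) / 2) + (norm (grad (p K) x))\<^sup>2 / (2 * t))" for x
        proof -
          have "grad (f K) x $ i = (of_nat m * p K x ^ (m - 1)) * grad (p K) x $ i" for i
            unfolding grad_def f_def[abs_def] by (simp add: partial_deriv_power[OF p1[OF K]])
          then have "norm (grad (f K) x) = real m * (cmod (p K x) ^ (m - 1) * norm (grad (p K) x))"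
            unfolding norm_vec_def by (simp add: norm_mult norm_power L2_set_right_distrib mult.assoc)
          also have "\<dots> \<le> real m * (t * ((cmod (p K x) ^ (m - 1))\<^sup>2 / 2) + (norm (grad (p K) x))\<^sup>2 / (2 * t))"
            using weighted_product_le[OF t, of "norm (grad (p K) x)" "cmod (p K x) ^ (m - 1)"]
            by (intro mult_left_mono) (simp_all add: mult.commute)
          finally show ?thesis by (simp add: power_even_eq)
        qed
        have "(LINT x|lebesgue_on K. norm (grad (f K) x))
          \<le> (LINT x|lebesgue_on K. real m * (t * (cmod (p K x) ^ (2 * (m - 1)) / 2) + (norm (grad (p K) x))\<^sup>2 / (2 * t)))"
          by (rule integral_mono[OF i1 _ pw]) (use i2 i3 in simp)
        also have "\<dots> = real m * (t * (I K / 2) + (LINT x|lebesgue_on K. (norm (grad (p K) x))\<^sup>2) / (2 * t))"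
          unfolding I_def using i2 i3 by simp
        finally show ?thesis .
      qed
      then have "BG \<le> (\<Sum>K\<in>?M. real m * (t * (I K / 2) + (LINT x|lebesgue_on K. (norm (grad (p K) x))\<^sup>2) / (2 * t)))"
        unfolding BG_def by (rule sum_mono)
      also have "\<dots> = real m * (t * (P / 2) + Q1 / (2 * t))"
        unfolding P_def Q1_def by (simp add: sum.distrib sum_distrib_left sum_divide_distrib distrib_left)
      finally show ?thesis .
    qed
    have EB: "BE \<le> real m * (Q2 / (2 * t) + t * (8 * C0 * P))" if t: "t > 0" for t
    proof -
      have E1: "edge_integral E (\<lambda>x. cmod (edge_jump \<Omega> ?M ?n E f x))
         \<le> real m * (J E / (2 * t) + t * (C0 * (\<Sum>K | K \<in> ?M \<and> E edge_of K. I K)))" if E: "E \<in> edges ?M" for E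
      proof -
        let ?N = "{K. K \<in> ?M \<and> E edge_of K}"
        let ?j = "\<lambda>x. (cmod (edge_jump \<Omega> ?M ?n E p x))\<^sup>2"
        let ?w = "\<lambda>K x. cmod (p K x) ^ (2 * (m - 1))"
        let ?d = "diameter E"
        have fN: "finite ?N" using M(1) by simp
        \<comment> \<open>The weight is \<open>t * diameter E\<close>: its inverse is the factor of
          the jump in the DG norm, and the diameter itself is what the trace inequality asks
          for.\<close>
        have pw: "cmod (edge_jump \<Omega> ?M ?n E f x) \<le> real m / (2 * t * ?d) * ?j x + real m * t * ?d * (\<Sum>K\<in>?N. ?w K x)" for x
        proof -
          define w where "w = (\<Sum>K\<in>?N. cmod (p K x) ^ (m - 1))"
          have j1: "cmod (edge_jump \<Omega> ?M ?n E f x) \<le> real m * (cmod (edge_jump \<Omega> ?M ?n E p x) * w)"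
            and w2: "w\<^sup>2 \<le> 2 * (\<Sum>K\<in>?N. ?w K x)"
          proof -
            have "cmod (edge_jump \<Omega> ?M ?n E f x) \<le> real m * (cmod (edge_jump \<Omega> ?M ?n E p x) * w) \<and> w\<^sup>2 \<le> 2 * (\<Sum>K\<in>?N. ?w K x)"
            proof (cases "boundary_edge \<Omega> E")
              case True
              have N: "?N = {elem1 ?M ?n E}" by (rule boundary_edge_elements(1)[OF cm en E True])
              let ?a = "p (elem1 ?M ?n E) x"
              have "cmod ?a ^ m \<le> real m * (cmod ?a * cmod ?a ^ (m - 1))" if "m > 0"
              proof -
                have "cmod ?a * cmod ?a ^ (m - 1) = cmod ?a ^ m" using that by (simp flip: power_Suc)
                moreover have "1 * cmod ?a ^ m \<le> real m * cmod ?a ^ m" using that by (intro mult_right_mono) auto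
                ultimately show ?thesis by simp
              qed
              then show ?thesis
                unfolding w_def N edge_jump_def f_def using True m by (auto simp: norm_power power_even_eq)
            next
              case False
              note ie = interior_edge_elements[OF assms(1) cm en E False]
              let ?a = "p (elem1 ?M ?n E) x" and ?b = "p (elem2 ?M ?n E) x"
              have w: "w = cmod ?a ^ (m - 1) + cmod ?b ^ (m - 1)"
                unfolding w_def ie(1) using ie(2) by simp
              have W: "(\<Sum>K\<in>?N. ?w K x) = (cmod ?a ^ (m - 1))\<^sup>2 + (cmod ?b ^ (m - 1))\<^sup>2"
                unfolding ie(1) using ie(2) by (simp add: power_even_eq)
              have "w\<^sup>2 \<le> 2 * (\<Sum>K\<in>?N. ?w K x)"
                unfolding w W using zero_le_power2[of "cmod ?a ^ (m - 1) - cmod ?b ^ (m - 1)"]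
                by (simp add: power2_sum power2_diff)
              moreover have "cmod (edge_jump \<Omega> ?M ?n E f x) \<le> real m * (cmod (edge_jump \<Omega> ?M ?n E p x) * w)"
                unfolding edge_jump_def f_def w using False norm_power_diff_le[of ?a m ?b] by (simp add: mult.assoc)
              ultimately show ?thesis by blast
            qed
            then show "cmod (edge_jump \<Omega> ?M ?n E f x) \<le> real m * (cmod (edge_jump \<Omega> ?M ?n E p x) * w)"
              "w\<^sup>2 \<le> 2 * (\<Sum>K\<in>?N. ?w K x)" by auto
          qed
          have td: "t * ?d > 0" using t dE[OF E] by simp
          have "cmod (edge_jump \<Omega> ?M ?n E p x) * w \<le> t * ?d * (w\<^sup>2 / 2) + ?j x / (2 * (t * ?d))"
            by (rule weighted_product_le[OF td])
          also have "\<dots> \<le> t * ?d * (\<Sum>K\<in>?N. ?w K x) + ?j x / (2 * (t * ?d))"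
            using w2 td by (intro add_right_mono mult_left_mono) auto
          finally have "real m * (cmod (edge_jump \<Omega> ?M ?n E p x) * w)
              \<le> real m * (t * ?d * (\<Sum>K\<in>?N. ?w K x) + ?j x / (2 * (t * ?d)))" by (intro mult_left_mono) auto
          with j1 show ?thesis by (simp add: algebra_simps)
        qed
        have c1: "continuous_on UNIV ?j" by (intro continuous_intros jc[OF E])
        have c2: "continuous_on UNIV (?w K)" if "K \<in> ?N" for K using that by (intro continuous_intros pc) auto
        have c3: "continuous_on UNIV (\<lambda>x. \<Sum>K\<in>?N. ?w K x)" using c2 by (rule continuous_on_sum)
        have lin: "bounded_linear (\<lambda>x::real. c * x)" for c by (rule bounded_linear_mult_right)
        have sumE: "edge_integral E (\<lambda>x. \<Sum>K\<in>A. ?w K x) = (\<Sum>K\<in>A. edge_integral E (?w K))" if "A \<subseteq> ?N" for A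
          using finite_subset[OF that fN] that
        proof (induction A rule: finite_induct)
          case empty
          show ?case using edge_integral_const[OF cm E, of 0] by simp
        next
          case (insert K A)
          have "continuous_on UNIV (\<lambda>x. \<Sum>K\<in>A. ?w K x)" using insert.prems c2 by (intro continuous_on_sum) auto
          then have "edge_integral E (\<lambda>x. ?w K x + (\<Sum>K\<in>A. ?w K x)) = edge_integral E (?w K) + edge_integral E (\<lambda>x. \<Sum>K\<in>A. ?w K x)"
            using insert.prems c2 by (intro edge_integral_add[OF cm E]) auto
          then show ?case using insert by simp
        qed
        have "edge_integral E (\<lambda>x. cmod (edge_jump \<Omega> ?M ?n E f x))
          \<le> edge_integral E (\<lambda>x. real m / (2 * t * ?d) * ?j x + real m * t * ?d * (\<Sum>K\<in>?N. ?w K x))"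
          by (intro edge_integral_mono[OF cm E] continuous_intros jfc[OF E] c1 c3 pw)
        also have "\<dots> = edge_integral E (\<lambda>x. real m / (2 * t * ?d) * ?j x) + edge_integral E (\<lambda>x. real m * t * ?d * (\<Sum>K\<in>?N. ?w K x))"
          by (intro edge_integral_add[OF cm E] continuous_intros c1 c3)
        also have "\<dots> = real m / (2 * t * ?d) * edge_integral E ?j + real m * t * ?d * (\<Sum>K\<in>?N. edge_integral E (?w K))"
          by (simp only: edge_integral_bounded_linear[OF cm E c1 lin] edge_integral_bounded_linear[OF cm E c3 lin] sumE[OF order_refl])
        also have "\<dots> = real m * (J E / (2 * t)) + real m * t * (\<Sum>K\<in>?N. ?d * edge_integral E (?w K))"
          unfolding J_def by (simp add: sum_distrib_left mult_ac)
        also have "\<dots> \<le> real m * (J E / (2 * t)) + real m * t * (\<Sum>K\<in>?N. C0 * I K)"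
          unfolding I_def using t pk by (intro add_left_mono mult_left_mono sum_mono tr) auto
        also have "\<dots> = real m * (J E / (2 * t) + t * (C0 * (\<Sum>K\<in>?N. I K)))"
          by (simp add: sum_distrib_left algebra_simps)
        finally show ?thesis .
      qed
      have cnt: "(\<Sum>E\<in>edges ?M. \<Sum>K | K \<in> ?M \<and> E edge_of K. I K) \<le> 8 * P"
      proof -
        have "(\<Sum>E\<in>edges ?M. \<Sum>K | K \<in> ?M \<and> E edge_of K. I K) = (\<Sum>K\<in>?M. \<Sum>E | E \<in> edges ?M \<and> E edge_of K. I K)"
          using sum.swap_restrict[OF fE M(1), of "\<lambda>E K. I K" "\<lambda>E K. E edge_of K"] .
        also have "\<dots> \<le> (\<Sum>K\<in>?M. 8 * I K)"
        proof (rule sum_mono)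
          fix K assume K: "K \<in> ?M"
          have "card {E \<in> edges ?M. E edge_of K} \<le> card {E. E edge_of K}"
            using card_edges_le(1)[OF M(2)[OF K]] by (intro card_mono) auto
          then have "card {E \<in> edges ?M. E edge_of K} \<le> 8" using card_edges_le(2)[OF M(2)[OF K]] by linarith
          then show "(\<Sum>E | E \<in> edges ?M \<and> E edge_of K. I K) \<le> 8 * I K"
            using I0[of K] by (simp add: mult_right_mono)
        qed
        finally show ?thesis by (simp add: P_def sum_distrib_left)
      qed
      have "BE \<le> (\<Sum>E\<in>edges ?M. real m * (J E / (2 * t) + t * (C0 * (\<Sum>K | K \<in> ?M \<and> E edge_of K. I K))))"
        unfolding BE_def by (rule sum_mono[OF E1])
      also have "\<dots> = real m * (Q2 / (2 * t) + t * (C0 * (\<Sum>E\<in>edges ?M. \<Sum>K | K \<in> ?M \<and> E edge_of K. I K)))"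
        unfolding Q2_def by (simp add: sum.distrib sum_distrib_left sum_divide_distrib distrib_left)
      also have "\<dots> \<le> real m * (Q2 / (2 * t) + t * (C0 * (8 * P)))"
        using cnt t C0 by (intro mult_left_mono add_left_mono) auto
      finally show ?thesis by (simp add: mult_ac)
    qed
    have "BG + BE \<le> t * (real m * (1/2 + 8 * C0) * P) + (real m / 2 * (Q1 + Q2)) / t" if t: "t > 0" for t
      using GB[OF t] EB[OF t] t by (simp add: field_simps)
    then have "(BG + BE)\<^sup>2 \<le> 4 * (real m * (1/2 + 8 * C0) * P) * (real m / 2 * (Q1 + Q2))"
      using BG0 BE0 P0 Q10 Q20 C0 by (intro square_le_of_weighted) auto
    also have "\<dots> = (C - 1) * (Q1 + Q2) * P" by (simp add: C_def)
    also have "\<dots> \<le> C * (Q1 + Q2) * P" using P0 Q10 Q20 by (intro mult_right_mono) auto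
    finally have B: "(BG + BE)\<^sup>2 \<le> C * (Q1 + Q2) * P" .
    have int: "(LINT x|lebesgue_on \<Omega>. cmod (v x) ^ r) = (\<Sum>K\<in>?M. LINT x|lebesgue_on K. cmod (p K x) ^ r)" for r
      unfolding p_def by (rule LINT_mesh(2)[OF assms(1,2) cm en v]) (intro continuous_intros)
    have "(LINT x|lebesgue_on \<Omega>. cmod (v x) ^ (2 * m)) = (\<Sum>K\<in>?M. LINT x|lebesgue_on K. (cmod (f K x))\<^sup>2)"
      unfolding int f_def by (simp add: norm_power power_even_eq)
    also have "\<dots> \<le> (BG + BE)\<^sup>2"
      unfolding BG_def BE_def by (rule piecewise_L2_le_BV[OF assms(1) cm en f1])
    also note B
    finally show ?thesis unfolding DG int P_def I_def .
  qed
  then show ?thesis using C by blast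
qed


section \<open>Sesquilinearity of the discrete form\<close>

lemma grad_add:
  assumes "Cn 1 p" "Cn 1 q" shows "grad (\<lambda>x. p x + q x) x = grad p x + grad q x"
  by (simp add: vec_eq_iff grad_def partial_deriv_add[OF assms])

lemma grad_cmult:
  assumes "Cn 1 p" shows "grad (\<lambda>x. c * p x) x = (\<chi> i. c * grad p x $ i)"
  by (simp add: vec_eq_iff grad_def partial_deriv_cmult[OF assms])

lemma normal_comp_add: "normal_comp (g + h) m = normal_comp g m + normal_comp h m"
  by (simp add: normal_comp_def sum.distrib algebra_simps)

lemma normal_comp_scaleR: "normal_comp (r *\<^sub>R g) m = r *\<^sub>R normal_comp g m"
  by (simp add: normal_comp_def scaleR_sum_right)

lemma normal_comp_cmult: "normal_comp (\<chi> i. c * g $ i) m = c * normal_comp g m"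
  by (simp add: normal_comp_def sum_distrib_left mult.assoc)

locale dg_mesh =
  fixes \<Omega> :: "R2 set" and M :: "R2 set set" and n :: "R2 set \<Rightarrow> R2" and k :: nat
  assumes open_dom: "open \<Omega>" and mesh: "conforming_mesh \<Omega> M" and normals: "edge_normals \<Omega> M n"
begin

abbreviation "V \<equiv> Vh k \<Omega> M"

definition jump :: "(R2 \<Rightarrow> complex) \<Rightarrow> R2 set \<Rightarrow> R2 \<Rightarrow> complex" where
  "jump v E x = edge_jump \<Omega> M n E (restr v) x"

definition flux :: "(R2 \<Rightarrow> complex) \<Rightarrow> R2 set \<Rightarrow> R2 \<Rightarrow> complex" where
  "flux v E x = normal_comp (edge_avg \<Omega> M n E (\<lambda>K. grad (restr v K)) x) (n E)"

lemma restr_Cn1: "v \<in> V \<Longrightarrow> K \<in> M \<Longrightarrow> Cn 1 (restr v K)"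
  by (rule Pk_Cn1[OF Vh_restr(1)[OF mesh]])

lemma jump_add:
  assumes "u \<in> V" "v \<in> V" "E \<in> edges M"
  shows "jump (\<lambda>x. u x + v x) E x = jump u E x + jump v E x"
  using elem_in_mesh[OF open_dom mesh normals assms(3)]
  by (simp add: jump_def edge_jump_def Vh_add(2)[OF mesh assms(1,2)])

lemma jump_cmult:
  assumes "v \<in> V" "E \<in> edges M"
  shows "jump (\<lambda>x. c * v x) E x = c * jump v E x"
  using elem_in_mesh[OF open_dom mesh normals assms(2)]
  by (simp add: jump_def edge_jump_def Vh_cmult(2)[OF mesh assms(1)] algebra_simps)

lemma grad_restr_add:
  assumes "u \<in> V" "v \<in> V" "K \<in> M"
  shows "grad (restr (\<lambda>x. u x + v x) K) x = grad (restr u K) x + grad (restr v K) x"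
  by (simp only: Vh_add(2)[OF mesh assms] grad_add[OF restr_Cn1[OF assms(1,3)] restr_Cn1[OF assms(2,3)]])

lemma grad_restr_cmult:
  assumes "v \<in> V" "K \<in> M"
  shows "grad (restr (\<lambda>x. c * v x) K) x = (\<chi> i. c * grad (restr v K) x $ i)"
  by (simp only: Vh_cmult(2)[OF mesh assms] grad_cmult[OF restr_Cn1[OF assms]])

lemma flux_eq:
  "flux v E x = (if boundary_edge \<Omega> E then normal_comp (grad (restr v (elem1 M n E)) x) (n E)
     else (1/2) *\<^sub>R (normal_comp (grad (restr v (elem1 M n E)) x) (n E) + normal_comp (grad (restr v (elem2 M n E)) x) (n E)))"
  by (simp add: flux_def edge_avg_def normal_comp_add normal_comp_scaleR)

lemma flux_add:
  assumes "u \<in> V" "v \<in> V" "E \<in> edges M"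
  shows "flux (\<lambda>x. u x + v x) E x = flux u E x + flux v E x"
  using elem_in_mesh[OF open_dom mesh normals assms(3)]
  by (simp add: flux_eq grad_restr_add[OF assms(1,2)] normal_comp_add scaleR_add_right)

lemma flux_cmult:
  assumes "v \<in> V" "E \<in> edges M"
  shows "flux (\<lambda>x. c * v x) E x = c * flux v E x"
  using elem_in_mesh[OF open_dom mesh normals assms(2)]
  by (simp add: flux_eq grad_restr_cmult[OF assms(1)] normal_comp_cmult scaleR_conv_of_real algebra_simps)

lemma jump_continuous:
  assumes "v \<in> V" "E \<in> edges M" shows "continuous_on UNIV (jump v E)"
  unfolding jump_def[abs_def]
  using continuous_on_edge_jump[OF open_dom mesh normals assms(2) Cn1_continuous(1)[OF restr_Cn1[OF assms(1)]]]
  by simp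

lemma flux_continuous:
  assumes "v \<in> V" "E \<in> edges M" shows "continuous_on UNIV (flux v E)"
proof -
  have c: "continuous_on UNIV (\<lambda>x. normal_comp (grad (restr v K) x) m)" if "K \<in> M" for K m
    unfolding normal_comp_def
    by (intro continuous_intros Cn1_continuous(3)[OF restr_Cn1[OF assms(1) that]])
  show ?thesis
    using elem_in_mesh[OF open_dom mesh normals assms(2)] c
    unfolding flux_eq[abs_def] by (cases "boundary_edge \<Omega> E") (auto intro!: continuous_intros)
qed

lemmas edge_conts = jump_continuous flux_continuous

abbreviation "gform u v K x \<equiv> \<Sum>i\<in>UNIV. grad (restr u K) x $ i * cnj (grad (restr v K) x $ i)"

lemma gform_continuous:
  assumes "u \<in> V" "v \<in> V" "K \<in> M" shows "continuous_on UNIV (gform u v K)"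
  by (intro continuous_intros Cn1_continuous(3)[OF restr_Cn1[OF assms(1,3)]] Cn1_continuous(3)[OF restr_Cn1[OF assms(2,3)]])

lemma gform_integrable:
  assumes "u \<in> V" "v \<in> V" "K \<in> M" shows "integrable (lebesgue_on K) (gform u v K)"
proof (rule integrable_lebesgue_on_compact[OF _ gform_continuous[OF assms]])
  show "compact K" using mesh assms(3) by (auto simp: conforming_mesh_def dest: compact_simplex)
qed

lemma ah_eq: "ah \<Omega> M n lam u v =
     (\<Sum>K\<in>M. LINT x|lebesgue_on K. gform u v K x)
   - (\<Sum>E\<in>edges M. edge_integral E (\<lambda>x. flux u E x * cnj (jump v E x)))
   - (\<Sum>E\<in>edges M. edge_integral E (\<lambda>x. jump u E x * cnj (flux v E x)))
   + (\<Sum>E\<in>edges M. of_real (lam / diameter E) * edge_integral E (\<lambda>x. jump u E x * cnj (jump v E x)))"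
  unfolding ah_def flux_def jump_def by (rule refl)

lemma ah_add_left:
  assumes u: "u \<in> V" and w: "w \<in> V" and v: "v \<in> V"
  shows "ah \<Omega> M n lam (\<lambda>x. u x + w x) v = ah \<Omega> M n lam u v + ah \<Omega> M n lam w v"
proof -
  have 1: "(\<Sum>K\<in>M. LINT x|lebesgue_on K. gform (\<lambda>x. u x + w x) v K x)
     = (\<Sum>K\<in>M. LINT x|lebesgue_on K. gform u v K x) + (\<Sum>K\<in>M. LINT x|lebesgue_on K. gform w v K x)"
    unfolding sum.distrib[symmetric]
  proof (rule sum.cong[OF refl])
    fix K assume K: "K \<in> M"
    have "gform (\<lambda>x. u x + w x) v K x = gform u v K x + gform w v K x" for x
      by (simp add: grad_restr_add[OF u w K] sum.distrib algebra_simps)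
    then show "(LINT x|lebesgue_on K. gform (\<lambda>x. u x + w x) v K x)
       = (LINT x|lebesgue_on K. gform u v K x) + (LINT x|lebesgue_on K. gform w v K x)"
      using Bochner_Integration.integral_add[OF gform_integrable[OF u v K] gform_integrable[OF w v K]] by simp
  qed
  \<comment> \<open>Stated for arbitrary \<open>f\<close> and \<open>g\<close>, each of which
    becomes the jump or the flux, so that one argument settles all three edge terms.\<close>
  have e: "edge_integral E (\<lambda>x. f (\<lambda>x. u x + w x) E x * cnj (g v E x))
      = edge_integral E (\<lambda>x. f u E x * cnj (g v E x)) + edge_integral E (\<lambda>x. f w E x * cnj (g v E x))"
    if "E \<in> edges M" "\<And>x. f (\<lambda>x. u x + w x) E x = f u E x + f w E x"
       "continuous_on UNIV (f u E)" "continuous_on UNIV (f w E)" "continuous_on UNIV (g v E)"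
    for f g :: "(R2 \<Rightarrow> complex) \<Rightarrow> R2 set \<Rightarrow> R2 \<Rightarrow> complex" and E
  proof -
    have "(\<lambda>x. f (\<lambda>x. u x + w x) E x * cnj (g v E x)) = (\<lambda>x. f u E x * cnj (g v E x) + f w E x * cnj (g v E x))"
      unfolding that(2) by (simp add: distrib_right)
    then show ?thesis
      using that(3-5) by (simp only:) (intro edge_integral_add[OF mesh that(1)] continuous_intros)
  qed
  have 2: "(\<Sum>E\<in>edges M. edge_integral E (\<lambda>x. flux (\<lambda>x. u x + w x) E x * cnj (jump v E x)))
      = (\<Sum>E\<in>edges M. edge_integral E (\<lambda>x. flux u E x * cnj (jump v E x))) + (\<Sum>E\<in>edges M. edge_integral E (\<lambda>x. flux w E x * cnj (jump v E x)))"
    unfolding sum.distrib[symmetric]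
    by (rule sum.cong[OF refl], rule e) (auto intro: u w v flux_add edge_conts)
  have 3: "(\<Sum>E\<in>edges M. edge_integral E (\<lambda>x. jump (\<lambda>x. u x + w x) E x * cnj (flux v E x)))
      = (\<Sum>E\<in>edges M. edge_integral E (\<lambda>x. jump u E x * cnj (flux v E x))) + (\<Sum>E\<in>edges M. edge_integral E (\<lambda>x. jump w E x * cnj (flux v E x)))"
    unfolding sum.distrib[symmetric]
    by (rule sum.cong[OF refl], rule e) (auto intro: u w v jump_add edge_conts)
  have 4: "(\<Sum>E\<in>edges M. of_real (lam / diameter E) * edge_integral E (\<lambda>x. jump (\<lambda>x. u x + w x) E x * cnj (jump v E x)))
      = (\<Sum>E\<in>edges M. of_real (lam / diameter E) * edge_integral E (\<lambda>x. jump u E x * cnj (jump v E x)))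
        + (\<Sum>E\<in>edges M. of_real (lam / diameter E) * edge_integral E (\<lambda>x. jump w E x * cnj (jump v E x)))"
    unfolding sum.distrib[symmetric] distrib_left[symmetric]
    by (rule sum.cong[OF refl], rule arg_cong[where f="\<lambda>z. _ * z"], rule e) (auto intro: u w v jump_add edge_conts)
  show ?thesis unfolding ah_eq 1 2 3 4 by (simp only: algebra_simps)
qed

lemma ah_cmult_left:
  assumes u: "u \<in> V" and v: "v \<in> V"
  shows "ah \<Omega> M n lam (\<lambda>x. c * u x) v = c * ah \<Omega> M n lam u v"
proof -
  have 1: "(\<Sum>K\<in>M. LINT x|lebesgue_on K. gform (\<lambda>x. c * u x) v K x) = c * (\<Sum>K\<in>M. LINT x|lebesgue_on K. gform u v K x)"
    unfolding sum_distrib_left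
  proof (rule sum.cong[OF refl])
    fix K assume K: "K \<in> M"
    have "gform (\<lambda>x. c * u x) v K x = c * gform u v K x" for x
      by (simp add: grad_restr_cmult[OF u K] sum_distrib_left mult.assoc)
    then show "(LINT x|lebesgue_on K. gform (\<lambda>x. c * u x) v K x) = c * (LINT x|lebesgue_on K. gform u v K x)"
      by simp
  qed
  have e: "edge_integral E (\<lambda>x. f (\<lambda>x. c * u x) E x * cnj (g v E x)) = c * edge_integral E (\<lambda>x. f u E x * cnj (g v E x))"
    if "E \<in> edges M" "\<And>x. f (\<lambda>x. c * u x) E x = c * f u E x"
       "continuous_on UNIV (f u E)" "continuous_on UNIV (g v E)"
    for f g :: "(R2 \<Rightarrow> complex) \<Rightarrow> R2 set \<Rightarrow> R2 \<Rightarrow> complex" and E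
  proof -
    have "continuous_on UNIV (\<lambda>x. f u E x * cnj (g v E x))" using that(3,4) by (intro continuous_intros)
    from edge_integral_bounded_linear[OF mesh that(1) this bounded_linear_mult_right[of c]]
    show ?thesis unfolding that(2) by (simp add: mult.assoc)
  qed
  have 2: "(\<Sum>E\<in>edges M. edge_integral E (\<lambda>x. flux (\<lambda>x. c * u x) E x * cnj (jump v E x)))
      = c * (\<Sum>E\<in>edges M. edge_integral E (\<lambda>x. flux u E x * cnj (jump v E x)))"
    unfolding sum_distrib_left
    by (rule sum.cong[OF refl], rule e) (auto intro: u v flux_cmult edge_conts)
  have 3: "(\<Sum>E\<in>edges M. edge_integral E (\<lambda>x. jump (\<lambda>x. c * u x) E x * cnj (flux v E x)))
      = c * (\<Sum>E\<in>edges M. edge_integral E (\<lambda>x. jump u E x * cnj (flux v E x)))"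
    unfolding sum_distrib_left
    by (rule sum.cong[OF refl], rule e) (auto intro: u v jump_cmult edge_conts)
  have 4: "(\<Sum>E\<in>edges M. of_real (lam / diameter E) * edge_integral E (\<lambda>x. jump (\<lambda>x. c * u x) E x * cnj (jump v E x)))
      = c * (\<Sum>E\<in>edges M. of_real (lam / diameter E) * edge_integral E (\<lambda>x. jump u E x * cnj (jump v E x)))"
    unfolding sum_distrib_left mult.left_commute[of c]
    by (rule sum.cong[OF refl], rule arg_cong[where f="\<lambda>z. _ * z"], rule e) (auto intro: u v jump_cmult edge_conts)
  show ?thesis unfolding ah_eq 1 2 3 4 by (simp only: algebra_simps)
qed

text \<open>Exchanging the arguments swaps the two consistency terms up to conjugation and
  conjugates the volume and penalty terms, the penalty factors being real.\<close>

lemma ah_hermitian: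
  assumes u: "u \<in> V" and v: "v \<in> V"
  shows "ah \<Omega> M n lam v u = cnj (ah \<Omega> M n lam u v)"
proof -
  have 1: "(LINT x|lebesgue_on K. gform v u K x) = cnj (LINT x|lebesgue_on K. gform u v K x)" for K
  proof -
    have eq: "gform v u K = (\<lambda>x. cnj (gform u v K x))" by (simp add: fun_eq_iff cnj_sum mult.commute)
    show ?thesis by (subst eq) (rule Bochner_Integration.integral_cnj)
  qed
  have e: "edge_integral E (\<lambda>x. g v E x * cnj (f u E x)) = cnj (edge_integral E (\<lambda>x. f u E x * cnj (g v E x)))"
    if "E \<in> edges M" "continuous_on UNIV (f u E)" "continuous_on UNIV (g v E)"
    for f g :: "(R2 \<Rightarrow> complex) \<Rightarrow> R2 set \<Rightarrow> R2 \<Rightarrow> complex" and E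
  proof -
    have "continuous_on UNIV (\<lambda>x. f u E x * cnj (g v E x))" using that(2,3) by (intro continuous_intros)
    from edge_integral_bounded_linear[OF mesh that(1) this bounded_linear_cnj]
    show ?thesis by (simp add: mult.commute)
  qed
  have 2: "(\<Sum>E\<in>edges M. edge_integral E (\<lambda>x. flux v E x * cnj (jump u E x)))
      = cnj (\<Sum>E\<in>edges M. edge_integral E (\<lambda>x. jump u E x * cnj (flux v E x)))"
    unfolding cnj_sum by (rule sum.cong[OF refl], rule e) (auto intro: u v edge_conts)
  have 3: "(\<Sum>E\<in>edges M. edge_integral E (\<lambda>x. jump v E x * cnj (flux u E x)))
      = cnj (\<Sum>E\<in>edges M. edge_integral E (\<lambda>x. flux u E x * cnj (jump v E x)))"
    unfolding cnj_sum by (rule sum.cong[OF refl], rule e) (auto intro: u v edge_conts)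
  have 4: "(\<Sum>E\<in>edges M. of_real (lam / diameter E) * edge_integral E (\<lambda>x. jump v E x * cnj (jump u E x)))
      = cnj (\<Sum>E\<in>edges M. of_real (lam / diameter E) * edge_integral E (\<lambda>x. jump u E x * cnj (jump v E x)))"
    unfolding cnj_sum complex_cnj_mult complex_cnj_complex_of_real
    by (rule sum.cong[OF refl], rule arg_cong[where f="\<lambda>z. _ * z"], rule e) (auto intro: u v edge_conts)
  show ?thesis unfolding ah_eq 1 2 3 4 by (simp add: cnj_sum)
qed

end


section \<open>Bounded measurable functions and Hermitian forms\<close>

text \<open>On a domain of finite measure this class consists of integrable functions and is closed
  under all products that occur, so integrability of the nonlinear terms needs no Hoelder
  inequality. Piecewise polynomials belong to it.\<close>

definition bounded_measurable :: "R2 set \<Rightarrow> (R2 \<Rightarrow> 'a::{banach,second_countable_topology}) \<Rightarrow> bool" where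
  "bounded_measurable \<Omega> f \<longleftrightarrow> f \<in> borel_measurable (lebesgue_on \<Omega>) \<and> (\<exists>B. AE x in lebesgue_on \<Omega>. norm (f x) \<le> B)"

lemma bounded_measurable_dominated:
  assumes "bounded_measurable \<Omega> g" "f \<in> borel_measurable (lebesgue_on \<Omega>)" "\<And>x. norm (f x) \<le> norm (g x)"
  shows "bounded_measurable \<Omega> f"
proof -
  obtain B where B: "AE x in lebesgue_on \<Omega>. norm (g x) \<le> B" using assms(1) unfolding bounded_measurable_def by blast
  have "AE x in lebesgue_on \<Omega>. norm (f x) \<le> B"
    using B by eventually_elim (use assms(3) order_trans in blast)
  then show ?thesis using assms(2) unfolding bounded_measurable_def by blast
qed

lemma bounded_measurable_const: "bounded_measurable \<Omega> (\<lambda>x. c)"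
  unfolding bounded_measurable_def by (auto intro: exI[of _ "norm c"])

lemma bounded_measurable_add:
  assumes "bounded_measurable \<Omega> f" "bounded_measurable \<Omega> g"
  shows "bounded_measurable \<Omega> (\<lambda>x. f x + g x)"
proof -
  obtain A where A: "AE x in lebesgue_on \<Omega>. norm (f x) \<le> A" using assms(1) unfolding bounded_measurable_def by blast
  obtain B where B: "AE x in lebesgue_on \<Omega>. norm (g x) \<le> B" using assms(2) unfolding bounded_measurable_def by blast
  have "AE x in lebesgue_on \<Omega>. norm (f x + g x) \<le> A + B"
    using A B by eventually_elim (rule norm_triangle_mono)
  then show ?thesis using assms unfolding bounded_measurable_def by (auto intro: borel_measurable_add)
qed

lemma bounded_measurable_mult:
  fixes f g :: "R2 \<Rightarrow> 'a::{banach,second_countable_topology,real_normed_algebra}"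
  assumes "bounded_measurable \<Omega> f" "bounded_measurable \<Omega> g"
  shows "bounded_measurable \<Omega> (\<lambda>x. f x * g x)"
proof -
  obtain A where A: "AE x in lebesgue_on \<Omega>. norm (f x) \<le> A" using assms(1) unfolding bounded_measurable_def by blast
  obtain B where B: "AE x in lebesgue_on \<Omega>. norm (g x) \<le> B" using assms(2) unfolding bounded_measurable_def by blast
  have "AE x in lebesgue_on \<Omega>. norm (f x * g x) \<le> A * B"
    using A B
  proof eventually_elim
    case (elim x)
    have "norm (f x * g x) \<le> norm (f x) * norm (g x)" by (rule norm_mult_ineq)
    also have "\<dots> \<le> A * B" using elim order_trans[OF norm_ge_zero elim(1)] by (intro mult_mono) auto
    finally show ?case .
  qed
  then show ?thesis using assms unfolding bounded_measurable_def by (auto intro: borel_measurable_times)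
qed

lemma bounded_measurable_power:
  fixes f :: "R2 \<Rightarrow> 'a::{banach,second_countable_topology,real_normed_algebra_1}"
  assumes "bounded_measurable \<Omega> f" shows "bounded_measurable \<Omega> (\<lambda>x. f x ^ m)"
  by (induction m) (simp_all add: bounded_measurable_const bounded_measurable_mult[OF assms])

lemma bounded_measurable_norm:
  assumes "bounded_measurable \<Omega> f" shows "bounded_measurable \<Omega> (\<lambda>x. norm (f x))"
  using assms unfolding bounded_measurable_def by auto

lemma bounded_measurable_cnj:
  assumes "bounded_measurable \<Omega> f" shows "bounded_measurable \<Omega> (\<lambda>x. cnj (f x))"
  by (rule bounded_measurable_dominated[OF assms])
     (use assms in \<open>auto simp: bounded_measurable_def intro: measurable_compose[OF _ borel_measurable_continuous_onI] continuous_intros\<close>)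

lemma bounded_measurable_of_real:
  assumes "bounded_measurable \<Omega> f" shows "bounded_measurable \<Omega> (\<lambda>x. complex_of_real (f x))"
  by (rule bounded_measurable_dominated[OF bounded_measurable_norm[OF assms], unfolded norm_of_real real_norm_def])
     (use assms in \<open>auto simp: bounded_measurable_def\<close>)

lemma bounded_measurable_uminus:
  assumes "bounded_measurable \<Omega> f" shows "bounded_measurable \<Omega> (\<lambda>x. - f x)"
  using assms unfolding bounded_measurable_def by auto

lemma bounded_measurable_diff:
  assumes "bounded_measurable \<Omega> f" "bounded_measurable \<Omega> g"
  shows "bounded_measurable \<Omega> (\<lambda>x. f x - g x)"
  using bounded_measurable_add[OF assms(1) bounded_measurable_uminus[OF assms(2)]] by simp

lemmas bounded_measurable_intros = bounded_measurable_const bounded_measurable_add bounded_measurable_diff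
  bounded_measurable_mult bounded_measurable_power bounded_measurable_norm bounded_measurable_cnj
  bounded_measurable_of_real bounded_measurable_uminus

lemma bounded_measurable_integrable:
  assumes "\<Omega> \<in> lmeasurable" "bounded_measurable \<Omega> f"
  shows "integrable (lebesgue_on \<Omega>) f"
proof -
  interpret finite_measure "lebesgue_on \<Omega>"
    using assms(1) by (simp add: finite_measure_lebesgue_on)
  obtain B where "AE x in lebesgue_on \<Omega>. norm (f x) \<le> B" using assms(2) unfolding bounded_measurable_def by blast
  then show ?thesis using assms(2) unfolding bounded_measurable_def by (intro integrable_const_bound[of _ B]) auto
qed

text \<open>It is entered both with the discrete form and with the L^2 inner product, so that the
  identities for the midpoint are proved once. Nonnegativity replaces definiteness because members
  of \<open>V\<close> are functions and not classes.\<close>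

locale hermitian_form =
  fixes V :: "('a \<Rightarrow> complex) set" and a :: "('a \<Rightarrow> complex) \<Rightarrow> ('a \<Rightarrow> complex) \<Rightarrow> complex"
  assumes V_add: "u \<in> V \<Longrightarrow> v \<in> V \<Longrightarrow> (\<lambda>x. u x + v x) \<in> V"
    and V_cmult: "u \<in> V \<Longrightarrow> (\<lambda>x. c * u x) \<in> V"
    and add_left: "u \<in> V \<Longrightarrow> w \<in> V \<Longrightarrow> v \<in> V \<Longrightarrow> a (\<lambda>x. u x + w x) v = a u v + a w v"
    and cmult_left: "u \<in> V \<Longrightarrow> v \<in> V \<Longrightarrow> a (\<lambda>x. c * u x) v = c * a u v"
    and hermitian: "u \<in> V \<Longrightarrow> v \<in> V \<Longrightarrow> a v u = cnj (a u v)"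
    and nonneg: "v \<in> V \<Longrightarrow> Re (a v v) \<ge> 0"
begin

lemma add_right:
  assumes "u \<in> V" "v \<in> V" "w \<in> V" shows "a u (\<lambda>x. v x + w x) = a u v + a u w"
  by (simp only: hermitian[OF V_add[OF assms(2,3)] assms(1)] add_left[OF assms(2,3,1)]
      hermitian[OF assms(2,1)] hermitian[OF assms(3,1)] complex_cnj_add)

lemma cmult_right:
  assumes "u \<in> V" "v \<in> V" shows "a u (\<lambda>x. c * v x) = cnj c * a u v"
  by (simp only: hermitian[OF V_cmult[OF assms(2)] assms(1)] cmult_left[OF assms(2,1)]
      hermitian[OF assms(2,1)] complex_cnj_mult)

lemma V_diff: "u \<in> V \<Longrightarrow> v \<in> V \<Longrightarrow> (\<lambda>x. u x - v x) \<in> V"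
  using V_add[of u "\<lambda>x. -1 * v x"] V_cmult[of v "-1"] by simp

lemma diff_left:
  assumes "u \<in> V" "w \<in> V" "v \<in> V" shows "a (\<lambda>x. u x - w x) v = a u v - a w v"
  using add_left[OF assms(1) V_cmult[OF assms(2), of "-1"] assms(3)] cmult_left[OF assms(2,3), of "-1"] by simp

lemma diff_right:
  assumes "u \<in> V" "v \<in> V" "w \<in> V" shows "a u (\<lambda>x. v x - w x) = a u v - a u w"
  using add_right[OF assms(1,2) V_cmult[OF assms(3), of "-1"]] cmult_right[OF assms(1,3), of "-1"] by simp

lemma self_real: "v \<in> V \<Longrightarrow> a v v = of_real (Re (a v v))"
  using hermitian[of v v] by (simp add: complex_eq_iff)

text \<open>Expand the nonnegative form at \<open>t u - s v\<close>, where \<open>s\<close> is the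
  phase of \<open>a u v\<close>. Since \<open>sgn\<close> gives \<open>0\<close> when
  \<open>a u v = 0\<close>, the modulus of \<open>s\<close> is only used to be at most one.\<close>

lemma norm_form_le:
  assumes u: "u \<in> V" and v: "v \<in> V" and t: "t > 0"
  shows "cmod (a u v) \<le> t * Re (a u u) / 2 + Re (a v v) / (2 * t)"
proof -
  let ?s = "sgn (a u v)"
  let ?w = "\<lambda>x. of_real t * u x - ?s * v x"
  note tu = V_cmult[OF u, of "of_real t"] and sv = V_cmult[OF v, of ?s]
  have "a ?w ?w = of_real (t\<^sup>2) * a u u - of_real t * cnj ?s * a u v - of_real t * ?s * a v u + ?s * cnj ?s * a v v"
  proof -
    note ws = V_diff[OF tu sv]
    have "a ?w ?w = of_real t * a u ?w - ?s * a v ?w"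
      unfolding diff_left[OF tu sv ws] cmult_left[OF u ws] cmult_left[OF v ws] ..
    also have "a u ?w = of_real t * a u u - cnj ?s * a u v"
      unfolding diff_right[OF u tu sv] cmult_right[OF u u] cmult_right[OF u v] by simp
    also have "a v ?w = of_real t * a v u - cnj ?s * a v v"
      unfolding diff_right[OF v tu sv] cmult_right[OF v u] cmult_right[OF v v] by simp
    finally show ?thesis by (simp add: algebra_simps power2_eq_square)
  qed
  moreover have "cnj ?s * a u v = of_real (cmod (a u v))"
  proof (cases "a u v = 0")
    case False
    have "cnj ?s * a u v = (a u v * cnj (a u v)) / of_real (cmod (a u v))"
      by (simp add: sgn_div_norm scaleR_conv_of_real field_simps)
    also have "\<dots> = of_real (cmod (a u v))"
      using False by (simp only: complex_norm_square[symmetric]) (simp add: power2_eq_square)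
    finally show ?thesis .
  qed simp
  moreover have "?s * a v u = of_real (cmod (a u v))"
    using arg_cong[OF calculation(2), of cnj] hermitian[OF u v] by simp
  moreover have "?s * cnj ?s * a v v = of_real ((cmod ?s)\<^sup>2 * Re (a v v))"
    by (simp only: complex_norm_square[symmetric] of_real_mult self_real[OF v, symmetric])
  ultimately have "a ?w ?w = of_real (t\<^sup>2) * a u u - of_real (2 * t * cmod (a u v)) + of_real ((cmod ?s)\<^sup>2 * Re (a v v))"
    by (simp add: mult.assoc)
  then have "Re (a ?w ?w) = t\<^sup>2 * Re (a u u) - 2 * t * cmod (a u v) + (cmod ?s)\<^sup>2 * Re (a v v)"
    by simp
  moreover have "Re (a ?w ?w) \<ge> 0" by (rule nonneg[OF V_diff[OF tu sv]])
  moreover have "(cmod ?s)\<^sup>2 * Re (a v v) \<le> 1 * Re (a v v)"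
    using nonneg[OF v] by (intro mult_right_mono) (auto simp: norm_sgn)
  ultimately have "2 * t * cmod (a u v) \<le> t\<^sup>2 * Re (a u u) + Re (a v v)" by linarith
  then have "cmod (a u v) \<le> (t\<^sup>2 * Re (a u u) + Re (a v v)) / (2 * t)"
    using t by (simp add: pos_le_divide_eq mult.commute)
  also have "\<dots> = t * Re (a u u) / 2 + Re (a v v) / (2 * t)" using t by (simp add: field_simps power2_eq_square)
  finally show ?thesis .
qed

end


section \<open>The cubic term\<close>

definition cubic :: "(R2 \<Rightarrow> complex) \<Rightarrow> R2 \<Rightarrow> complex" where
  "cubic w x = of_real ((cmod (w x))\<^sup>2) * w x"

lemma norm_cubic: "cmod (cubic w x) = cmod (w x) ^ 3"
  by (simp add: cubic_def norm_mult norm_power power2_eq_square power3_eq_cube)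

text \<open>Write the difference as \<open>|w|^2 (w - z) + (|w|^2 - |z|^2) z\<close> and bound the
  last bracket by \<open>|w - z| (|w| + |z|)\<close>.\<close>

lemma cubic_diff_le:
  "cmod (cubic w x - cubic z x) \<le> 3/2 * ((cmod (w x))\<^sup>2 + (cmod (z x))\<^sup>2) * cmod (w x - z x)"
proof -
  let ?w = "cmod (w x)" and ?z = "cmod (z x)" and ?e = "cmod (w x - z x)"
  have "cubic w x - cubic z x = of_real (?w\<^sup>2) * (w x - z x) + of_real (?w\<^sup>2 - ?z\<^sup>2) * z x"
    by (simp add: cubic_def algebra_simps)
  then have "cmod (cubic w x - cubic z x) \<le> ?w\<^sup>2 * ?e + \<bar>?w\<^sup>2 - ?z\<^sup>2\<bar> * ?z"
    using norm_triangle_ineq[of "of_real (?w\<^sup>2) * (w x - z x)" "of_real (?w\<^sup>2 - ?z\<^sup>2) * z x"]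
    by (simp only: norm_mult norm_of_real abs_power2)
  also have "\<bar>?w\<^sup>2 - ?z\<^sup>2\<bar> = \<bar>?w - ?z\<bar> * (?w + ?z)"
  proof -
    have "?w\<^sup>2 - ?z\<^sup>2 = (?w - ?z) * (?w + ?z)" by (simp add: power2_eq_square algebra_simps)
    then show ?thesis by (simp add: abs_mult)
  qed
  also have "?w\<^sup>2 * ?e + \<bar>?w - ?z\<bar> * (?w + ?z) * ?z \<le> ?w\<^sup>2 * ?e + ?e * (?w + ?z) * ?z"
    by (intro add_left_mono mult_right_mono norm_triangle_ineq3) auto
  also have "\<dots> = (?w\<^sup>2 + ?w * ?z + ?z\<^sup>2) * ?e" by (simp add: algebra_simps power2_eq_square)
  also have "\<dots> \<le> 3/2 * (?w\<^sup>2 + ?z\<^sup>2) * ?e"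
  proof (rule mult_right_mono)
    show "?w\<^sup>2 + ?w * ?z + ?z\<^sup>2 \<le> 3/2 * (?w\<^sup>2 + ?z\<^sup>2)"
      using zero_le_power2[of "?w - ?z"] by (simp add: power2_diff)
  qed simp
  finally show ?thesis .
qed

text \<open>All that the analysis of the scheme keeps from the discretisation. Every mesh yields an
  interpretation with the same \<open>C\<close>, so constants made of \<open>C\<close>, the domain
  and the coefficients are uniform in the mesh.\<close>

locale CN_space = hermitian_form V a
  for \<Omega> :: "R2 set" and V :: "(R2 \<Rightarrow> complex) set" and a +
  fixes C :: real
  assumes domain: "\<Omega> \<in> lmeasurable"
    and V_bounded: "v \<in> V \<Longrightarrow> bounded_measurable \<Omega> v"
    and C_pos: "C > 0"
    and GN: "v \<in> V \<Longrightarrow> m \<in> {1, 2, 3} \<Longrightarrow>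
      (LINT x|lebesgue_on \<Omega>. cmod (v x) ^ (2 * m)) \<le> C * Re (a v v) * (LINT x|lebesgue_on \<Omega>. cmod (v x) ^ (2 * (m - 1)))"
begin

abbreviation A :: "(R2 \<Rightarrow> complex) \<Rightarrow> real" where "A v \<equiv> Re (a v v)"
abbreviation ip :: "(R2 \<Rightarrow> complex) \<Rightarrow> (R2 \<Rightarrow> complex) \<Rightarrow> complex" where "ip \<equiv> L2_inner \<Omega>"

text \<open>The \<open>r\<close>-th power of the L^r norm, kept as a power so that the inequalities
  need no roots.\<close>

definition mom :: "nat \<Rightarrow> (R2 \<Rightarrow> complex) \<Rightarrow> real" where
  "mom r v = (LINT x|lebesgue_on \<Omega>. cmod (v x) ^ r)"

lemmas bm = bounded_measurable_intros
lemmas bi = bounded_measurable_integrable[OF domain]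

lemma mom_nonneg: "mom r v \<ge> 0"
  by (simp add: mom_def)

lemma mom_0: "mom 0 v = measure lebesgue \<Omega>"
  using domain by (simp add: mom_def measure_restrict_space fmeasurableD)

lemma mom_integrable: "bounded_measurable \<Omega> v \<Longrightarrow> integrable (lebesgue_on \<Omega>) (\<lambda>x. cmod (v x) ^ r)"
  by (intro bi bm)

lemma mom2_le: "v \<in> V \<Longrightarrow> mom 2 v \<le> C * measure lebesgue \<Omega> * A v"
  using GN[of v 1] mom_0[of v] by (simp add: mom_def mult_ac)

lemma mom4_le: "v \<in> V \<Longrightarrow> mom 4 v \<le> C * A v * mom 2 v"
  using GN[of v 2] by (simp add: mom_def)

lemma mom6_le: "v \<in> V \<Longrightarrow> mom 6 v \<le> C * A v * mom 4 v"
  using GN[of v 3] by (simp add: mom_def)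

lemma integrable_product:
  assumes "bounded_measurable \<Omega> f" "bounded_measurable \<Omega> g"
  shows "integrable (lebesgue_on \<Omega>) (\<lambda>x. f x * cnj (g x))"
  by (intro bi bm assms)

lemma ip_add_left:
  assumes "bounded_measurable \<Omega> f" "bounded_measurable \<Omega> g" "bounded_measurable \<Omega> h"
  shows "ip (\<lambda>x. f x + g x) h = ip f h + ip g h"
  unfolding L2_inner_def distrib_right
  by (rule Bochner_Integration.integral_add; rule integrable_product; fact)

lemma ip_diff_left:
  assumes "bounded_measurable \<Omega> f" "bounded_measurable \<Omega> g" "bounded_measurable \<Omega> h"
  shows "ip (\<lambda>x. f x - g x) h = ip f h - ip g h"
  unfolding L2_inner_def left_diff_distrib
  by (rule Bochner_Integration.integral_diff; rule integrable_product; fact)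

lemma ip_cmult_left: "ip (\<lambda>x. c * f x) h = c * ip f h"
  unfolding L2_inner_def by (simp add: mult.assoc)

lemma ip_hermitian: "ip g f = cnj (ip f g)"
proof -
  have "(\<lambda>x. g x * cnj (f x)) = (\<lambda>x. cnj (f x * cnj (g x)))" by (simp add: fun_eq_iff mult.commute)
  then show ?thesis unfolding L2_inner_def by (simp only: Bochner_Integration.integral_cnj)
qed

lemma ip_self: "ip v v = of_real (mom 2 v)"
  unfolding L2_inner_def mom_def complex_norm_square[symmetric] by (rule integral_complex_of_real)

sublocale ip: hermitian_form V ip
proof
  show "(\<lambda>x. u x + v x) \<in> V" if "u \<in> V" "v \<in> V" for u v using that by (rule V_add)
  show "(\<lambda>x. c * u x) \<in> V" if "u \<in> V" for u c using that by (rule V_cmult)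
  show "ip (\<lambda>x. u x + w x) v = ip u v + ip w v" if "u \<in> V" "w \<in> V" "v \<in> V" for u w v
    using that by (intro ip_add_left V_bounded)
  show "ip (\<lambda>x. c * u x) v = c * ip u v" for c u v by (rule ip_cmult_left)
  show "ip v u = cnj (ip u v)" for u v by (rule ip_hermitian)
  show "Re (ip v v) \<ge> 0" for v by (simp add: ip_self mom_nonneg)
qed

lemma cubic_bounded: "bounded_measurable \<Omega> w \<Longrightarrow> bounded_measurable \<Omega> (cubic w)"
  unfolding cubic_def[abs_def] by (intro bm)

lemma ip_cubic_self: "ip (cubic w) w = of_real (mom 4 w)"
proof -
  have "cubic w x * cnj (w x) = of_real (cmod (w x) ^ 4)" for x
    unfolding cubic_def mult.assoc complex_norm_square[symmetric] of_real_mult[symmetric] power_add[symmetric] by simp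
  then show ?thesis unfolding L2_inner_def mom_def by (simp only: integral_complex_of_real)
qed

lemma norm_ip_le:
  assumes "bounded_measurable \<Omega> f" "bounded_measurable \<Omega> g" "integrable (lebesgue_on \<Omega>) h"
    "\<And>x. cmod (f x) * cmod (g x) \<le> h x"
  shows "cmod (ip f g) \<le> (LINT x|lebesgue_on \<Omega>. h x)"
  unfolding L2_inner_def
  by (rule Bochner_Integration.integral_norm_bound_integral[OF integrable_product[OF assms(1,2)] assms(3)]) (use assms(4) in \<open>simp add: norm_mult\<close>)

lemma ip_cubic_le6:
  assumes "bounded_measurable \<Omega> w" "bounded_measurable \<Omega> d" "t > 0"
  shows "cmod (ip (cubic w) d) \<le> t * mom 6 w / 2 + mom 2 d / (2 * t)"
proof -
  have "cmod (ip (cubic w) d) \<le> (LINT x|lebesgue_on \<Omega>. t * (cmod (w x) ^ 6 / 2) + cmod (d x) ^ 2 / (2 * t))"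
  proof (rule norm_ip_le[OF cubic_bounded[OF assms(1)] assms(2)])
    show "integrable (lebesgue_on \<Omega>) (\<lambda>x. t * (cmod (w x) ^ 6 / 2) + cmod (d x) ^ 2 / (2 * t))"
      using mom_integrable[OF assms(1), of 6] mom_integrable[OF assms(2), of 2] by simp
    fix x
    have "cmod (d x) * cmod (w x) ^ 3 \<le> t * ((cmod (w x) ^ 3)\<^sup>2 / 2) + (cmod (d x))\<^sup>2 / (2 * t)"
      by (rule weighted_product_le[OF assms(3)])
    then show "cmod (cubic w x) * cmod (d x) \<le> t * (cmod (w x) ^ 6 / 2) + cmod (d x) ^ 2 / (2 * t)"
      by (simp add: norm_cubic mult.commute flip: power_mult)
  qed
  also have "\<dots> = t * mom 6 w / 2 + mom 2 d / (2 * t)"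
    unfolding mom_def using mom_integrable[OF assms(1), of 6] mom_integrable[OF assms(2), of 2] by simp
  finally show ?thesis .
qed

text \<open>Pointwise this is Young's inequality with exponents 4/3 and 4, obtained by applying the
  quadratic version to \<open>(|w| |g|) |w|^2\<close> and then to \<open>|g|^2 |w|^2\<close>; the
  coefficient \<open>3/4 * s\<close> is \<open>s/2 + s/4\<close>.\<close>

lemma ip_cubic_le4:
  assumes "bounded_measurable \<Omega> w" "bounded_measurable \<Omega> g" "s > 0"
  shows "cmod (ip (cubic w) g) \<le> 3/4 * s * mom 4 w + mom 4 g / (4 * s ^ 3)"
proof -
  have "cmod (ip (cubic w) g) \<le> (LINT x|lebesgue_on \<Omega>. 3/4 * s * cmod (w x) ^ 4 + cmod (g x) ^ 4 / (4 * s ^ 3))"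
  proof (rule norm_ip_le[OF cubic_bounded[OF assms(1)] assms(2)])
    show "integrable (lebesgue_on \<Omega>) (\<lambda>x. 3/4 * s * cmod (w x) ^ 4 + cmod (g x) ^ 4 / (4 * s ^ 3))"
      using mom_integrable[OF assms(1), of 4] mom_integrable[OF assms(2), of 4] by simp
    fix x
    let ?w = "cmod (w x)" and ?g = "cmod (g x)"
    have 1: "(?w * ?g) * ?w\<^sup>2 \<le> s * ((?w\<^sup>2)\<^sup>2 / 2) + (?w * ?g)\<^sup>2 / (2 * s)"
      by (rule weighted_product_le[OF assms(3)])
    have 2: "?g\<^sup>2 * ?w\<^sup>2 \<le> s\<^sup>2 * ((?w\<^sup>2)\<^sup>2 / 2) + (?g\<^sup>2)\<^sup>2 / (2 * s\<^sup>2)"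
      using assms(3) by (intro weighted_product_le) simp
    have "?w ^ 3 * ?g = (?w * ?g) * ?w\<^sup>2" by (simp add: power2_eq_square power3_eq_cube)
    also note 1
    also have "(?w * ?g)\<^sup>2 / (2 * s) \<le> (s\<^sup>2 * ((?w\<^sup>2)\<^sup>2 / 2) + (?g\<^sup>2)\<^sup>2 / (2 * s\<^sup>2)) / (2 * s)"
      using 2 assms(3) by (intro divide_right_mono) (simp_all add: power_mult_distrib mult.commute)
    also have "s * ((?w\<^sup>2)\<^sup>2 / 2) + (s\<^sup>2 * ((?w\<^sup>2)\<^sup>2 / 2) + (?g\<^sup>2)\<^sup>2 / (2 * s\<^sup>2)) / (2 * s)
       = 3/4 * s * ?w ^ 4 + ?g ^ 4 / (4 * s ^ 3)"
      using assms(3) by (simp add: field_simps power2_eq_square power3_eq_cube power4_eq_xxxx)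
    finally show "cmod (cubic w x) * ?g \<le> 3/4 * s * ?w ^ 4 + ?g ^ 4 / (4 * s ^ 3)"
      by (simp only: norm_cubic)
  qed
  also have "\<dots> = 3/4 * s * mom 4 w + mom 4 g / (4 * s ^ 3)"
    unfolding mom_def using mom_integrable[OF assms(1), of 4] mom_integrable[OF assms(2), of 4] by simp
  finally show ?thesis .
qed

text \<open>Cauchy-Schwarz moves everything to fourth moments, and the fourth moment of
  \<open>e\<close> is at most \<open>C * A e * mom 2 e\<close>. Hence only the L^4 norms of
  \<open>w\<close> and \<open>z\<close> enter, and \<open>\<epsilon>\<close> balances the two
  quantities that a step can absorb.\<close>

lemma ip_cubic_diff_le:
  assumes w: "w \<in> V" and z: "z \<in> V" and e: "e \<in> V" and ew: "\<And>x. e x = w x - z x" and eps: "\<epsilon> > 0"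
  shows "cmod (ip (\<lambda>x. cubic w x - cubic z x) e)
     \<le> 3/2 * (\<epsilon> * A e + (mom 4 w + mom 4 z) * C / (2 * \<epsilon>) * mom 2 e)"
proof -
  note b = V_bounded[OF w] V_bounded[OF z] V_bounded[OF e]
  let ?W = "\<lambda>x. (cmod (w x))\<^sup>2 + (cmod (z x))\<^sup>2"
  define X where "X = (LINT x|lebesgue_on \<Omega>. ?W x * (cmod (e x))\<^sup>2)"
  have iX: "integrable (lebesgue_on \<Omega>) (\<lambda>x. ?W x * (cmod (e x))\<^sup>2)" by (intro bi bm b)
  have "cmod (ip (\<lambda>x. cubic w x - cubic z x) e) \<le> (LINT x|lebesgue_on \<Omega>. 3/2 * (?W x * (cmod (e x))\<^sup>2))"
  proof (rule norm_ip_le)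
    show "bounded_measurable \<Omega> (\<lambda>x. cubic w x - cubic z x)" by (intro bm cubic_bounded b)
    show "integrable (lebesgue_on \<Omega>) (\<lambda>x. 3/2 * (?W x * (cmod (e x))\<^sup>2))" using iX by simp
    fix x
    have "cmod (cubic w x - cubic z x) * cmod (e x) \<le> 3/2 * ?W x * cmod (w x - z x) * cmod (e x)"
      by (intro mult_right_mono cubic_diff_le) simp
    then show "cmod (cubic w x - cubic z x) * cmod (e x) \<le> 3/2 * (?W x * (cmod (e x))\<^sup>2)"
      unfolding ew by (simp add: power2_eq_square mult_ac)
  qed (rule b(3))
  also have "\<dots> = 3/2 * X" unfolding X_def by simp
  finally have 1: "cmod (ip (\<lambda>x. cubic w x - cubic z x) e) \<le> 3/2 * X" .
  let ?L = "mom 4 w + mom 4 z"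
  have X0: "X \<ge> 0" unfolding X_def by simp
  have "X \<le> t * ?L + (mom 4 e / 2) / t" if t: "t > 0" for t
  proof -
    have "X \<le> (LINT x|lebesgue_on \<Omega>. t * (cmod (w x) ^ 4 + cmod (z x) ^ 4) + cmod (e x) ^ 4 / (2 * t))"
      unfolding X_def
    proof (rule integral_mono[OF iX])
      show "integrable (lebesgue_on \<Omega>) (\<lambda>x. t * (cmod (w x) ^ 4 + cmod (z x) ^ 4) + cmod (e x) ^ 4 / (2 * t))"
        using b[THEN mom_integrable, of 4] by simp
      fix x
      have "(cmod (e x))\<^sup>2 * ?W x \<le> t * ((?W x)\<^sup>2 / 2) + ((cmod (e x))\<^sup>2)\<^sup>2 / (2 * t)"
        by (rule weighted_product_le[OF t])
      moreover have "(?W x)\<^sup>2 / 2 \<le> cmod (w x) ^ 4 + cmod (z x) ^ 4"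
        using zero_le_power2[of "(cmod (w x))\<^sup>2 - (cmod (z x))\<^sup>2"]
        by (simp add: power2_sum power2_diff flip: power_mult)
      then have "t * ((?W x)\<^sup>2 / 2) \<le> t * (cmod (w x) ^ 4 + cmod (z x) ^ 4)" using t by (intro mult_left_mono) auto
      ultimately show "?W x * (cmod (e x))\<^sup>2 \<le> t * (cmod (w x) ^ 4 + cmod (z x) ^ 4) + cmod (e x) ^ 4 / (2 * t)"
        by (simp add: mult.commute flip: power_mult)
    qed
    also have "\<dots> = t * ?L + (mom 4 e / 2) / t"
      unfolding mom_def using b[THEN mom_integrable, of 4] by (simp add: distrib_left)
    finally show ?thesis .
  qed
  then have "X\<^sup>2 \<le> 4 * ?L * (mom 4 e / 2)"
    using X0 by (intro square_le_of_weighted) (auto simp: mom_nonneg)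
  also have "\<dots> \<le> 4 * ?L * (C * A e * mom 2 e / 2)"
    using mom4_le[OF e] by (intro mult_left_mono divide_right_mono) (auto simp: mom_nonneg)
  also have "\<dots> = 4 * (\<epsilon> * A e) * (?L * C / (2 * \<epsilon>) * mom 2 e)" using eps by simp
  also have "\<dots> \<le> (\<epsilon> * A e + ?L * C / (2 * \<epsilon>) * mom 2 e)\<^sup>2"
    using zero_le_power2[of "\<epsilon> * A e - ?L * C / (2 * \<epsilon>) * mom 2 e"] by (simp only: power2_sum power2_diff)
  finally have "X \<le> \<epsilon> * A e + ?L * C / (2 * \<epsilon>) * mom 2 e"
    using nonneg[OF e] eps C_pos by (intro power2_le_imp_le[of X] add_nonneg_nonneg mult_nonneg_nonneg divide_nonneg_nonneg) (auto simp: mom_nonneg)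
  with 1 show ?thesis by simp
qed

end


section \<open>Energy estimates for one step\<close>

context hermitian_form
begin

lemma reflect_form:
  assumes "w \<in> V" "g \<in> V"
  shows "Re (a (\<lambda>x. 2 * w x - g x) (\<lambda>x. 2 * w x - g x)) = 4 * Re (a w w) - 4 * Re (a w g) + Re (a g g)"
proof -
  note w2 = V_cmult[OF assms(1), of 2]
  note r = V_diff[OF w2 assms(2)]
  have "a (\<lambda>x. 2 * w x - g x) (\<lambda>x. 2 * w x - g x) = 2 * (2 * a w w - a w g) - (2 * a g w - a g g)"
    unfolding diff_left[OF w2 assms(2) r] cmult_left[OF assms(1) r] diff_right[OF assms(1) w2 assms(2)]
      diff_right[OF assms(2) w2 assms(2)] cmult_right[OF assms(1,1)] cmult_right[OF assms(2,1)] by simp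
  then show ?thesis by (simp add: hermitian[OF assms])
qed

text \<open>With \<open>w\<close> the midpoint, \<open>2 w - g\<close> is the new value, so a
  quadratic form changes over a step by a pairing of \<open>w\<close> with \<open>w - g\<close>. For
  the inner product this pairing arises from testing with \<open>w\<close>, for \<open>a\<close>
  from testing with a multiple of \<open>w - g\<close>.\<close>

lemma reflect_form_diff:
  assumes "w \<in> V" "g \<in> V"
  shows "Re (a (\<lambda>x. 2 * w x - g x) (\<lambda>x. 2 * w x - g x)) - Re (a g g) = 4 * Re (a w (\<lambda>x. w x - g x))"
  by (simp add: reflect_form[OF assms] diff_right[OF assms(1,1,2)])

text \<open>Convexity of the quadratic form, \<open>w\<close> being the mean of \<open>g\<close> and
  \<open>2 w - g\<close>.\<close>

lemma midpoint_form_le: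
  assumes "w \<in> V" "g \<in> V"
  shows "Re (a w w) \<le> (Re (a (\<lambda>x. 2 * w x - g x) (\<lambda>x. 2 * w x - g x)) + Re (a g g)) / 2"
proof -
  have "Re (a w g) \<le> Re (a w w) / 2 + Re (a g g) / 2"
    using norm_form_le[OF assms, of 1] complex_Re_le_cmod[of "a w g"] by simp
  then show ?thesis unfolding reflect_form[OF assms] by simp
qed

lemma sum_form_le:
  assumes "d \<in> V" "g \<in> V"
  shows "Re (a (\<lambda>x. d x + g x) (\<lambda>x. d x + g x)) \<le> 2 * (Re (a d d) + Re (a g g))"
proof -
  have s: "Re (a (\<lambda>x. d x + g x) (\<lambda>x. d x + g x)) = Re (a d d) + 2 * Re (a d g) + Re (a g g)"
    unfolding add_left[OF assms V_add[OF assms]] add_right[OF assms(1,1,2)] add_right[OF assms(2,1,2)]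
    by (simp add: hermitian[OF assms])
  have "Re (a d g) \<le> Re (a d d) / 2 + Re (a g g) / 2"
    using norm_form_le[OF assms, of 1] complex_Re_le_cmod[of "a d g"] by simp
  then show ?thesis unfolding s by simp
qed

end

locale CN_scheme = CN_space +
  fixes \<nu> \<alpha> \<kappa> \<beta> \<gamma> :: real
  assumes nu: "\<nu> > 0" and kappa: "\<kappa> > 0"
begin

text \<open>One step of the scheme from \<open>g = u\<^sup>n\<^sup>-\<^sup>1\<close>, in terms of the midpoint \<open>w\<close>; the new value is \<open>2 w - g\<close>.\<close>

definition CN_step :: "real \<Rightarrow> (R2 \<Rightarrow> complex) \<Rightarrow> (R2 \<Rightarrow> complex) \<Rightarrow> bool" where
  "CN_step \<tau> g w \<longleftrightarrow> (\<forall>v\<in>V. of_real (2 / \<tau>) * ip (\<lambda>x. w x - g x) v + Complex \<nu> \<alpha> * a w v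
     + Complex \<kappa> \<beta> * ip (cubic w) v - of_real \<gamma> * ip w v = 0)"

abbreviation "c1 \<equiv> cmod (Complex \<nu> \<alpha>)"
abbreviation "c2 \<equiv> cmod (Complex \<kappa> \<beta>)"
abbreviation "\<mu> \<equiv> measure lebesgue \<Omega>"

lemma c1_pos: "c1 > 0" and c2_pos: "c2 > 0"
  using nu kappa by (simp_all add: complex_eq_iff)

lemma ip_Re_self: "Re (ip v v) = mom 2 v"
  by (simp add: ip_self)

lemma Re_mult_ge: "Re (c * z) \<ge> - (cmod c * cmod z)"
  using abs_Re_le_cmod[of "c * z"] by (simp add: norm_mult)

lemma ip_diff_right:
  assumes "bounded_measurable \<Omega> f" "bounded_measurable \<Omega> g" "bounded_measurable \<Omega> h"
  shows "ip h (\<lambda>x. f x - g x) = ip h f - ip h g"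
  using ip_diff_left[OF assms] by (metis complex_cnj_diff ip_hermitian)

text \<open>Test with \<open>w\<close>.\<close>

lemma mom2_energy_step:
  assumes w: "w \<in> V" and g: "g \<in> V" and \<tau>: "\<tau> > 0" and step: "CN_step \<tau> g w"
  shows "mom 2 (\<lambda>x. 2 * w x - g x) + 2 * \<tau> * \<nu> * A w \<le> mom 2 g + 2 * \<tau> * (\<mu> * \<gamma>\<^sup>2 / (4 * \<kappa>))"
proof -
  note b = V_bounded[OF w]
  have "of_real (2 / \<tau>) * ip (\<lambda>x. w x - g x) w + Complex \<nu> \<alpha> * a w w
     + Complex \<kappa> \<beta> * ip (cubic w) w - of_real \<gamma> * ip w w = 0"
    using step w unfolding CN_step_def by blast
  then have "Re (of_real (2 / \<tau>) * ip (\<lambda>x. w x - g x) w + Complex \<nu> \<alpha> * of_real (A w)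
     + Complex \<kappa> \<beta> * of_real (mom 4 w) - of_real \<gamma> * of_real (mom 2 w)) = 0"
    unfolding ip_cubic_self ip_self[of w] self_real[OF w, symmetric] by simp
  then have eq: "2 / \<tau> * Re (ip (\<lambda>x. w x - g x) w) + \<nu> * A w + \<kappa> * mom 4 w - \<gamma> * mom 2 w = 0" by simp
  have "mom 2 (\<lambda>x. 2 * w x - g x) - mom 2 g = 4 * Re (ip w (\<lambda>x. w x - g x))"
    using ip.reflect_form_diff[OF w g] by (simp only: ip_Re_self)
  also have "Re (ip w (\<lambda>x. w x - g x)) = Re (ip (\<lambda>x. w x - g x) w)"
    using ip_hermitian[of w "\<lambda>x. w x - g x"] by simp
  finally have 1: "mom 2 (\<lambda>x. 2 * w x - g x) - mom 2 g = 2 * \<tau> * (2 / \<tau> * Re (ip (\<lambda>x. w x - g x) w))"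
    using \<tau> by simp
  \<comment> \<open>Pointwise the quartic term absorbs the quadratic one and leaves the constant
    \<open>\<gamma>\<^sup>2 / (4 * \<kappa>)\<close>, for either sign of \<open>\<gamma>\<close>. So
    the bound on \<open>mom 2\<close> grows only linearly in time and needs no condition on the size
    of \<open>\<tau>\<close>.\<close>
  have "\<gamma> * mom 2 w \<le> \<kappa> * mom 4 w + \<mu> * \<gamma>\<^sup>2 / (4 * \<kappa>)"
  proof -
    have "(LINT x|lebesgue_on \<Omega>. \<gamma> * cmod (w x) ^ 2) \<le> (LINT x|lebesgue_on \<Omega>. \<kappa> * cmod (w x) ^ 4 + \<gamma>\<^sup>2 / (4 * \<kappa>))"
    proof (rule integral_mono)
      show "integrable (lebesgue_on \<Omega>) (\<lambda>x. \<gamma> * cmod (w x) ^ 2)" "integrable (lebesgue_on \<Omega>) (\<lambda>x. \<kappa> * cmod (w x) ^ 4 + \<gamma>\<^sup>2 / (4 * \<kappa>))"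
        by (intro bi bm b)+
      fix x
      have "\<gamma> * (cmod (w x))\<^sup>2 \<le> (2 * \<kappa>) * (((cmod (w x))\<^sup>2)\<^sup>2 / 2) + \<gamma>\<^sup>2 / (2 * (2 * \<kappa>))"
        using kappa by (intro weighted_product_le) simp
      then show "\<gamma> * cmod (w x) ^ 2 \<le> \<kappa> * cmod (w x) ^ 4 + \<gamma>\<^sup>2 / (4 * \<kappa>)" by (simp flip: power_mult)
    qed
    also have "\<dots> = \<kappa> * mom 4 w + \<mu> * (\<gamma>\<^sup>2 / (4 * \<kappa>))"
    proof -
      have "integrable (lebesgue_on \<Omega>) (\<lambda>x. \<kappa> * cmod (w x) ^ 4)" "integrable (lebesgue_on \<Omega>) (\<lambda>x. \<gamma>\<^sup>2 / (4 * \<kappa>))"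
        by (intro bi bm b)+
      then have "(LINT x|lebesgue_on \<Omega>. \<kappa> * cmod (w x) ^ 4 + \<gamma>\<^sup>2 / (4 * \<kappa>))
          = (LINT x|lebesgue_on \<Omega>. \<kappa> * cmod (w x) ^ 4) + (LINT x|lebesgue_on \<Omega>. \<gamma>\<^sup>2 / (4 * \<kappa>))"
        by (rule Bochner_Integration.integral_add)
      then show ?thesis using domain by (simp add: mom_def measure_restrict_space fmeasurableD)
    qed
    finally show ?thesis by (simp add: mom_def)
  qed
  then have "2 / \<tau> * Re (ip (\<lambda>x. w x - g x) w) + \<nu> * A w \<le> \<mu> * \<gamma>\<^sup>2 / (4 * \<kappa>)" using eq by linarith
  then have "2 * \<tau> * (2 / \<tau> * Re (ip (\<lambda>x. w x - g x) w) + \<nu> * A w) \<le> 2 * \<tau> * (\<mu> * \<gamma>\<^sup>2 / (4 * \<kappa>))"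
    using \<tau> by (intro mult_left_mono) auto
  with 1 show ?thesis unfolding distrib_left by (simp add: mult.assoc)
qed

text \<open>With the weight \<open>2\<kappa>/(3 c2)\<close> in Young's inequality the term pairing \<open>cubic w\<close> with \<open>g\<close> costs half of \<open>\<kappa> mom 4 w\<close>.\<close>

definition step_bound :: "real \<Rightarrow> real" where
  "step_bound m = (c1\<^sup>2 / (2 * \<nu>) + \<bar>\<gamma>\<bar> * (C * \<mu>) / 2) * m
     + c2 * (C * m * (C * \<mu> * m)) / (4 * (2 * \<kappa> / (3 * c2)) ^ 3)"

lemma step_bound_nonneg: "m \<ge> 0 \<Longrightarrow> step_bound m \<ge> 0"
  unfolding step_bound_def using nu kappa C_pos c2_pos
  by (intro add_nonneg_nonneg mult_nonneg_nonneg divide_nonneg_nonneg) auto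

text \<open>Test with \<open>w - g\<close>. The bound on \<open>w\<close> does not degenerate as \<open>\<tau> \<rightarrow> 0\<close>, unlike the one that the energy
  identity gives for a single step.\<close>

lemma increment_bound:
  assumes w: "w \<in> V" and g: "g \<in> V" and \<tau>: "\<tau> > 0" "3/2 * \<bar>\<gamma>\<bar> * \<tau> \<le> 2" and step: "CN_step \<tau> g w"
    and m: "A g \<le> m"
  shows "mom 4 w \<le> 2 * step_bound m / \<kappa>" "A w \<le> 2 * (2 * step_bound m / \<nu> + m)"
proof -
  define d where "d = (\<lambda>x. w x - g x)"
  have d: "d \<in> V" unfolding d_def by (rule V_diff[OF w g])
  have wd: "w = (\<lambda>x. d x + g x)" by (simp add: d_def)
  note b = V_bounded[OF w] V_bounded[OF g] V_bounded[OF d]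
  have m0: "m \<ge> 0" using nonneg[OF g] m by linarith
  \<comment> \<open>Substituting \<open>w = d + g\<close> in the first argument exposes
    \<open>A d\<close> and, further on, \<open>mom 2 d\<close>. In the cubic term the second
    argument \<open>d = w - g\<close> is expanded instead, which keeps the good term
    \<open>mom 4 w\<close>.\<close>
  have awd: "a w d = of_real (A d) + a g d"
    by (subst wd) (simp only: add_left[OF d g d] self_real[OF d, symmetric])
  have icd: "ip (cubic w) d = of_real (mom 4 w) - ip (cubic w) g"
    unfolding d_def ip_diff_right[OF b(1,2) cubic_bounded[OF b(1)]] ip_cubic_self ..
  have iwd: "ip w d = of_real (mom 2 d) + ip g d"
    by (subst wd) (simp only: ip.add_left[OF d g d] ip_self)
  have "of_real (2 / \<tau>) * ip d d + Complex \<nu> \<alpha> * a w d + Complex \<kappa> \<beta> * ip (cubic w) d - of_real \<gamma> * ip w d = 0"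
    using step d unfolding CN_step_def d_def by blast
  then have "Re (of_real (2 / \<tau>) * of_real (mom 2 d) + Complex \<nu> \<alpha> * (of_real (A d) + a g d)
     + Complex \<kappa> \<beta> * (of_real (mom 4 w) - ip (cubic w) g) - of_real \<gamma> * (of_real (mom 2 d) + ip g d)) = 0"
    unfolding awd icd iwd ip_self by simp
  then have eq: "2 / \<tau> * mom 2 d + \<nu> * A d + Re (Complex \<nu> \<alpha> * a g d) + \<kappa> * mom 4 w
      - Re (Complex \<kappa> \<beta> * ip (cubic w) g) - \<gamma> * mom 2 d - \<gamma> * Re (ip g d) = 0"
    by (simp add: algebra_simps)
  have e1: "Re (Complex \<nu> \<alpha> * a g d) \<ge> - (c1\<^sup>2 / (2 * \<nu>) * A g + \<nu> / 2 * A d)"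
  proof -
    \<comment> \<open>The weight \<open>c1 / \<nu>\<close> gives \<open>A d\<close> the coefficient
      \<open>\<nu> / 2\<close>, half of what is available.\<close>
    have "c1 * cmod (a g d) \<le> c1 * (c1 / \<nu> * A g / 2 + A d / (2 * (c1 / \<nu>)))"
      using norm_form_le[OF g d, of "c1 / \<nu>"] nu c1_pos by (intro mult_left_mono) auto
    also have "\<dots> = c1\<^sup>2 / (2 * \<nu>) * A g + \<nu> / 2 * A d"
      using nu c1_pos by (simp add: field_simps power2_eq_square)
    finally show ?thesis using Re_mult_ge[of "Complex \<nu> \<alpha>" "a g d"] by linarith
  qed
  define s where "s = 2 * \<kappa> / (3 * c2)"
  have s: "s > 0" using kappa c2_pos by (simp add: s_def)
  have e2: "Re (Complex \<kappa> \<beta> * ip (cubic w) g) \<le> \<kappa> / 2 * mom 4 w + c2 * mom 4 g / (4 * s ^ 3)"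
  proof -
    have "Re (Complex \<kappa> \<beta> * ip (cubic w) g) \<le> c2 * cmod (ip (cubic w) g)"
      using complex_Re_le_cmod[of "Complex \<kappa> \<beta> * ip (cubic w) g"] by (simp add: norm_mult)
    also have "\<dots> \<le> c2 * (3/4 * s * mom 4 w + mom 4 g / (4 * s ^ 3))"
      using ip_cubic_le4[OF b(1,2) s] by (intro mult_left_mono) auto
    also have "\<dots> = (3/4 * c2 * s) * mom 4 w + c2 * mom 4 g / (4 * s ^ 3)" by (simp add: algebra_simps)
    also have "3/4 * c2 * s = \<kappa> / 2" using c2_pos by (simp add: s_def)
    finally show ?thesis .
  qed
  have e3: "\<gamma> * mom 2 d + \<gamma> * Re (ip g d) \<le> 3/2 * \<bar>\<gamma>\<bar> * mom 2 d + \<bar>\<gamma>\<bar> / 2 * mom 2 g"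
  proof -
    have "\<bar>Re (ip g d)\<bar> \<le> mom 2 g / 2 + mom 2 d / 2"
      using abs_Re_le_cmod[of "ip g d"] ip.norm_form_le[OF g d, of 1] by (simp add: ip_Re_self)
    then have "\<bar>\<gamma>\<bar> * \<bar>Re (ip g d)\<bar> \<le> \<bar>\<gamma>\<bar> * (mom 2 g / 2 + mom 2 d / 2)" by (intro mult_left_mono) auto
    moreover have "\<gamma> * Re (ip g d) \<le> \<bar>\<gamma>\<bar> * \<bar>Re (ip g d)\<bar>" by (metis abs_ge_self abs_mult)
    moreover have "\<gamma> * mom 2 d \<le> \<bar>\<gamma>\<bar> * mom 2 d" by (intro mult_right_mono) (auto simp: mom_nonneg)
    ultimately show ?thesis by (simp add: algebra_simps)
  qed
  \<comment> \<open>Here the smallness of \<open>\<tau>\<close> enters: the difference quotient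
    dominates the growth term in \<open>d\<close>.\<close>
  have e4: "3/2 * \<bar>\<gamma>\<bar> * mom 2 d \<le> 2 / \<tau> * mom 2 d"
    using \<tau> by (intro mult_right_mono) (auto simp: mom_nonneg pos_le_divide_eq)
  have g2: "mom 2 g \<le> C * \<mu> * m"
    by (rule order_trans[OF mom2_le[OF g] mult_left_mono[OF m]]) (use C_pos in simp)
  have g4: "mom 4 g \<le> C * m * (C * \<mu> * m)"
    by (rule order_trans[OF mom4_le[OF g]])
       (use m m0 g2 C_pos nonneg[OF g] in \<open>intro mult_mono mult_left_mono mult_nonneg_nonneg\<close>, auto simp: mom_nonneg)
  have "c1\<^sup>2 / (2 * \<nu>) * A g \<le> c1\<^sup>2 / (2 * \<nu>) * m" using m nu by (intro mult_left_mono) auto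
  moreover have "\<bar>\<gamma>\<bar> / 2 * mom 2 g \<le> \<bar>\<gamma>\<bar> / 2 * (C * \<mu> * m)" using g2 by (intro mult_left_mono) auto
  moreover have "c2 * mom 4 g / (4 * s ^ 3) \<le> c2 * (C * m * (C * \<mu> * m)) / (4 * s ^ 3)"
    using g4 s by (intro divide_right_mono mult_left_mono) auto
  moreover have "step_bound m = c1\<^sup>2 / (2 * \<nu>) * m + \<bar>\<gamma>\<bar> / 2 * (C * \<mu> * m) + c2 * (C * m * (C * \<mu> * m)) / (4 * s ^ 3)"
    unfolding step_bound_def s_def by (simp add: algebra_simps)
  ultimately have main: "\<nu> / 2 * A d + \<kappa> / 2 * mom 4 w \<le> step_bound m"
    using eq e1 e2 e3 e4 by linarith
  have "0 \<le> \<nu> / 2 * A d" using nonneg[OF d] nu by simp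
  then have "\<kappa> / 2 * mom 4 w \<le> step_bound m" using main by linarith
  then show "mom 4 w \<le> 2 * step_bound m / \<kappa>" using kappa by (simp add: field_simps)
  have "0 \<le> \<kappa> / 2 * mom 4 w" using mom_nonneg[of 4 w] kappa by simp
  then have "\<nu> / 2 * A d \<le> step_bound m" using main by linarith
  then have Ad: "A d \<le> 2 * step_bound m / \<nu>" using nu by (simp add: field_simps)
  have "A w \<le> 2 * (A d + A g)" using sum_form_le[OF d g] wd by simp
  then show "A w \<le> 2 * (2 * step_bound m / \<nu> + m)"     by (rule order_trans) (intro mult_left_mono add_mono Ad m, simp)
qed

text \<open>Test with \<open>(\<nu> + \<i>\<alpha>)(w - g)\<close>, which turns the coefficient of \<open>a w (w - g)\<close> into the real number \<open>c1\<^sup>2\<close>.\<close>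

lemma A_energy_step:
  assumes w: "w \<in> V" and g: "g \<in> V" and \<tau>: "\<tau> > 0" and step: "CN_step \<tau> g w"
  shows "A (\<lambda>x. 2 * w x - g x) - A g \<le> \<tau> / \<nu> * (c2\<^sup>2 * mom 6 w + \<gamma>\<^sup>2 * mom 2 w)"
proof -
  define d where "d = (\<lambda>x. w x - g x)"
  have d: "d \<in> V" unfolding d_def by (rule V_diff[OF w g])
  note b = V_bounded[OF w] V_bounded[OF d]
  let ?c = "Complex \<nu> \<alpha>" and ?k = "Complex \<kappa> \<beta>"
  have cd: "(\<lambda>x. ?c * d x) \<in> V" by (rule V_cmult[OF d])
  have icd: "ip (cubic w) (\<lambda>x. ?c * d x) = cnj ?c * ip (cubic w) d"
    using ip_cmult_left[of ?c d "cubic w"] by (metis complex_cnj_mult ip_hermitian)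
  have "of_real (2 / \<tau>) * ip d (\<lambda>x. ?c * d x) + ?c * a w (\<lambda>x. ?c * d x) + ?k * ip (cubic w) (\<lambda>x. ?c * d x) - of_real \<gamma> * ip w (\<lambda>x. ?c * d x) = 0"
    using step cd unfolding CN_step_def d_def by blast
  then have "of_real (2 / \<tau>) * (cnj ?c * of_real (mom 2 d)) + (?c * cnj ?c) * a w d + (?k * cnj ?c) * ip (cubic w) d - cnj ?c * (of_real \<gamma> * ip w d) = 0"
    unfolding icd cmult_right[OF w d] ip.cmult_right[OF w d] ip.cmult_right[OF d d] ip_self by (simp add: mult_ac)
  then have "Re (of_real (2 / \<tau>) * (cnj ?c * of_real (mom 2 d)) + of_real (c1\<^sup>2) * a w d + (?k * cnj ?c) * ip (cubic w) d - cnj ?c * (of_real \<gamma> * ip w d)) = 0"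
    by (simp only: complex_norm_square) simp
  then have eq: "2 / \<tau> * (\<nu> * mom 2 d) + c1\<^sup>2 * Re (a w d) + Re ((?k * cnj ?c) * ip (cubic w) d) - Re (cnj ?c * (of_real \<gamma> * ip w d)) = 0"
    by (simp only: minus_complex.sel plus_complex.sel) simp
  have cc: "c1 * c2 > 0" using c1_pos c2_pos by simp
  have e1: "Re ((?k * cnj ?c) * ip (cubic w) d) \<ge> - ((c1 * c2)\<^sup>2 * \<tau> / (4 * \<nu>) * mom 6 w + \<nu> / \<tau> * mom 2 d)"
  proof -
    \<comment> \<open>This weight, and \<open>\<tau> / (2 * \<nu>)\<close> in the next estimate,
      each produce \<open>\<nu> / \<tau> * mom 2 d\<close>. Together they use up
      \<open>2 / \<tau> * (\<nu> * mom 2 d)\<close> exactly, and what remains carries a factor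
      \<open>\<tau>\<close>.\<close>
    define t where "t = c1 * c2 * \<tau> / (2 * \<nu>)"
    have t: "t > 0" using cc \<tau> nu by (simp add: t_def)
    have "(c1 * c2) * cmod (ip (cubic w) d) \<le> (c1 * c2) * (t * mom 6 w / 2 + mom 2 d / (2 * t))"
      using ip_cubic_le6[OF b t] cc by (intro mult_left_mono) auto
    also have "\<dots> = (c1 * c2)\<^sup>2 * \<tau> / (4 * \<nu>) * mom 6 w + \<nu> / \<tau> * mom 2 d"
      using c1_pos c2_pos \<tau> nu unfolding t_def by (simp add: field_simps power2_eq_square)
    finally show ?thesis using Re_mult_ge[of "?k * cnj ?c" "ip (cubic w) d"] by (simp add: norm_mult mult.commute)
  qed
  have e2: "Re (cnj ?c * (of_real \<gamma> * ip w d)) \<le> (c1 * \<gamma>)\<^sup>2 * \<tau> / (4 * \<nu>) * mom 2 w + \<nu> / \<tau> * mom 2 d"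
  proof -
    let ?e = "complex_of_real (c1 * \<gamma>)"
    have ew: "(\<lambda>x. ?e * w x) \<in> V" by (rule V_cmult[OF w])
    have "Re (cnj ?c * (of_real \<gamma> * ip w d)) \<le> cmod (cnj ?c * (of_real \<gamma> * ip w d))" by (rule complex_Re_le_cmod)
    also have "\<dots> = cmod (ip (\<lambda>x. ?e * w x) d)" by (simp add: ip_cmult_left norm_mult abs_mult)
    also have "\<dots> \<le> \<tau> / (2 * \<nu>) * mom 2 (\<lambda>x. ?e * w x) / 2 + mom 2 d / (2 * (\<tau> / (2 * \<nu>)))"
      using ip.norm_form_le[OF ew d, of "\<tau> / (2 * \<nu>)"] \<tau> nu by (simp add: ip_Re_self)
    also have "mom 2 (\<lambda>x. ?e * w x) = (c1 * \<gamma>)\<^sup>2 * mom 2 w"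
      unfolding mom_def by (simp add: norm_mult power_mult_distrib abs_mult)
    also have "\<tau> / (2 * \<nu>) * ((c1 * \<gamma>)\<^sup>2 * mom 2 w) / 2 + mom 2 d / (2 * (\<tau> / (2 * \<nu>))) = (c1 * \<gamma>)\<^sup>2 * \<tau> / (4 * \<nu>) * mom 2 w + \<nu> / \<tau> * mom 2 d"
      using \<tau> nu by (simp add: field_simps)
    finally show ?thesis .
  qed
  have "c1\<^sup>2 * Re (a w d) \<le> (c1 * c2)\<^sup>2 * \<tau> / (4 * \<nu>) * mom 6 w + (c1 * \<gamma>)\<^sup>2 * \<tau> / (4 * \<nu>) * mom 2 w"
  proof -
    have "2 / \<tau> * (\<nu> * mom 2 d) = \<nu> / \<tau> * mom 2 d + \<nu> / \<tau> * mom 2 d" by simp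
    then show ?thesis using eq e1 e2 by linarith
  qed
  also have "\<dots> = c1\<^sup>2 * (\<tau> / (4 * \<nu>) * (c2\<^sup>2 * mom 6 w + \<gamma>\<^sup>2 * mom 2 w))"
    by (simp add: power_mult_distrib algebra_simps)
  finally have "Re (a w d) \<le> \<tau> / (4 * \<nu>) * (c2\<^sup>2 * mom 6 w + \<gamma>\<^sup>2 * mom 2 w)"
    by (rule mult_left_le_imp_le) (use c1_pos in simp)
  then have "4 * Re (a w d) \<le> \<tau> / \<nu> * (c2\<^sup>2 * mom 6 w + \<gamma>\<^sup>2 * mom 2 w)" using nu by (simp add: field_simps)
  then show ?thesis using reflect_form_diff[OF w g] by (simp only: d_def)
qed

text \<open>Test the difference of the two equations with \<open>w - z\<close>.\<close>

lemma step_unique: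
  assumes w: "w \<in> V" and z: "z \<in> V" and \<tau>: "\<tau> > 0"
    and gb: "bounded_measurable \<Omega> g" "bounded_measurable \<Omega> g'" and gg: "AE x in lebesgue_on \<Omega>. g x = g' x"
    and step: "CN_step \<tau> g w" "CN_step \<tau> g' z"
    and L: "mom 4 w + mom 4 z \<le> L" and small: "\<tau> * (\<bar>\<gamma>\<bar> + 9 * c2\<^sup>2 * C * L / (8 * \<nu>)) \<le> 1"
  shows "AE x in lebesgue_on \<Omega>. w x = z x"
proof -
  define e where "e = (\<lambda>x. w x - z x)"
  have e: "e \<in> V" unfolding e_def by (rule V_diff[OF w z])
  note b = V_bounded[OF w] V_bounded[OF z] V_bounded[OF e]
  \<comment> \<open>The old values agree only almost everywhere, so they cancel under the integral
    and not pointwise.\<close>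
  have D: "ip (\<lambda>x. w x - g x) e - ip (\<lambda>x. z x - g' x) e = of_real (mom 2 e)"
  proof -
    have "ip (\<lambda>x. w x - g x) e - ip (\<lambda>x. z x - g' x) e = ip (\<lambda>x. (w x - g x) - (z x - g' x)) e"
      by (rule ip_diff_left[symmetric]) (intro bm b gb)+
    also have "\<dots> = ip e e"
      unfolding L2_inner_def
    proof (rule integral_cong_AE)
      have "bounded_measurable \<Omega> (\<lambda>x. (w x - g x - (z x - g' x)) * cnj (e x))" by (intro bm b gb)
      then show "(\<lambda>x. (w x - g x - (z x - g' x)) * cnj (e x)) \<in> borel_measurable (lebesgue_on \<Omega>)" by (simp add: bounded_measurable_def)
      have "bounded_measurable \<Omega> (\<lambda>x. e x * cnj (e x))" by (intro bm b gb)
      then show "(\<lambda>x. e x * cnj (e x)) \<in> borel_measurable (lebesgue_on \<Omega>)" by (simp add: bounded_measurable_def)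
      show "AE x in lebesgue_on \<Omega>. (w x - g x - (z x - g' x)) * cnj (e x) = e x * cnj (e x)"
        using gg by eventually_elim (simp add: e_def)
    qed
    finally show ?thesis by (simp add: ip_self)
  qed
  have A: "a w e - a z e = of_real (A e)"
    using diff_left[OF w z e] self_real[OF e] by (simp add: e_def)
  have N: "ip (cubic w) e - ip (cubic z) e = ip (\<lambda>x. cubic w x - cubic z x) e"
    by (rule ip_diff_left[symmetric]) (intro cubic_bounded b)+
  have I: "ip w e - ip z e = of_real (mom 2 e)"
    using ip.diff_left[OF w z e] ip_self[of e] by (simp add: e_def)
  have "of_real (2 / \<tau>) * ip (\<lambda>x. w x - g x) e + Complex \<nu> \<alpha> * a w e + Complex \<kappa> \<beta> * ip (cubic w) e - of_real \<gamma> * ip w e = 0"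
    "of_real (2 / \<tau>) * ip (\<lambda>x. z x - g' x) e + Complex \<nu> \<alpha> * a z e + Complex \<kappa> \<beta> * ip (cubic z) e - of_real \<gamma> * ip z e = 0"
    using step e unfolding CN_step_def by blast+
  then have "of_real (2 / \<tau>) * (ip (\<lambda>x. w x - g x) e - ip (\<lambda>x. z x - g' x) e) + Complex \<nu> \<alpha> * (a w e - a z e)
     + Complex \<kappa> \<beta> * (ip (cubic w) e - ip (cubic z) e) - of_real \<gamma> * (ip w e - ip z e) = 0"
    unfolding right_diff_distrib by (simp add: algebra_simps)
  then have "Re (of_real (2 / \<tau>) * of_real (mom 2 e) + Complex \<nu> \<alpha> * of_real (A e)
     + Complex \<kappa> \<beta> * ip (\<lambda>x. cubic w x - cubic z x) e - of_real \<gamma> * of_real (mom 2 e)) = 0"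
    unfolding D A N I by simp
  then have eq: "2 / \<tau> * mom 2 e + \<nu> * A e + Re (Complex \<kappa> \<beta> * ip (\<lambda>x. cubic w x - cubic z x) e) - \<gamma> * mom 2 e = 0"
    by (simp only: minus_complex.sel plus_complex.sel) simp
  \<comment> \<open>Chosen so that the part of the cubic difference with \<open>A e\<close> is
    exactly \<open>\<nu> * A e\<close>.\<close>
  define \<epsilon> where "\<epsilon> = 2 * \<nu> / (3 * c2)"
  have eps: "\<epsilon> > 0" using nu c2_pos by (simp add: \<epsilon>_def)
  have "c2 * cmod (ip (\<lambda>x. cubic w x - cubic z x) e) \<le> c2 * (3/2 * (\<epsilon> * A e + (mom 4 w + mom 4 z) * C / (2 * \<epsilon>) * mom 2 e))"
    by (intro mult_left_mono ip_cubic_diff_le[OF w z e _ eps]) (auto simp: e_def)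
  also have "\<dots> \<le> c2 * (3/2 * (\<epsilon> * A e + L * C / (2 * \<epsilon>) * mom 2 e))"
    using L C_pos eps by (intro mult_left_mono add_left_mono mult_right_mono divide_right_mono) (auto simp: mom_nonneg)
  also have "\<dots> = \<nu> * A e + 9 * c2\<^sup>2 * C * L / (8 * \<nu>) * mom 2 e"
    using c2_pos nu unfolding \<epsilon>_def by (simp add: field_simps power2_eq_square)
  finally have "Re (Complex \<kappa> \<beta> * ip (\<lambda>x. cubic w x - cubic z x) e) \<ge> - (\<nu> * A e + 9 * c2\<^sup>2 * C * L / (8 * \<nu>) * mom 2 e)"
    using Re_mult_ge[of "Complex \<kappa> \<beta>" "ip (\<lambda>x. cubic w x - cubic z x) e"] by linarith
  moreover have "\<gamma> * mom 2 e \<le> \<bar>\<gamma>\<bar> * mom 2 e" by (intro mult_right_mono) (auto simp: mom_nonneg)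
  ultimately have 1: "2 / \<tau> * mom 2 e \<le> (\<bar>\<gamma>\<bar> + 9 * c2\<^sup>2 * C * L / (8 * \<nu>)) * mom 2 e"
    using eq unfolding distrib_right by linarith
  \<comment> \<open>The right-hand side uses at most half of \<open>2 / \<tau>\<close>; the other
    half forces \<open>mom 2 e\<close> to vanish.\<close>
  have "(\<bar>\<gamma>\<bar> + 9 * c2\<^sup>2 * C * L / (8 * \<nu>)) \<le> 1 / \<tau>" using small \<tau> by (simp add: pos_le_divide_eq mult.commute)
  then have "(\<bar>\<gamma>\<bar> + 9 * c2\<^sup>2 * C * L / (8 * \<nu>)) * mom 2 e \<le> 1 / \<tau> * mom 2 e" by (intro mult_right_mono) (auto simp: mom_nonneg)
  with 1 have "1 / \<tau> * mom 2 e \<le> 0" by (simp add: field_simps)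
  then have "mom 2 e = 0" using \<tau> mom_nonneg[of 2 e] by (simp add: mult_le_0_iff field_simps)
  then have "AE x in lebesgue_on \<Omega>. cmod (e x) ^ 2 = 0"
    unfolding mom_def using mom_integrable[OF b(3), of 2] by (subst (asm) integral_nonneg_eq_0_iff_AE) auto
  then show ?thesis by eventually_elim (simp add: e_def)
qed

end


section \<open>Uniqueness for small time steps\<close>

text \<open>For \<open>s \<le> 1/2\<close> the inverse of \<open>1 - s\<close> is at most
  \<open>1 + 2 * s\<close>. Bounding this and \<open>1 + s\<close> by exponentials turns the product
  over the steps into one exponential of a sum.\<close>

lemma discrete_Gronwall_step:
  fixes x y s :: real
  assumes "x \<ge> 0" "y \<ge> 0" "0 \<le> s" "s \<le> 1/2" "y - x \<le> s * (y + x)"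
  shows "y \<le> x * exp (3 * s)"
proof -
  have e: "1 + s \<le> exp s" "1 + 2 * s \<le> exp (2 * s)" using exp_ge_add_one_self by blast+
  have "s * s \<le> 1/2 * s" using assms(3,4) by (intro mult_right_mono) auto
  then have "1 \<le> (1 - s) * (1 + 2 * s)" by (simp add: algebra_simps)
  then have "1 * y \<le> (1 - s) * (1 + 2 * s) * y" using assms(2) by (intro mult_right_mono) auto
  also have "\<dots> = (y * (1 - s)) * (1 + 2 * s)" by (simp only: mult_ac)
  also have "\<dots> \<le> (x * (1 + s)) * (1 + 2 * s)"
  proof (rule mult_right_mono)
    show "y * (1 - s) \<le> x * (1 + s)" using assms(5) by (simp add: algebra_simps)
  qed (use assms(3) in simp)
  also have "\<dots> \<le> (x * exp s) * exp (2 * s)"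
    using e assms(1,3) by (intro mult_mono mult_left_mono) auto
  also have "\<dots> = x * (exp s * exp (2 * s))" by (simp only: mult.assoc)
  also have "exp s * exp (2 * s) = exp (3 * s)" by (simp add: exp_add[symmetric])
  finally show ?thesis by simp
qed

context CN_scheme
begin

lemma midpt_facts:
  assumes "U n \<in> V" "U (n - 1) \<in> V"
  shows "midpt U n \<in> V" "U n = (\<lambda>x. 2 * midpt U n x - U (n - 1) x)"
proof -
  have "midpt U n = (\<lambda>x. (1/2) * (U n x + U (n - 1) x))" by (simp add: fun_eq_iff midpt_def)
  then show "midpt U n \<in> V" using V_cmult[OF V_add[OF assms]] by metis
  show "U n = (\<lambda>x. 2 * midpt U n x - U (n - 1) x)" by (rule ext) (simp add: midpt_def add_divide_distrib)
qed

text \<open>The bound \<open>m\<close> can be fixed before the induction because the exponents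
  \<open>K * \<tau> / 2 * A w\<close> add up to at most \<open>K * B / (4 * \<nu>)\<close> by the
  energy bound, whatever \<open>A\<close> does. Inside the induction \<open>A g \<le> m\<close>
  serves to see that each single exponent is at most \<open>1/2\<close>; the resulting condition on
  \<open>\<tau>\<close> involves \<open>m\<close> and not the step number.\<close>

lemma scheme_bounded:
  assumes U: "\<And>n. n \<le> N \<Longrightarrow> U n \<in> V"
    and step: "\<And>n. n \<in> {1..N} \<Longrightarrow> CN_step \<tau> (U (n - 1)) (midpt U n)"
    and \<tau>: "\<tau> > 0" "real N * \<tau> \<le> T" and A0: "A (U 0) \<le> A0"
    and B: "B = C * \<mu> * A0 + 2 * T * (\<mu> * \<gamma>\<^sup>2 / (4 * \<kappa>))"
    and K: "K = (c2\<^sup>2 * C\<^sup>2 * B + \<gamma>\<^sup>2 * (C * \<mu>)) / \<nu>"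
    and m: "m = (1 + A0) * exp (3 * K * B / (4 * \<nu>))"
    and small: "3/2 * \<bar>\<gamma>\<bar> * \<tau> \<le> 2" "K * \<tau> * (2 * (2 * step_bound m / \<nu> + m)) \<le> 1"
    and n: "n \<le> N"
  shows "A (U n) \<le> m"
proof -
  define K0 where "K0 = \<mu> * \<gamma>\<^sup>2 / (4 * \<kappa>)"
  have K0: "K0 \<ge> 0" unfolding K0_def using kappa by simp
  define S where "S n = (\<Sum>i=1..n. A (midpt U i))" for n
  have mid: "midpt U i \<in> V" if "i \<in> {1..N}" for i using that by (intro midpt_facts(1) U) auto
  have Ueq: "U i = (\<lambda>x. 2 * midpt U i x - U (i - 1) x)" if "i \<in> {1..N}" for i
    using that by (intro midpt_facts(2) U) auto
  have S0: "S n \<ge> 0" if "n \<le> N" for n unfolding S_def using that by (intro sum_nonneg nonneg mid) auto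
  have A00: "A0 \<ge> 0" using A0 nonneg[OF U[of 0]] by simp
  have T0: "T \<ge> 0" using \<tau> by (meson less_eq_real_def mult_nonneg_nonneg of_nat_0_le_iff order_trans)
  have B0: "B \<ge> 0" unfolding B using A00 T0 C_pos K0 by (intro add_nonneg_nonneg mult_nonneg_nonneg) (auto simp: K0_def)
  have Kn: "K \<ge> 0" unfolding K using B0 C_pos nu by (intro divide_nonneg_nonneg add_nonneg_nonneg mult_nonneg_nonneg) auto
  have energy: "mom 2 (U n) + 2 * \<tau> * \<nu> * S n \<le> mom 2 (U 0) + 2 * (real n * \<tau>) * K0" if "n \<le> N" for n
    using that
  proof (induction n)
    case 0
    then show ?case by (simp add: S_def)
  next
    case (Suc n)
    have i: "Suc n \<in> {1..N}" using Suc.prems by simp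
    have "mom 2 (U (Suc n)) + 2 * \<tau> * \<nu> * A (midpt U (Suc n)) \<le> mom 2 (U n) + 2 * \<tau> * K0"
      using mom2_energy_step[OF mid[OF i] U[of n] \<tau>(1)] step[OF i] Ueq[OF i] Suc.prems by (simp add: K0_def)
    moreover have "S (Suc n) = S n + A (midpt U (Suc n))" by (simp add: S_def)
    ultimately show ?case using Suc by (simp add: algebra_simps)
  qed
  have bnd: "mom 2 (U n) + 2 * \<tau> * \<nu> * S n \<le> B" if n: "n \<le> N" for n
  proof -
    have "real n * \<tau> \<le> T" using n \<tau> by (meson less_eq_real_def mult_right_mono of_nat_mono order_trans)
    then have "2 * (real n * \<tau>) * K0 \<le> 2 * T * K0" using K0 by (intro mult_right_mono) auto
    moreover have "mom 2 (U 0) \<le> C * \<mu> * A0"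
      using C_pos by (intro order_trans[OF mom2_le[OF U[of 0]] mult_left_mono[OF A0]]) auto
    ultimately show ?thesis using energy[OF n] unfolding B K0_def by linarith
  qed
  have m2: "mom 2 (U n) \<le> B" if "n \<le> N" for n
  proof -
    have "0 \<le> 2 * \<tau> * \<nu> * S n" using S0[OF that] \<tau>(1) nu by simp
    then show ?thesis using bnd[OF that] by linarith
  qed
  have Sb: "K * \<tau> / 2 * S n \<le> K * B / (4 * \<nu>)" if "n \<le> N" for n
  proof -
    have "2 * \<tau> * \<nu> * S n \<le> B" using bnd[OF that] mom_nonneg[of 2 "U n"] by linarith
    then have "\<tau> * S n \<le> B / (2 * \<nu>)" using nu by (simp add: field_simps)
    then have "K / 2 * (\<tau> * S n) \<le> K / 2 * (B / (2 * \<nu>))" using Kn by (intro mult_left_mono) auto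
    then show ?thesis by simp
  qed
  have growth: "1 + A (U n) \<le> (1 + A0) * exp (3 * (K * \<tau> / 2 * S n))" if "n \<le> N" for n
    using that
  proof (induction n)
    case 0
    then show ?case using A0 by (simp add: S_def)
  next
    case (Suc n)
    have i: "Suc n \<in> {1..N}" using Suc.prems by simp
    let ?w = "midpt U (Suc n)" and ?g = "U n"
    have w: "?w \<in> V" and g: "?g \<in> V" using mid[OF i] U[of n] Suc.prems by auto
    have st: "CN_step \<tau> ?g ?w" using step[OF i] by simp
    have un: "U (Suc n) = (\<lambda>x. 2 * ?w x - ?g x)" using Ueq[OF i] by simp
    have IH: "1 + A ?g \<le> (1 + A0) * exp (3 * (K * \<tau> / 2 * S n))" using Suc by simp
    also have "\<dots> \<le> (1 + A0) * exp (3 * K * B / (4 * \<nu>))"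
      using Sb[of n] Suc.prems A00 by (intro mult_left_mono) auto
    finally have gm: "A ?g \<le> m" unfolding m by simp
    define s where "s = K * \<tau> / 2 * A ?w"
    have Aw: "A ?w \<ge> 0" by (rule nonneg[OF w])
    have s0: "s \<ge> 0" unfolding s_def using Kn \<tau>(1) Aw by simp
    have "K * \<tau> * A ?w \<le> K * \<tau> * (2 * (2 * step_bound m / \<nu> + m))"
      using increment_bound(2)[OF w g \<tau>(1) small(1) st gm] Kn \<tau>(1) by (intro mult_left_mono) auto
    then have "K * \<tau> * A ?w \<le> 1" using small(2) by (rule order_trans)
    then have s1: "s \<le> 1/2" unfolding s_def by simp
    have w2: "mom 2 ?w \<le> B"
    proof -
      have "mom 2 ?w \<le> (mom 2 (U (Suc n)) + mom 2 ?g) / 2"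
        using ip.midpoint_form_le[OF w g] unfolding un by (simp only: ip_Re_self)
      then show ?thesis using m2[OF Suc.prems] m2[OF Suc_leD[OF Suc.prems]] by simp
    qed
    \<comment> \<open>Two moment inequalities leave a quadratic expression in \<open>A\<close>, the
      L^2 norm of the midpoint being already bounded.\<close>
    have m6: "mom 6 ?w \<le> C\<^sup>2 * B * (A ?w)\<^sup>2"
    proof -
      have "mom 6 ?w \<le> C * A ?w * mom 4 ?w" by (rule mom6_le[OF w])
      also have "\<dots> \<le> C * A ?w * (C * A ?w * mom 2 ?w)"
        using C_pos Aw by (intro mult_left_mono mom4_le[OF w]) auto
      also have "\<dots> \<le> C * A ?w * (C * A ?w * B)"
        using C_pos Aw w2 by (intro mult_left_mono) auto
      finally show ?thesis by (simp add: power2_eq_square mult_ac)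
    qed
    have "A (U (Suc n)) - A ?g \<le> \<tau> / \<nu> * (c2\<^sup>2 * mom 6 ?w + \<gamma>\<^sup>2 * mom 2 ?w)"
      unfolding un by (rule A_energy_step[OF w g \<tau>(1) st])
    also have "\<dots> \<le> \<tau> / \<nu> * (c2\<^sup>2 * C\<^sup>2 * B * (A ?w * (1 + A ?w)) + \<gamma>\<^sup>2 * (C * \<mu>) * (A ?w * (1 + A ?w)))"
    proof (intro mult_left_mono add_mono)
      have "c2\<^sup>2 * mom 6 ?w \<le> c2\<^sup>2 * (C\<^sup>2 * B * (A ?w)\<^sup>2)" using m6 by (intro mult_left_mono) auto
      also have "\<dots> \<le> c2\<^sup>2 * (C\<^sup>2 * B * (A ?w * (1 + A ?w)))"
        using B0 Aw by (intro mult_left_mono) (auto simp: power2_eq_square algebra_simps)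
      finally show "c2\<^sup>2 * mom 6 ?w \<le> c2\<^sup>2 * C\<^sup>2 * B * (A ?w * (1 + A ?w))" by (simp add: mult.assoc)
      have "\<gamma>\<^sup>2 * mom 2 ?w \<le> \<gamma>\<^sup>2 * (C * \<mu> * A ?w)" by (intro mult_left_mono mom2_le[OF w]) auto
      also have "\<dots> \<le> \<gamma>\<^sup>2 * (C * \<mu> * (A ?w * (1 + A ?w)))"
        using C_pos Aw by (intro mult_left_mono) (auto simp: algebra_simps)
      finally show "\<gamma>\<^sup>2 * mom 2 ?w \<le> \<gamma>\<^sup>2 * (C * \<mu>) * (A ?w * (1 + A ?w))" by (simp add: mult.assoc)
    qed (use \<tau>(1) nu in simp)
    also have "\<dots> = \<tau> * ((c2\<^sup>2 * C\<^sup>2 * B + \<gamma>\<^sup>2 * (C * \<mu>)) / \<nu>) * (A ?w * (1 + A ?w))"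
      unfolding distrib_right[symmetric] by simp
    also have "\<dots> = 2 * s * (1 + A ?w)" unfolding s_def K[symmetric] by simp
    \<comment> \<open>One factor \<open>A ?w\<close> stays in \<open>s\<close>, where it is
      summable; the other is replaced by the mean of old and new values, the form that the Gronwall
      step expects.\<close>
    also have "\<dots> \<le> 2 * s * (1 + (A (U (Suc n)) + A ?g) / 2)"
      using midpoint_form_le[OF w g] s0 unfolding un by (intro mult_left_mono add_left_mono) auto
    also have "\<dots> = s * ((1 + A (U (Suc n))) + (1 + A ?g))" by (simp add: algebra_simps)
    finally have "(1 + A (U (Suc n))) - (1 + A ?g) \<le> s * ((1 + A (U (Suc n))) + (1 + A ?g))" by simp
    then have "1 + A (U (Suc n)) \<le> (1 + A ?g) * exp (3 * s)"
      using nonneg[OF g] nonneg[OF U[OF Suc.prems]] s0 s1 by (intro discrete_Gronwall_step) auto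
    also have "\<dots> \<le> (1 + A0) * exp (3 * (K * \<tau> / 2 * S n)) * exp (3 * s)"
      using IH by (intro mult_right_mono) auto
    also have "\<dots> = (1 + A0) * exp (3 * (K * \<tau> / 2 * S (Suc n)))"
      unfolding mult.assoc exp_add[symmetric] by (simp add: S_def s_def algebra_simps)
    finally show ?case .
  qed
  have "1 + A (U n) \<le> (1 + A0) * exp (3 * K * B / (4 * \<nu>))"
    by (rule order_trans[OF growth[OF n]]) (use Sb[OF n] A00 in \<open>intro mult_left_mono, auto\<close>)
  then show ?thesis unfolding m by simp
qed

text \<open>Each sequence satisfies the bound \<open>m\<close> on its own, hence the midpoints of
  both satisfy the same L^4 bound, and one condition on \<open>\<tau>\<close> makes every step
  unique.\<close>

lemma scheme_unique:
  assumes U: "\<And>n. n \<le> N \<Longrightarrow> U n \<in> V" and U': "\<And>n. n \<le> N \<Longrightarrow> U' n \<in> V"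
    and step: "\<And>n. n \<in> {1..N} \<Longrightarrow> CN_step \<tau> (U (n - 1)) (midpt U n)"
    and step': "\<And>n. n \<in> {1..N} \<Longrightarrow> CN_step \<tau> (U' (n - 1)) (midpt U' n)"
    and start: "AE x in lebesgue_on \<Omega>. U 0 x = U' 0 x"
    and \<tau>: "\<tau> > 0" "real N * \<tau> \<le> T" and A0: "A (U 0) \<le> A0" "A (U' 0) \<le> A0"
    and B: "B = C * \<mu> * A0 + 2 * T * (\<mu> * \<gamma>\<^sup>2 / (4 * \<kappa>))"
    and K: "K = (c2\<^sup>2 * C\<^sup>2 * B + \<gamma>\<^sup>2 * (C * \<mu>)) / \<nu>"
    and m: "m = (1 + A0) * exp (3 * K * B / (4 * \<nu>))"
    and small: "3/2 * \<bar>\<gamma>\<bar> * \<tau> \<le> 2" "K * \<tau> * (2 * (2 * step_bound m / \<nu> + m)) \<le> 1"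
      "\<tau> * (\<bar>\<gamma>\<bar> + 9 * c2\<^sup>2 * C * (4 * step_bound m / \<kappa>) / (8 * \<nu>)) \<le> 1"
    and n: "n \<le> N"
  shows "AE x in lebesgue_on \<Omega>. U n x = U' n x"
  using n
proof (induction n)
  case 0
  show ?case by (rule start)
next
  case (Suc n)
  have i: "Suc n \<in> {1..N}" using Suc.prems by simp
  have g: "U n \<in> V" "U' n \<in> V" using U U' Suc.prems by auto
  have w: "midpt U (Suc n) \<in> V" "midpt U' (Suc n) \<in> V"
    using U U' Suc.prems by (auto intro!: midpt_facts(1))
  have st: "CN_step \<tau> (U n) (midpt U (Suc n))" "CN_step \<tau> (U' n) (midpt U' (Suc n))"
    using step[OF i] step'[OF i] by auto
  have "A (U n) \<le> m" "A (U' n) \<le> m"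
    using scheme_bounded[OF U step \<tau> A0(1) B K m small(1,2)] scheme_bounded[OF U' step' \<tau> A0(2) B K m small(1,2)]
      Suc.prems by auto
  then have "mom 4 (midpt U (Suc n)) \<le> 2 * step_bound m / \<kappa>" "mom 4 (midpt U' (Suc n)) \<le> 2 * step_bound m / \<kappa>"
    using increment_bound(1)[OF w(1) g(1) \<tau>(1) small(1) st(1)] increment_bound(1)[OF w(2) g(2) \<tau>(1) small(1) st(2)] by auto
  then have L: "mom 4 (midpt U (Suc n)) + mom 4 (midpt U' (Suc n)) \<le> 4 * step_bound m / \<kappa>" by simp
  have ae: "AE x in lebesgue_on \<Omega>. U n x = U' n x" using Suc by simp
  have "AE x in lebesgue_on \<Omega>. midpt U (Suc n) x = midpt U' (Suc n) x"
    by (rule step_unique[OF w \<tau>(1) V_bounded[OF g(1)] V_bounded[OF g(2)] ae st L small(3)])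
  then show ?case using ae
  proof eventually_elim
    case (elim x)
    then show ?case by (simp add: midpt_def)
  qed
qed

end


section \<open>Initial data and conclusion\<close>

text \<open>Each of the finitely many elements is compact, so its polynomial is bounded there. The
  bound may depend on the mesh, since it only serves integrability.\<close>

lemma Vh_bounded_measurable:
  assumes "open \<Omega>" "conforming_mesh \<Omega> M" "v \<in> Vh k \<Omega> M"
  shows "bounded_measurable \<Omega> v"
proof -
  have M: "finite M" "\<Union>M = closure \<Omega>" "\<And>K. K \<in> M \<Longrightarrow> compact K"
    using assms(2) by (auto simp: conforming_mesh_def triangulation_def dest: compact_simplex)
  have Ks: "K \<in> sets lebesgue" if "K \<in> M" for K using M(3)[OF that] by (simp add: compact_imp_closed)
  have "\<exists>b. \<forall>x\<in>K. cmod (restr v K x) \<le> b" if "K \<in> M" for K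
  proof -
    have "continuous_on K (restr v K)"
      using Cn1_continuous(1)[OF Pk_Cn1[OF Vh_restr(1)[OF assms(2,3) that]]] by (rule continuous_on_subset) simp
    then have "bounded (restr v K ` K)"
      using M(3)[OF that] by (intro compact_imp_bounded compact_continuous_image)
    then show ?thesis by (auto simp: bounded_iff)
  qed
  then obtain b where b: "\<And>K x. K \<in> M \<Longrightarrow> x \<in> K \<Longrightarrow> cmod (restr v K x) \<le> b K" by metis
  have "AE x in lebesgue. x \<in> K \<longrightarrow> v x = restr v K x" if "K \<in> M" for K
    using Vh_restr(2)[OF assms(2,3) that] Ks[OF that] by (subst (asm) AE_restrict_space_iff) auto
  then have "AE x in lebesgue. \<forall>K\<in>M. x \<in> K \<longrightarrow> v x = restr v K x" using M(1) by (intro AE_finite_allI)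
  then have "AE x in lebesgue. x \<in> \<Omega> \<longrightarrow> cmod (v x) \<le> (\<Sum>K\<in>M. \<bar>b K\<bar>)"
  proof eventually_elim
    case (elim x)
    show ?case
    proof
      assume "x \<in> \<Omega>"
      then obtain K where K: "K \<in> M" "x \<in> K" using M(2) closure_subset by blast
      have "cmod (v x) \<le> \<bar>b K\<bar>" using elim K b[OF K] by auto
      also have "\<dots> \<le> (\<Sum>K\<in>M. \<bar>b K\<bar>)" using M(1) K(1) by (intro member_le_sum) auto
      finally show "cmod (v x) \<le> (\<Sum>K\<in>M. \<bar>b K\<bar>)" .
    qed
  qed
  then have "AE x in lebesgue_on \<Omega>. cmod (v x) \<le> (\<Sum>K\<in>M. \<bar>b K\<bar>)"
    using assms(1) by (subst AE_restrict_space_iff) auto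
  then show ?thesis using assms(3) unfolding bounded_measurable_def Vh_iff L2_def by auto
qed

section \<open>Square integrability of the weak Laplacian of the initial value\<close>

lemma L2_AE_cong:
  assumes "\<Omega> \<in> sets lebesgue" "f \<in> L2 \<Omega>" "AE x in lebesgue_on \<Omega>. f x = g x"
  shows "g \<in> L2 \<Omega>"
proof -
  have fm: "f \<in> borel_measurable (lebesgue_on \<Omega>)" using assms(2) by (simp add: L2_def)
  have "(\<lambda>x. indicator \<Omega> x *\<^sub>R g x) \<in> borel_measurable lebesgue"
  proof (rule borel_measurable_AE)
    show "(\<lambda>x. indicator \<Omega> x *\<^sub>R f x) \<in> borel_measurable lebesgue"
      using fm assms(1) by (subst (asm) borel_measurable_restrict_space_iff) auto
    have "AE x in lebesgue. x \<in> \<Omega> \<longrightarrow> f x = g x"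
      using assms(1,3) by (subst (asm) AE_restrict_space_iff) auto
    then show "AE x in lebesgue. indicator \<Omega> x *\<^sub>R f x = indicator \<Omega> x *\<^sub>R g x"
      by eventually_elim (auto simp: indicator_def)
  qed
  then have [measurable]: "g \<in> borel_measurable (lebesgue_on \<Omega>)"
    using assms(1) by (subst borel_measurable_restrict_space_iff) auto
  have "integrable (lebesgue_on \<Omega>) (\<lambda>x. (cmod (g x))\<^sup>2)"
  proof (rule integrable_cong_AE_imp)
    show "integrable (lebesgue_on \<Omega>) (\<lambda>x. (cmod (f x))\<^sup>2)" using assms(2) by (simp add: L2_def)
    show "AE x in lebesgue_on \<Omega>. (cmod (f x))\<^sup>2 = (cmod (g x))\<^sup>2"
      using assms(3) by eventually_elim simp
  qed measurable
  then show ?thesis by (simp add: L2_def)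
qed

lemma Cn_partial_deriv_funpow:
  assumes "\<And>n. Cn n \<phi>" shows "Cn n ((partial_deriv i ^^ a) \<phi>)"
proof (induction a arbitrary: n)
  case 0 then show ?case using assms by simp
next
  case (Suc a)
  have "Cn (Suc n) ((partial_deriv i ^^ a) \<phi>)" by (rule Suc)
  then show ?case by simp
qed

lemma Cn_partial_deriv_measurable:
  assumes "\<And>n. Cn n \<phi>" shows "(partial_deriv i ^^ a) \<phi> \<in> borel_measurable borel"
  using Cn_partial_deriv_funpow[OF assms, of 0] by (intro borel_measurable_continuous_onI) simp

text \<open>Regularity is known for \<open>u 0\<close>, while the Ritz projection starts from
  \<open>u0\<close>, which agrees with it only almost everywhere; this lemma carries the weak
  derivatives over.\<close>

lemma has_weak_deriv_AE_cong:
  assumes "\<Omega> \<in> sets lebesgue" "has_weak_deriv \<Omega> a b f h" "AE x in lebesgue_on \<Omega>. f x = g x"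
  shows "has_weak_deriv \<Omega> a b g h"
proof -
  have f: "f \<in> L2 \<Omega>" using assms(2) by (simp add: has_weak_deriv_def)
  have g: "g \<in> L2 \<Omega>" by (rule L2_AE_cong[OF assms(1) f assms(3)])
  have "(LINT x|lebesgue_on \<Omega>. f x * \<psi> x) = (LINT x|lebesgue_on \<Omega>. g x * \<psi> x)"
    if "test_function \<Omega> \<phi>" "\<psi> = (partial_deriv 1 ^^ a) ((partial_deriv 2 ^^ b) \<phi>)" for \<phi> \<psi>
  proof (rule integral_cong_AE)
    have "\<psi> \<in> borel_measurable borel"
      unfolding that(2) using that(1)
      by (intro Cn_partial_deriv_measurable Cn_partial_deriv_funpow) (simp add: test_function_def)
    then have [measurable]: "\<psi> \<in> borel_measurable (lebesgue_on \<Omega>)"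
      by (intro measurable_restrict_space1 measurable_completion) simp
    have [measurable]: "f \<in> borel_measurable (lebesgue_on \<Omega>)" "g \<in> borel_measurable (lebesgue_on \<Omega>)"
      using f g by (auto simp: L2_def)
    show "(\<lambda>x. f x * \<psi> x) \<in> borel_measurable (lebesgue_on \<Omega>)" "(\<lambda>x. g x * \<psi> x) \<in> borel_measurable (lebesgue_on \<Omega>)"
      by measurable
    show "AE x in lebesgue_on \<Omega>. f x * \<psi> x = g x * \<psi> x" using assms(3) by eventually_elim simp
  qed
  note eq = this
  show ?thesis
    unfolding has_weak_deriv_def
  proof (intro conjI allI impI)
    show "h \<in> L2 \<Omega>" using assms(2) by (simp add: has_weak_deriv_def)
    fix \<phi> assume \<phi>: "test_function \<Omega> \<phi>"
    show "(LINT x|lebesgue_on \<Omega>. g x * (partial_deriv 1 ^^ a) ((partial_deriv 2 ^^ b) \<phi>) x)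
        = (-1) ^ (a + b) * (LINT x|lebesgue_on \<Omega>. h x * \<phi> x)"
      unfolding eq[OF \<phi> refl, symmetric] using assms(2) \<phi> by (simp add: has_weak_deriv_def)
  qed (rule g)
qed

text \<open>\<open>weak_deriv\<close> is a choice, so its square integrability follows from the
  existence of some weak derivative of that order.\<close>

lemma weak_laplacian_in_L2:
  assumes "\<Omega> \<in> sets lebesgue" "f \<in> Hm m \<Omega>" "m \<ge> 2" "AE x in lebesgue_on \<Omega>. f x = g x"
  shows "weak_laplacian \<Omega> g \<in> L2 \<Omega>"
proof -
  have "weak_deriv \<Omega> a b g \<in> L2 \<Omega>" if ab: "a + b \<le> m" for a b
  proof -
    obtain h where "has_weak_deriv \<Omega> a b f h" using assms(2) ab unfolding Hm_def by blast
    then have "has_weak_deriv \<Omega> a b g h" by (rule has_weak_deriv_AE_cong[OF assms(1) _ assms(4)])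
    then have "has_weak_deriv \<Omega> a b g (weak_deriv \<Omega> a b g)" unfolding weak_deriv_def
      by (rule someI[where P = "has_weak_deriv \<Omega> a b g"])
    then show ?thesis by (simp add: has_weak_deriv_def)
  qed
  from L2_add[OF this[of 2 0] this[of 0 2]] show ?thesis
    using assms(3) unfolding weak_laplacian_def[abs_def] by simp
qed

context CN_space
begin

text \<open>Testing the projection with itself bounds \<open>A r\<close> by the pairing of
  \<open>f\<close> with \<open>r\<close>. With the weight
  \<open>C * measure lebesgue \<Omega> + 1\<close> the part with \<open>mom 2 r\<close> costs at
  most half of \<open>A r\<close>. This is the mesh-independent starting bound for
  \<open>A\<close>.\<close>

lemma ritz_bound:
  assumes r: "r \<in> V" and eq: "a r r = - ip f r" and f: "f \<in> L2 \<Omega>"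
  shows "A r \<le> (C * measure lebesgue \<Omega> + 1) * (LINT x|lebesgue_on \<Omega>. (cmod (f x))\<^sup>2)"
proof -
  let ?t = "C * measure lebesgue \<Omega> + 1"
  let ?F = "LINT x|lebesgue_on \<Omega>. (cmod (f x))\<^sup>2"
  have t: "?t > 0" using C_pos by (simp add: add_nonneg_pos)
  have [measurable]: "f \<in> borel_measurable (lebesgue_on \<Omega>)" "r \<in> borel_measurable (lebesgue_on \<Omega>)"
    using f V_bounded[OF r] by (auto simp: L2_def bounded_measurable_def)
  have if2: "integrable (lebesgue_on \<Omega>) (\<lambda>x. (cmod (f x))\<^sup>2)" using f by (simp add: L2_def)
  have ir: "integrable (lebesgue_on \<Omega>) (\<lambda>x. cmod (r x) ^ 2)" by (rule mom_integrable[OF V_bounded[OF r]])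
  have ib: "integrable (lebesgue_on \<Omega>) (\<lambda>x. ?t * ((cmod (f x))\<^sup>2 / 2) + (cmod (r x))\<^sup>2 / (2 * ?t))"
    using if2 ir by simp
  have pw: "norm (f x * cnj (r x)) \<le> ?t * ((cmod (f x))\<^sup>2 / 2) + (cmod (r x))\<^sup>2 / (2 * ?t)" for x
    using weighted_product_le[OF t, of "cmod (r x)" "cmod (f x)"] by (simp add: norm_mult mult.commute)
  have "A r \<le> cmod (ip f r)" using eq complex_Re_le_cmod[of "a r r"] by simp
  also have "\<dots> \<le> (LINT x|lebesgue_on \<Omega>. ?t * ((cmod (f x))\<^sup>2 / 2) + (cmod (r x))\<^sup>2 / (2 * ?t))"
    unfolding L2_inner_def
  proof (rule Bochner_Integration.integral_norm_bound_integral[OF _ ib pw])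
    show "integrable (lebesgue_on \<Omega>) (\<lambda>x. f x * cnj (r x))"
    proof (rule Bochner_Integration.integrable_bound[OF ib])
      have "(\<lambda>x. cnj (r x)) \<in> borel_measurable (lebesgue_on \<Omega>)"
        using bounded_measurable_cnj[OF V_bounded[OF r]] by (simp add: bounded_measurable_def)
      then show "(\<lambda>x. f x * cnj (r x)) \<in> borel_measurable (lebesgue_on \<Omega>)" by measurable
      show "AE x in lebesgue_on \<Omega>. norm (f x * cnj (r x)) \<le> norm (?t * ((cmod (f x))\<^sup>2 / 2) + (cmod (r x))\<^sup>2 / (2 * ?t))"
        by (intro AE_I2 order_trans[OF pw]) (simp only: real_norm_def abs_ge_self)
    qed
  qed
  also have "\<dots> = ?t * (?F / 2) + mom 2 r / (2 * ?t)"
    unfolding mom_def using if2 ir by simp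
  also have "mom 2 r / (2 * ?t) \<le> A r / 2"
  proof -
    have "mom 2 r \<le> C * measure lebesgue \<Omega> * A r" by (rule mom2_le[OF r])
    also have "\<dots> \<le> ?t * A r" using nonneg[OF r] by (intro mult_right_mono) auto
    finally have "mom 2 r / (2 * ?t) \<le> ?t * A r / (2 * ?t)" using t by (intro divide_right_mono) auto
    also have "?t * A r / (2 * ?t) = A r / 2"
    proof -
      have "s * x / (2 * s) = x / 2" if "s > 0" for s x :: real using that by simp
      then show ?thesis using t by blast
    qed
    finally show ?thesis .
  qed
  finally have "A r \<le> ?t * (?F / 2) + A r / 2" by simp
  then show ?thesis by simp
qed

end

theorem theorem3p4:
  fixes \<Omega> :: "R2 set"
    and T \<nu> \<alpha> \<kappa> \<beta> \<gamma> lam :: real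
    and k :: nat
    and mesh :: "nat \<Rightarrow> R2 set set"
    and nrm :: "nat \<Rightarrow> R2 set \<Rightarrow> R2"
    and u0 :: "R2 \<Rightarrow> complex"
    and u :: "real \<Rightarrow> R2 \<Rightarrow> complex"
  assumes "convex_polygonal_domain \<Omega>"
    and "T > 0" and "\<nu> > 0" and "\<kappa> > 0" and "k \<ge> 1"
    and "GL_solution (k + 1) \<Omega> T \<nu> \<alpha> \<kappa> \<beta> \<gamma> u0 u"
    and "\<And>j. conforming_mesh \<Omega> (mesh j)"
    and "quasi_uniform mesh"
    and "\<And>j. edge_normals \<Omega> (mesh j) (nrm j)"
    and "penalty_admissible k \<Omega> mesh nrm lam"
  shows "\<exists>\<tau>\<^sub>0>0. \<forall>j N. N \<ge> 1 \<and> T / real N \<le> \<tau>\<^sub>0 \<longrightarrow>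
    (\<forall>U V. CN_DG_solution k \<Omega> (mesh j) (nrm j) lam \<nu> \<alpha> \<kappa> \<beta> \<gamma> u0 N (T / real N) U \<and>
           CN_DG_solution k \<Omega> (mesh j) (nrm j) lam \<nu> \<alpha> \<kappa> \<beta> \<gamma> u0 N (T / real N) V \<longrightarrow>
       (\<forall>n\<le>N. AE x in lebesgue_on \<Omega>. U n x = V n x))"
proof -
  let ?V = "\<lambda>j. Vh k \<Omega> (mesh j)"
  let ?a = "\<lambda>j. ah \<Omega> (mesh j) (nrm j) lam"
  let ?sol = "\<lambda>j N. CN_DG_solution k \<Omega> (mesh j) (nrm j) lam \<nu> \<alpha> \<kappa> \<beta> \<gamma> u0 N (T / real N)"
  have dom: "open \<Omega>" "convex \<Omega>" "bounded \<Omega>" using assms(1) by (auto simp: convex_polygonal_domain_def)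
  have lm: "\<Omega> \<in> lmeasurable" using dom by (simp add: lmeasurable_open)
  obtain P where P: "P > 0" and coer: "\<And>j v. v \<in> ?V j \<Longrightarrow>
        P * (DG_norm \<Omega> (mesh j) (nrm j) v)\<^sup>2 \<le> Re (?a j v v)"
    using assms(10) unfolding penalty_admissible_def by blast
  define ml where "ml = measure lebesgue \<Omega>"
  have "\<exists>G>0. \<forall>j. \<forall>v\<in>?V j. (LINT x|lebesgue_on \<Omega>. cmod (v x) ^ (2 * m))
      \<le> G * (DG_norm \<Omega> (mesh j) (nrm j) v)\<^sup>2 * (LINT x|lebesgue_on \<Omega>. cmod (v x) ^ (2 * (m - 1)))"
    if "m \<in> {1,2,3}" for m
    using that by (intro broken_Gagliardo_Nirenberg dom(1,2) assms(7,8,9)) auto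
  then obtain G where G: "\<And>m. m \<in> {1,2,3} \<Longrightarrow> G m > (0::real)"
    and GN: "\<And>m j v. m \<in> {1,2,3} \<Longrightarrow> v \<in> ?V j \<Longrightarrow> (LINT x|lebesgue_on \<Omega>. cmod (v x) ^ (2 * m))
      \<le> G m * (DG_norm \<Omega> (mesh j) (nrm j) v)\<^sup>2 * (LINT x|lebesgue_on \<Omega>. cmod (v x) ^ (2 * (m - 1)))"
    by metis
  \<comment> \<open>One constant for all three exponents; the coercivity constant \<open>P\<close>
    replaces the DG norm by the form itself.\<close>
  define C where "C = (G 1 + G 2 + G 3) / P"
  have Cpos: "C > 0" unfolding C_def using G[of 1] G[of 2] G[of 3] P by simp
  have scheme: "CN_scheme \<Omega> (?V j) (?a j) C \<nu> \<kappa>" for j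
  proof -
    interpret dg_mesh \<Omega> "mesh j" "nrm j" k by unfold_locales (rule dom(1) assms(7) assms(9))+
    show ?thesis
    proof
      show "(\<lambda>x. u x + v x) \<in> ?V j" if "u \<in> ?V j" "v \<in> ?V j" for u v
        by (rule Vh_add(1)[OF assms(7) that])
      show "(\<lambda>x. c * u x) \<in> ?V j" if "u \<in> ?V j" for u c
        by (rule Vh_cmult(1)[OF assms(7) that])
      show "?a j (\<lambda>x. u x + w x) v = ?a j u v + ?a j w v"
        if "u \<in> ?V j" "w \<in> ?V j" "v \<in> ?V j" for u w v
        by (rule ah_add_left[OF that])
      show "?a j (\<lambda>x. c * u x) v = c * ?a j u v"
        if "u \<in> ?V j" "v \<in> ?V j" for u v c
        by (rule ah_cmult_left[OF that])
      show "?a j v u = cnj (?a j u v)"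
        if "u \<in> ?V j" "v \<in> ?V j" for u v
        by (rule ah_hermitian[OF that])
      show "0 \<le> Re (?a j v v)" if "v \<in> ?V j" for v
        by (rule order_trans[OF _ coer[OF that]]) (use P in simp)
      show "\<Omega> \<in> lmeasurable" by (rule lm)
      show "bounded_measurable \<Omega> v" if "v \<in> ?V j" for v
        by (rule Vh_bounded_measurable[OF dom(1) assms(7) that])
      show "C > 0" by (rule Cpos)
      show "\<nu> > 0" "\<kappa> > 0" by (rule assms(3,4))+
      fix v m assume v: "v \<in> ?V j" and m: "m \<in> {1, 2, 3::nat}"
      let ?D = "(DG_norm \<Omega> (mesh j) (nrm j) v)\<^sup>2" and ?I = "LINT x|lebesgue_on \<Omega>. cmod (v x) ^ (2 * (m - 1))"
      have "(LINT x|lebesgue_on \<Omega>. cmod (v x) ^ (2 * m)) \<le> G m * ?D * ?I" by (rule GN[OF m v])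
      also have "\<dots> \<le> (G 1 + G 2 + G 3) * ?D * ?I"
        using m G[of 1] G[of 2] G[of 3] by (intro mult_right_mono) auto
      also have "\<dots> = C * (P * ?D) * ?I" using P by (simp add: C_def)
      also have "\<dots> \<le> C * Re (?a j v v) * ?I"
        using Cpos coer[OF v] by (intro mult_right_mono mult_left_mono) auto
      finally show "(LINT x|lebesgue_on \<Omega>. cmod (v x) ^ (2 * m)) \<le> C * Re (?a j v v) * ?I" .
    qed
  qed
  have lap: "weak_laplacian \<Omega> u0 \<in> L2 \<Omega>"
  proof (rule weak_laplacian_in_L2)
    show "\<Omega> \<in> sets lebesgue" using dom(1) by simp
    have "C_time (Suc 2) (k + 1) \<Omega> T u" using assms(6) by (simp add: GL_solution_def numeral_3_eq_3)
    then have "\<forall>t\<in>{0..T}. u t \<in> Hm (k + 1) \<Omega> \<inter> H10 \<Omega>" unfolding C_time.simps(2) by blast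
    then show "u 0 \<in> Hm (k + 1) \<Omega>" using assms(2) by simp
    show "2 \<le> k + 1" using assms(5) by simp
    show "AE x in lebesgue_on \<Omega>. u 0 x = u0 x" using assms(6) by (simp add: GL_solution_def)
  qed
  define A0 where "A0 = (C * ml + 1) * (LINT x|lebesgue_on \<Omega>. (cmod (weak_laplacian \<Omega> u0 x))\<^sup>2)"
  define c2 where "c2 = cmod (Complex \<kappa> \<beta>)"
  define B where "B = C * ml * A0 + 2 * T * (ml * \<gamma>\<^sup>2 / (4 * \<kappa>))"
  define K where "K = (c2\<^sup>2 * C\<^sup>2 * B + \<gamma>\<^sup>2 * (C * ml)) / \<nu>"
  define m where "m = (1 + A0) * exp (3 * K * B / (4 * \<nu>))"
  \<comment> \<open>Outside its locale \<open>step_bound\<close> takes the domain, \<open>C\<close>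
    and the coefficients as arguments, but neither the space nor the form, so \<open>sb\<close> is
    the same number for every mesh.\<close>
  define sb where "sb = CN_scheme.step_bound \<Omega> C \<nu> \<alpha> \<kappa> \<beta> \<gamma> m"
  \<comment> \<open>The sum of three nonnegative coefficients, one for each smallness condition on
    \<open>\<tau>\<close>; the threshold \<open>1 / (1 + Q)\<close> meets them all, also when
    \<open>Q = 0\<close>.\<close>
  define Q where "Q = 3/2 * \<bar>\<gamma>\<bar> + K * (2 * (2 * sb / \<nu> + m)) + (\<bar>\<gamma>\<bar> + 9 * c2\<^sup>2 * C * (4 * sb / \<kappa>) / (8 * \<nu>))"
  have A00: "A0 \<ge> 0" unfolding A0_def ml_def using Cpos by (intro mult_nonneg_nonneg add_nonneg_nonneg) auto
  have B0: "B \<ge> 0" unfolding B_def ml_def using Cpos A00 assms(2,4) by (intro add_nonneg_nonneg mult_nonneg_nonneg divide_nonneg_nonneg) auto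
  have K0: "K \<ge> 0" unfolding K_def ml_def using B0 Cpos assms(3) by (intro divide_nonneg_nonneg add_nonneg_nonneg mult_nonneg_nonneg) auto
  have m0: "m \<ge> 0" unfolding m_def using A00 by simp
  have sb0: "sb \<ge> 0" unfolding sb_def by (rule CN_scheme.step_bound_nonneg[OF scheme m0])
  have q1: "0 \<le> 3/2 * \<bar>\<gamma>\<bar>" by simp
  have q2: "0 \<le> K * (2 * (2 * sb / \<nu> + m))" using K0 sb0 m0 assms(3) by simp
  have q3: "0 \<le> \<bar>\<gamma>\<bar> + 9 * c2\<^sup>2 * C * (4 * sb / \<kappa>) / (8 * \<nu>)" using sb0 Cpos assms(3,4) by simp
  show ?thesis
  proof (intro exI[of _ "1 / (1 + Q)"] conjI allI impI)
    have Q0: "Q \<ge> 0" unfolding Q_def using q1 q2 q3 by linarith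
    then show "1 / (1 + Q) > 0" by simp
    fix j N U V n
    assume N: "N \<ge> 1 \<and> T / real N \<le> 1 / (1 + Q)"
      and UV: "?sol j N U \<and>
           ?sol j N V"
      and n: "n \<le> N"
    let ?\<tau> = "T / real N"
    have tau: "?\<tau> > 0" "real N * ?\<tau> \<le> T" using N assms(2) by auto
    have tQ: "?\<tau> * Q \<le> 1"
    proof -
      have "?\<tau> * Q \<le> 1 / (1 + Q) * Q" using N Q0 by (intro mult_right_mono) auto
      also have "\<dots> \<le> 1" using Q0 by (simp add: field_simps)
      finally show ?thesis .
    qed
    have small: "x * ?\<tau> \<le> 1" if "x \<le> Q" for x
      using mult_left_mono[OF that, of ?\<tau>] tau(1) tQ by (simp add: mult.commute)
    interpret CN_scheme \<Omega> "?V j" "?a j" C \<nu> \<alpha> \<kappa> \<beta> \<gamma>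
      by (rule scheme)
    have sol: "W n \<in> ?V j" if "?sol j N W" "n \<le> N" for W n
      using that by (simp add: CN_DG_solution_def)
    have stepW: "CN_step ?\<tau> (W (n - 1)) (midpt W n)"
      if W: "?sol j N W" and n: "n \<in> {1..N}" for W n
      unfolding CN_step_def
    proof
      fix v assume v: "v \<in> ?V j"
      have "D_tau ?\<tau> W n = (\<lambda>x. of_real (2 / ?\<tau>) * (midpt W n x - W (n - 1) x))"
      proof
        fix x
        have mid: "midpt W n x - W (n - 1) x = (W n x - W (n - 1) x) / 2" by (simp add: midpt_def field_simps)
        show "D_tau ?\<tau> W n x = of_real (2 / ?\<tau>) * (midpt W n x - W (n - 1) x)"
          unfolding mid D_tau_def by simp
      qed
      then have D: "ip (D_tau ?\<tau> W n) v = of_real (2 / ?\<tau>) * ip (\<lambda>x. midpt W n x - W (n - 1) x) v"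
        by (simp only: ip_cmult_left)
      have N: "(\<lambda>x. of_real ((cmod (midpt W n x))\<^sup>2) * midpt W n x) = cubic (midpt W n)"
        by (simp add: fun_eq_iff cubic_def)
      have "ip (D_tau ?\<tau> W n) v + Complex \<nu> \<alpha> * ?a j (midpt W n) v
         + Complex \<kappa> \<beta> * ip (\<lambda>x. of_real ((cmod (midpt W n x))\<^sup>2) * midpt W n x) v - of_real \<gamma> * ip (midpt W n) v = 0"
        using W n v unfolding CN_DG_solution_def by blast
      then show "of_real (2 / ?\<tau>) * ip (\<lambda>x. midpt W n x - W (n - 1) x) v + Complex \<nu> \<alpha> * ?a j (midpt W n) v
         + Complex \<kappa> \<beta> * ip (cubic (midpt W n)) v - of_real \<gamma> * ip (midpt W n) v = 0"
        unfolding D N .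
    qed
    have ritz: "?a j (W 0) v = - ip (weak_laplacian \<Omega> u0) v"
      if W: "?sol j N W" and v: "v \<in> ?V j" for W v
      using that unfolding CN_DG_solution_def is_ritz_projection_def by blast
    have startW: "A (W 0) \<le> A0"
      if W: "?sol j N W" for W
      unfolding A0_def ml_def using sol[OF W, of 0] by (intro ritz_bound ritz[OF W] lap) auto
    \<comment> \<open>Both starting values are Ritz projections of the same function, so the form
      vanishes on their difference, and \<open>mom2_le\<close> turns this into equality almost
      everywhere.\<close>
    have start: "AE x in lebesgue_on \<Omega>. U 0 x = V 0 x"
    proof -
      let ?e = "\<lambda>x. U 0 x - V 0 x"
      have UV0: "U 0 \<in> ?V j" "V 0 \<in> ?V j" using sol UV by auto
      have e: "?e \<in> ?V j" by (rule V_diff[OF UV0])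
      have "?a j ?e ?e = 0"
        unfolding diff_left[OF UV0 e] using ritz e UV by simp
      then have "mom 2 ?e \<le> 0" using mom2_le[OF e] by simp
      then have "mom 2 ?e = 0" using mom_nonneg[of 2 ?e] by linarith
      then have "AE x in lebesgue_on \<Omega>. cmod (?e x) ^ 2 = 0"
        unfolding mom_def using mom_integrable[OF V_bounded[OF e], of 2]
        by (subst (asm) integral_nonneg_eq_0_iff_AE) auto
      then show ?thesis by eventually_elim simp
    qed
    show "AE x in lebesgue_on \<Omega>. U n x = V n x"
    proof (rule scheme_unique[where N = N and \<tau> = ?\<tau> and T = T and ?A0.0 = A0 and B = B and K = K and m = m])
      show "U n \<in> ?V j" "V n \<in> ?V j" if "n \<le> N" for n using sol UV that by auto
      show "CN_step ?\<tau> (U (n - 1)) (midpt U n)" "CN_step ?\<tau> (V (n - 1)) (midpt V n)" if "n \<in> {1..N}" for n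
        using stepW UV that by auto
      show "A (U 0) \<le> A0" "A (V 0) \<le> A0" using startW UV by auto
      show "3/2 * \<bar>\<gamma>\<bar> * ?\<tau> \<le> 2"
      proof -
        have "3/2 * \<bar>\<gamma>\<bar> \<le> Q" unfolding Q_def using q2 q3 by linarith
        from small[OF this] show ?thesis by (rule order_trans) simp
      qed
      show "K * ?\<tau> * (2 * (2 * step_bound m / \<nu> + m)) \<le> 1"
        using small[of "K * (2 * (2 * sb / \<nu> + m))"] q1 q3 unfolding sb_def Q_def by (simp add: mult_ac)
      show "?\<tau> * (\<bar>\<gamma>\<bar> + 9 * (cmod (Complex \<kappa> \<beta>))\<^sup>2 * C * (4 * step_bound m / \<kappa>) / (8 * \<nu>)) \<le> 1"
        using small[of "\<bar>\<gamma>\<bar> + 9 * c2\<^sup>2 * C * (4 * sb / \<kappa>) / (8 * \<nu>)"] q1 q2 unfolding sb_def Q_def c2_def by (simp add: mult.commute)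
    qed (use start tau n B_def K_def m_def ml_def c2_def in auto)
  qed
qed

end
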